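(* Let $\mathcal{T}_n$ denote the set of all plane triangulations with $n$ vertices and, for $T\in\mathcal{T}_n$, let $\mathcal{S}(T)$ be the set of Schnyder woods of $T$. Then $$2.37^n\le \max_{T\in\mathcal{T}_n}|\mathcal{S}(T)|\le 3.56^n,$$ where the lower bound is asserted for all sufficiently large $n$ and the upper bound for all $n\ge 3$.
   Context: A planar map is a finite simple planar graph with a fixed crossing-free embedding in the plane; a plane triangulation is a planar map all of whose faces (including the outer face) are triangles. Let $M$ be a planar map with three vertices $a_1,a_2,a_3$ occurring in clockwise order on the outer face (for a triangulation these are the three outer vertices). The suspension $M^\sigma$ of $M$ is obtained by attaching to each of the special vertices $a_1,a_2,a_3$ a half-edge reaching into the outer face. A Schnyder wood of $M$ (rooted at $a_1,a_2,a_3$) is an orientation and coloring of the edges of $M^\sigma$ with the colors $1,2,3$ (indices cyclic modulo 3) such that: (W1) every edge is oriented in one direction or in two opposite directions; the directions of edges are colored such that if an edge is bidirected, the two directions have distinct colors. (W2) The half-edge at $a_i$ is directed outwards and has color $i$. (W3) Every vertex $v$ has out-degree one in each color; the edges $e_1,e_2,e_3$ leaving $v$ in colors $1,2,3$ occur in clockwise order; each edge entering $v$ in color $i$ enters $v$ in the clockwise sector from $e_{i+1}$ to $e_{i-1}$. (W4) There is no interior face whose boundary is a monochromatic directed cycle. The Schnyder woods of $T$ are counted with respect to a fixed labeling $a_1,a_2,a_3$ of the outer vertices in clockwise order. *)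

theory Defs
  imports
    Complex_Main
    "HOL-Library.Numeral_Type"
    "HOL-Combinatorics.Orbits"
    "Graph_Theory.Graph_Theory"
begin

section \<open>Plane maps\<close>

text \<open>
  A crossing-free embedding of a connected simple graph is represented, up to
  orientation-preserving homeomorphism of the plane, by a combinatorial map with a
  distinguished outer face. The arc \<open>(u, v)\<close> is the edge \<open>uv\<close> seen from \<open>u\<close>;
  \<open>rot\<close> maps it to the next arc at \<open>u\<close> in clockwise order. That the embedding is in the
  sphere, hence in the plane once a face is chosen as outer, is expressed by Euler
  characteristic 2, as usual for combinatorial maps.
\<close>

record 'v plane_map =
  graph :: "'v pair_pre_digraph"
  rot :: "'v \<times> 'v \<Rightarrow> 'v \<times> 'v"
  outer :: "('v \<times> 'v) set"

abbreviation vertices :: "'v plane_map \<Rightarrow> 'v set" where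
  "vertices M \<equiv> pverts (graph M)"

abbreviation edge_arcs :: "'v plane_map \<Rightarrow> ('v \<times> 'v) set" where
  "edge_arcs M \<equiv> parcs (graph M)"

text \<open>
  A face is the set of arcs having it on their left. Since \<open>rot\<close> is clockwise, the arc
  following \<open>(u, v)\<close> on the boundary of that face is \<open>rot (v, u)\<close>. Interior faces are thus
  traversed counterclockwise, and the outer face is traversed clockwise.
\<close>

definition face_succ :: "'v plane_map \<Rightarrow> 'v \<times> 'v \<Rightarrow> 'v \<times> 'v" where
  "face_succ M d = rot M (prod.swap d)"

definition faces :: "'v plane_map \<Rightarrow> ('v \<times> 'v) set set" where
  "faces M = orbit (face_succ M) ` edge_arcs M"

text \<open>Every edge contributes two arcs, so the number of edges is half the number of arcs.\<close>

definition planar_map :: "'v plane_map \<Rightarrow> bool" where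
  "planar_map M \<longleftrightarrow>
     pair_graph (graph M) \<and> connected (with_proj (graph M)) \<and>
     rot M permutes edge_arcs M \<and>
     (\<forall>v \<in> vertices M. {d \<in> edge_arcs M. fst d = v} \<noteq> {} \<longrightarrow>
        cyclic_on (rot M) {d \<in> edge_arcs M. fst d = v}) \<and>
     int (card (vertices M)) - int (card (edge_arcs M) div 2) + int (card (faces M)) = 2 \<and>
     outer M \<in> faces M"

text \<open>
  In a graph without loops and parallel edges, a face with three arcs is bounded by three
  distinct vertices.
\<close>

definition plane_triangulation :: "'v plane_map \<Rightarrow> bool" where
  "plane_triangulation M \<longleftrightarrow> planar_map M \<and> (\<forall>F \<in> faces M. card F = 3)"

text \<open>
  Colours and the indices of the outer vertices live in the type \<open>3\<close> of integers
  modulo 3, in which \<open>3 = 0\<close>. As the outer face is traversed clockwise, the condition below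
  says that \<open>a 1\<close>, \<open>a 2\<close>, \<open>a 3\<close> are the three outer vertices of the triangulation \<open>M\<close>
  in clockwise order.
\<close>

definition outer_labeling :: "'v plane_map \<Rightarrow> (3 \<Rightarrow> 'v) \<Rightarrow> bool" where
  "outer_labeling M a \<longleftrightarrow> (\<forall>i. (a i, a (i + 1)) \<in> outer M)"

text \<open>
  Triangulations with \<open>n\<close> vertices, each with a labeling of its outer vertices. The vertices
  may be any \<open>n\<close> natural numbers, so this set is infinite; the number of Schnyder woods is
  nevertheless bounded for fixed \<open>n\<close>, so its maximum over this set is meaningful for
  \<open>n \<ge> 3\<close>.
\<close>

definition triangulations :: "nat \<Rightarrow> (nat plane_map \<times> (3 \<Rightarrow> nat)) set" where
  "triangulations n =
     {(M, a). plane_triangulation M \<and> card (vertices M) = n \<and> outer_labeling M a}"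


section \<open>Suspension\<close>

datatype 'v dart = Edge "'v \<times> 'v" | Half 'v

definition darts_at :: "'v plane_map \<Rightarrow> (3 \<Rightarrow> 'v) \<Rightarrow> 'v \<Rightarrow> 'v dart set" where
  "darts_at M a v =
     Edge ` {d \<in> edge_arcs M. fst d = v} \<union> (if v \<in> range a then {Half v} else {})"

text \<open>
  Clockwise rotation in the suspension. The half-edge at \<open>a i\<close> is inserted in the corner of
  the outer face at \<open>a i\<close>, that is, just before the arc of the outer face that starts at
  \<open>a i\<close>; in a triangulation this arc is unique.
\<close>

fun susp_rot :: "'v plane_map \<Rightarrow> (3 \<Rightarrow> 'v) \<Rightarrow> 'v dart \<Rightarrow> 'v dart" where
  "susp_rot M a (Edge d) =
     (if fst d \<in> range a \<and> rot M d \<in> outer M then Half (fst d) else Edge (rot M d))"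
| "susp_rot M a (Half v) = Edge (THE d. d \<in> outer M \<and> fst d = v)"

text \<open>
  The closed sector from \<open>x\<close> to \<open>y\<close>: what is met when following \<open>f\<close> from \<open>x\<close> until
  \<open>y\<close> is reached for the first time, both ends included.
\<close>

definition sector :: "('d \<Rightarrow> 'd) \<Rightarrow> 'd \<Rightarrow> 'd \<Rightarrow> 'd set" where
  "sector f x y = (\<lambda>k. (f ^^ k) x) ` {..(LEAST k. (f ^^ k) x = y)}"


section \<open>Schnyder woods\<close>

text \<open>
  An orientation and colouring is a function \<open>c\<close> on darts: \<open>c (Edge (u, v)) = Some i\<close> means
  that the edge \<open>uv\<close> is directed from \<open>u\<close> to \<open>v\<close> with colour \<open>i\<close> (it may in addition be
  directed from \<open>v\<close> to \<open>u\<close>), and \<open>None\<close> means that it is not directed from \<open>u\<close> to \<open>v\<close>.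
  \<open>c (Half v)\<close> is the colour of the half-edge at \<open>v\<close>, directed outwards.
\<close>

definition out_dart ::
  "'v plane_map \<Rightarrow> (3 \<Rightarrow> 'v) \<Rightarrow> ('v dart \<Rightarrow> 3 option) \<Rightarrow> 'v \<Rightarrow> 3 \<Rightarrow> 'v dart" where
  "out_dart M a c v i = (THE d. d \<in> darts_at M a v \<and> c d = Some i)"

definition W1 :: "'v plane_map \<Rightarrow> ('v dart \<Rightarrow> 3 option) \<Rightarrow> bool" where
  "W1 M c \<longleftrightarrow> (\<forall>(u, v) \<in> edge_arcs M.
     (c (Edge (u, v)) \<noteq> None \<or> c (Edge (v, u)) \<noteq> None) \<and>
     (c (Edge (u, v)) \<noteq> None \<and> c (Edge (v, u)) \<noteq> None \<longrightarrow> c (Edge (u, v)) \<noteq> c (Edge (v, u))))"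

definition W2 :: "(3 \<Rightarrow> 'v) \<Rightarrow> ('v dart \<Rightarrow> 3 option) \<Rightarrow> bool" where
  "W2 a c \<longleftrightarrow> (\<forall>i. c (Half (a i)) = Some i)"

text \<open>
  An edge entering \<open>v\<close> from \<open>u\<close> is seen at \<open>v\<close> as the dart \<open>Edge (v, u)\<close>. The sectors must
  be closed: a bidirected edge enters \<open>v\<close> while being one of the edges leaving \<open>v\<close>.
\<close>

definition W3 :: "'v plane_map \<Rightarrow> (3 \<Rightarrow> 'v) \<Rightarrow> ('v dart \<Rightarrow> 3 option) \<Rightarrow> bool" where
  "W3 M a c \<longleftrightarrow> (\<forall>v \<in> vertices M.
     (\<forall>i. \<exists>!d. d \<in> darts_at M a v \<and> c d = Some i) \<and>
     out_dart M a c v 2 \<in> sector (susp_rot M a) (out_dart M a c v 1) (out_dart M a c v 3) \<and>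
     (\<forall>u i. (u, v) \<in> edge_arcs M \<and> c (Edge (u, v)) = Some i \<longrightarrow>
        Edge (v, u) \<in>
          sector (susp_rot M a) (out_dart M a c v (i + 1)) (out_dart M a c v (i - 1))))"

text \<open>The boundary of a face can be a directed cycle in either of its two directions.\<close>

definition W4 :: "'v plane_map \<Rightarrow> ('v dart \<Rightarrow> 3 option) \<Rightarrow> bool" where
  "W4 M c \<longleftrightarrow> \<not> (\<exists>F \<in> faces M - {outer M}. \<exists>i.
     (\<forall>d \<in> F. c (Edge d) = Some i) \<or> (\<forall>d \<in> F. c (Edge (prod.swap d)) = Some i))"

text \<open>
  The first condition fixes the value of \<open>c\<close> outside the suspension, so that distinct
  functions are distinct orientations and colourings.
\<close>

definition schnyder_woods ::
  "'v plane_map \<Rightarrow> (3 \<Rightarrow> 'v) \<Rightarrow> ('v dart \<Rightarrow> 3 option) set" where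
  "schnyder_woods M a =
     {c. (\<forall>d. d \<notin> (\<Union>v \<in> vertices M. darts_at M a v) \<longrightarrow> c d = None) \<and>
         W1 M c \<and> W2 a c \<and> W3 M a c \<and> W4 M c}"

end

theory Submission
  imports Defs
begin

lemma cyclic_on_index:
  assumes "cyclic_on f S" "x \<in> S"
  shows "(f ^^ card S) x = x"
    and "inj_on (\<lambda>k. (f ^^ k) x) {..<card S}"
    and "S = (\<lambda>k. (f ^^ k) x) ` {..<card S}"
    and "0 < card S"
proof -
  have S: "orbit f x = S" "x \<in> orbit f x" using assms by (auto simp: cyclic_on_alldef)
  let ?m = "funpow_dist1 f x x"
  have *: "S = (\<lambda>k. (f ^^ k) x) ` {..<?m}" "inj_on (\<lambda>k. (f ^^ k) x) {..<?m}"
    using orbit_conv_funpow_dist1[OF S(2)] inj_on_funpow_dist1[OF S(2)] S(1)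
    by (simp_all add: lessThan_atLeast0)
  then have "card S = ?m" by (metis card_image card_lessThan)
  then show "(f ^^ card S) x = x" "inj_on (\<lambda>k. (f ^^ k) x) {..<card S}"
    "S = (\<lambda>k. (f ^^ k) x) ` {..<card S}" "0 < card S"
    using * funpow_dist1_prop[OF S(2)] by simp_all
qed

lemma cyclic_on_eq_iff_mod:
  assumes "cyclic_on f S" "x \<in> S"
  shows "(f ^^ k) x = (f ^^ l) x \<longleftrightarrow> k mod card S = l mod card S"
proof -
  note c = cyclic_on_index[OF assms]
  have "(f ^^ k) x = (f ^^ l) x \<longleftrightarrow> (f ^^ (k mod card S)) x = (f ^^ (l mod card S)) x"
    using c(1) by (simp add: funpow_mod_eq)
  also have "\<dots> \<longleftrightarrow> k mod card S = l mod card S"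
    using inj_onD[OF c(2)] c(4) by auto
  finally show ?thesis .
qed

lemma cyclic_on_window:
  assumes "cyclic_on f S" "x \<in> S" "(f ^^ k) x = (f ^^ l) x" "k \<le> l" "l < k + card S"
  shows "k = l"
proof (rule ccontr)
  assume "k \<noteq> l"
  then have "0 < l - k" "l - k < card S" using assms by auto
  moreover have "card S dvd l - k"
    using assms(3) assms(4) cyclic_on_eq_iff_mod[OF assms(1,2)] by (metis mod_eq_dvd_iff_nat)
  ultimately show False by (auto dest: dvd_imp_le)
qed

lemma sector_index:
  assumes "cyclic_on f S" "x \<in> S" "p \<le> q" "q < p + card S"
  shows "sector f ((f ^^ p) x) ((f ^^ q) x) = (\<lambda>l. (f ^^ l) x) ` {p..q}"
proof -
  have add: "(f ^^ k) ((f ^^ p) x) = (f ^^ (k + p)) x" for k by (simp add: funpow_add)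
  have "(LEAST k. (f ^^ k) ((f ^^ p) x) = (f ^^ q) x) = q - p"
  proof (rule Least_equality)
    fix k assume "(f ^^ k) ((f ^^ p) x) = (f ^^ q) x"
    then show "q - p \<le> k"
      using cyclic_on_window[OF assms(1,2), of "k + p" q] assms(4) by (force simp: add)
  qed (simp add: add assms(3))
  moreover have "(\<lambda>k. (f ^^ (k + p)) x) ` {..q - p} = (\<lambda>l. (f ^^ l) x) ` {p..q}"
  proof -
    have "(\<lambda>k. k + p) ` {..q - p} = {p..q}"
      using image_add_atLeastAtMost'[of p 0 "q - p"] assms(3) by (simp add: atMost_atLeast0)
    then show ?thesis using image_image[of "\<lambda>l. (f ^^ l) x" "\<lambda>k. k + p" "{..q - p}"] by simp
  qed
  ultimately show ?thesis by (simp add: sector_def add)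
qed

lemma three_cases:
  fixes i :: 3
  obtains "i = 0" | "i = 1" | "i = 2"
proof (cases i)
  case (of_int z)
  then have "z = 0 \<or> z = 1 \<or> z = 2" by auto
  then show ?thesis using of_int that by auto
qed

lemma three_arith [simp]:
  fixes i :: 3
  shows "(3 :: 3) = 0" "i + 1 + 1 = i + 2" "i + 1 + 2 = i" "i + 2 + 1 = i" "i + 2 + 2 = i + 1"
    "i - 1 = i + 2" "i - 2 = i + 1"
    "i + 1 \<noteq> i" "i + 2 \<noteq> i" "i \<noteq> i + 1" "i \<noteq> i + 2" "i + 1 \<noteq> i + 2" "i + 2 \<noteq> i + 1"
  by (rule three_cases[of i]; simp)+

lemma three_total: "j = i \<or> j = i + 1 \<or> j = i + 2" for i j :: 3
  by (rule three_cases[of i]; rule three_cases[of j]; simp)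

definition cyclic_triple :: "('d \<Rightarrow> 'd) \<Rightarrow> 'd set \<Rightarrow> (3 \<Rightarrow> 'd) \<Rightarrow> bool" where
  "cyclic_triple f S e \<longleftrightarrow> cyclic_on f S \<and>
     (\<forall>i. e i \<in> S \<and> (\<exists>p q. 0 < p \<and> p < q \<and> q < card S \<and>
        e (i + 1) = (f ^^ p) (e i) \<and> e (i + 2) = (f ^^ q) (e i)))"

lemma cyclic_triple_rotate:
  assumes "cyclic_on f S" "x \<in> S" "0 < p" "p < q" "q < card S"
    "y = (f ^^ p) x" "z = (f ^^ q) x"
  shows "\<exists>p q. 0 < p \<and> p < q \<and> q < card S \<and> z = (f ^^ p) y \<and> x = (f ^^ q) y"
proof (intro exI conjI)
  show "z = (f ^^ (q - p)) y"
    using assms funpow_add[of "q - p" p f] by simp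
  show "x = (f ^^ (card S - p)) y"
    using assms funpow_add[of "card S - p" p f] cyclic_on_index(1)[OF assms(1,2)] by simp
qed (use assms in auto)

lemma cyclic_tripleI:
  assumes "cyclic_on f S" "e i \<in> S" "0 < p" "p < q" "q < card S"
    "e (i + 1) = (f ^^ p) (e i)" "e (i + 2) = (f ^^ q) (e i)"
  shows "cyclic_triple f S e"
proof -
  let ?P = "\<lambda>i. e i \<in> S \<and> (\<exists>p q. 0 < p \<and> p < q \<and> q < card S \<and>
        e (i + 1) = (f ^^ p) (e i) \<and> e (i + 2) = (f ^^ q) (e i))"
  have step: "?P (i + 1)" if i: "?P i" for i
  proof -
    obtain p q where pq: "0 < p" "p < q" "q < card S"
      "e (i + 1) = (f ^^ p) (e i)" "e (i + 2) = (f ^^ q) (e i)" "e i \<in> S"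
      using i by blast
    have "e (i + 1) \<in> S" using pq cyclic_on_funpow_in[OF assms(1)] by simp
    then show ?thesis
      using cyclic_triple_rotate[OF assms(1) pq(6,1,2,3,4,5)] by simp
  qed
  have "?P i" using assms by auto
  moreover from this have "?P (i + 1)" by (rule step)
  moreover from this have "?P (i + 1 + 1)" by (rule step)
  ultimately have "?P j" for j using three_total[of j i] by (metis three_arith(2))
  then show ?thesis using assms(1) by (simp add: cyclic_triple_def)
qed

lemma cyclic_triple_if_sector:
  assumes "cyclic_on f S" "\<And>i. e i \<in> S" "inj e" "e (i + 1) \<in> sector f (e i) (e (i + 2))"
  shows "cyclic_triple f S e"
proof -
  note c = cyclic_on_index[OF assms(1) assms(2)[of i]]
  have "e (i + 1) \<in> S" "e (i + 2) \<in> S" using assms(2) by auto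
  then obtain p q where p: "p < card S" "e (i + 1) = (f ^^ p) (e i)"
    and q: "q < card S" "e (i + 2) = (f ^^ q) (e i)" using c(3) by blast
  have "e (i + 1) \<noteq> e i" "e (i + 2) \<noteq> e i" "e (i + 1) \<noteq> e (i + 2)"
    using assms(3) by (auto simp: inj_eq)
  then have "p \<noteq> 0" "q \<noteq> 0" "p \<noteq> q" using p q by (auto intro: gr0I)
  moreover have "sector f (e i) (e (i + 2)) = (\<lambda>l. (f ^^ l) (e i)) ` {0..q}"
    using sector_index[OF assms(1) assms(2)[of i], of 0 q] q by simp
  then obtain l where "l \<le> q" "(f ^^ l) (e i) = (f ^^ p) (e i)"
    using assms(4) p(2) by auto
  then have "l = p" using c(2) p(1) q(1) by (auto dest!: inj_onD)
  ultimately show ?thesis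
    using cyclic_tripleI[of f S e i p q] assms(1,2) p q \<open>l \<le> q\<close> by auto
qed

lemma cyclic_triple_sector:
  assumes "cyclic_triple f S e"
  shows "e i \<notin> sector f (e (i + 1)) (e (i + 2))"
    and "e (i + 1) \<in> sector f (e i) (e (i + 2))"
    and "e i \<in> sector f (e i) (e (i + 1))" "e (i + 1) \<in> sector f (e i) (e (i + 1))"
    and "inj e"
proof -
  have S: "cyclic_on f S" "e i \<in> S" for i using assms by (auto simp: cyclic_triple_def)
  have *: "e i \<notin> sector f (e (i + 1)) (e (i + 2)) \<and> e (i + 1) \<in> sector f (e i) (e (i + 2)) \<and>
    e i \<in> sector f (e i) (e (i + 1)) \<and> e (i + 1) \<in> sector f (e i) (e (i + 1)) \<and> e i \<noteq> e (i + 1)" for i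
  proof -
    obtain p q where pq: "0 < p" "p < q" "q < card S"
      "e (i + 1) = (f ^^ p) (e i)" "e (i + 2) = (f ^^ q) (e i)"
      using assms unfolding cyclic_triple_def by blast
    note sec = sector_index[OF S(1) S(2)[of i]]
    have A: "sector f (e (i + 1)) (e (i + 2)) = (\<lambda>l. (f ^^ l) (e i)) ` {p..q}"
      using sec[of p q] pq by simp
    have B: "sector f (e i) (e (i + 2)) = (\<lambda>l. (f ^^ l) (e i)) ` {0..q}"
      using sec[of 0 q] pq by simp
    have C: "sector f (e i) (e (i + 1)) = (\<lambda>l. (f ^^ l) (e i)) ` {0..p}"
      using sec[of 0 p] pq by simp
    have ne: "(f ^^ l) (e i) \<noteq> e i" if "0 < l" "l < card S" for l
      using cyclic_on_window[OF S(1) S(2)[of i], of 0 l] that by auto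
    have "e i \<notin> sector f (e (i + 1)) (e (i + 2))"
    proof
      assume "e i \<in> sector f (e (i + 1)) (e (i + 2))"
      then obtain l where "p \<le> l" "l \<le> q" "(f ^^ l) (e i) = e i" unfolding A by auto
      then show False using ne[of l] pq by simp
    qed
    moreover have "e (i + 1) \<in> sector f (e i) (e (i + 2))" "e (i + 1) \<in> sector f (e i) (e (i + 1))"
      unfolding B C using pq by auto
    moreover have "e i \<in> sector f (e i) (e (i + 1))"
      unfolding C by (rule image_eqI[of _ _ 0]) auto
    moreover have "e i \<noteq> e (i + 1)" using ne[of p] pq by auto
    ultimately show ?thesis by blast
  qed
  show "e i \<notin> sector f (e (i + 1)) (e (i + 2))" "e (i + 1) \<in> sector f (e i) (e (i + 2))"
    "e i \<in> sector f (e i) (e (i + 1))" "e (i + 1) \<in> sector f (e i) (e (i + 1))"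
    using *[of i] by blast+
  have ne: "e i \<noteq> e (i + 1)" for i using *[of i] by blast
  show "inj e"
  proof (rule injI)
    fix i j assume "e i = e j"
    then show "i = j" using three_total[of j i] ne[of i] ne[of "i + 2"] by (elim disjE) simp_all
  qed
qed

lemma cyclic_triple_adjacent:
  assumes "cyclic_triple f S e"
  shows "f (e i) \<in> sector f (e (i + 1)) (e (i + 2)) \<Longrightarrow> f (e i) = e (i + 1)"
    and "z \<in> sector f (e (i + 1)) (e (i + 2)) \<Longrightarrow> f z = e i \<Longrightarrow> z = e (i + 2)"
    and "f (e j) = e i \<Longrightarrow> j = i + 2"
proof -
  have S: "cyclic_on f S" "e i \<in> S" for i using assms by (auto simp: cyclic_triple_def)
  obtain p q where pq: "0 < p" "p < q" "q < card S"
    "e (i + 1) = (f ^^ p) (e i)" "e (i + 2) = (f ^^ q) (e i)"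
    using assms unfolding cyclic_triple_def by blast
  have sec: "sector f (e (i + 1)) (e (i + 2)) = (\<lambda>l. (f ^^ l) (e i)) ` {p..q}"
    using sector_index[OF S(1) S(2)[of i], of p q] pq by simp
  note win = cyclic_on_window[OF S(1) S(2)[of i]]
  show "f (e i) = e (i + 1)" if z: "f (e i) \<in> sector f (e (i + 1)) (e (i + 2))"
  proof -
    obtain l where l: "p \<le> l" "l \<le> q" "(f ^^ 1) (e i) = (f ^^ l) (e i)" using z sec by auto
    then have "1 = l" using win[of 1 l] pq by auto
    then have "p = 1" using l(1) pq(1) by simp
    then show ?thesis using pq by simp
  qed
  show "z = e (i + 2)" if z: "z \<in> sector f (e (i + 1)) (e (i + 2))" "f z = e i"
  proof -
    obtain l where l: "p \<le> l" "l \<le> q" "z = (f ^^ l) (e i)" using z sec by auto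
    then have "(f ^^ 0) (e i) = (f ^^ Suc l) (e i)" using z by simp
    then have "\<not> Suc l < card S" using win[of 0 "Suc l"] by auto
    then have "l = q" using l pq by simp
    then show ?thesis using l pq by simp
  qed
  show "j = i + 2" if "f (e j) = e i"
  proof -
    obtain p q where pq: "0 < p" "p < q" "q < card S"
      "e (j + 1) = (f ^^ p) (e j)" "e (j + 2) = (f ^^ q) (e j)"
      using assms unfolding cyclic_triple_def by blast
    have "i \<noteq> j" using cyclic_on_window[OF S(1) S(2)[of j], of 0 1] that pq by auto
    moreover have "i \<noteq> j + 2" using cyclic_on_window[OF S(1) S(2)[of j], of 1 q] that pq by auto
    ultimately show ?thesis using three_total[of i j] by auto
  qed
qed

definition next_in :: "'d set \<Rightarrow> ('d \<Rightarrow> 'd) \<Rightarrow> 'd \<Rightarrow> 'd \<Rightarrow> bool" where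
  "next_in P f x y \<longleftrightarrow> (\<exists>k > 0. y = (f ^^ k) x \<and> y \<in> P \<and> (\<forall>l. 0 < l \<and> l < k \<longrightarrow> (f ^^ l) x \<notin> P))"

lemma next_in_unique: "next_in P f x y \<Longrightarrow> next_in P f x z \<Longrightarrow> y = z"
  unfolding next_in_def by (metis linorder_neqE_nat)

lemma cyclic_triple_next_in:
  assumes "cyclic_triple f S e" "P \<inter> S = range e"
  shows "next_in P f (e i) (e (i + 1))"
    and "z \<in> sector f (e (i + 1)) (e (i + 2)) \<Longrightarrow> z \<notin> P \<Longrightarrow> next_in P f z (e (i + 2))"
proof -
  have S: "cyclic_on f S" "e i \<in> S" for i using assms by (auto simp: cyclic_triple_def)
  obtain p q where pq: "0 < p" "p < q" "q < card S"
    "e (i + 1) = (f ^^ p) (e i)" "e (i + 2) = (f ^^ q) (e i)"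
    using assms unfolding cyclic_triple_def by blast
  have sec: "sector f (e (i + 1)) (e (i + 2)) = (\<lambda>l. (f ^^ l) (e i)) ` {p..q}"
    using sector_index[OF S(1) S(2)[of i], of p q] pq by simp
  note win = cyclic_on_window[OF S(1) S(2)[of i]]
  have gap: "(f ^^ l) (e i) \<notin> P" if "0 < l" "l < card S" "l \<noteq> p" "l \<noteq> q" for l
  proof
    assume "(f ^^ l) (e i) \<in> P"
    moreover have "(f ^^ l) (e i) \<in> S" using S cyclic_on_funpow_in by metis
    ultimately obtain j where j: "(f ^^ l) (e i) = e j" using assms(2) by blast
    have "(f ^^ l) (e i) \<noteq> (f ^^ k) (e i)" if "k < card S" "k \<noteq> l" for k
      using win[of l k] win[of k l] that \<open>l < card S\<close> by (cases "k \<le> l") auto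
    from this[of 0] this[of p] this[of q] show False
      using that j pq three_total[of j i] by auto
  qed
  have P: "e i \<in> P" for i using assms(2) by auto
  show "next_in P f (e i) (e (i + 1))"
    unfolding next_in_def using pq gap P[of "i + 1"] by (intro exI[of _ p]) auto
  show "next_in P f z (e (i + 2))" if z: "z \<in> sector f (e (i + 1)) (e (i + 2))" "z \<notin> P"
  proof -
    obtain l where l: "p \<le> l" "l \<le> q" "z = (f ^^ l) (e i)" using z sec by auto
    then have "l < q" using z(2) pq(5) P[of "i + 2"] by (cases "l = q") auto
    show ?thesis
      unfolding next_in_def
    proof (intro exI[of _ "q - l"] conjI allI impI)
      show "e (i + 2) = (f ^^ (q - l)) z"
        using l \<open>l < q\<close> pq funpow_add[of "q - l" l f] by simp
      fix k assume k: "0 < k \<and> k < q - l"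
      then have "(f ^^ (k + l)) (e i) \<notin> P" using l pq by (intro gap) auto
      then show "(f ^^ k) z \<notin> P" using l by (simp add: funpow_add)
    qed (use \<open>l < q\<close> P in auto)
  qed
qed

lemma cyclic_triple_label:
  fixes L :: "'d \<Rightarrow> 3"
  assumes "cyclic_on f S" "card (Out \<inter> S) = 3"
    and step: "\<And>d. d \<in> S \<Longrightarrow> L (f d) = L d + of_bool (f d \<in> Out)"
  obtains e where "cyclic_triple f S e" "Out \<inter> S = range e" "\<And>i. L (e i) = i"
    "\<And>d. d \<in> S \<Longrightarrow> d \<in> sector f (e (L d)) (e (L d + 1))"
proof -
  have finS: "finite S" using assms(1) by (rule finite_cyclic_on)
  obtain x where x: "x \<in> Out" "x \<in> S" using assms(2) by (metis Int_iff card.empty ex_in_conv zero_neq_numeral)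
  note c = cyclic_on_index[OF assms(1) x(2)]
  let ?m = "card S"
  let ?K = "{k. k < ?m \<and> (f ^^ k) x \<in> Out}"
  have img: "(\<lambda>k. (f ^^ k) x) ` ?K = Out \<inter> S"
  proof
    show "(\<lambda>k. (f ^^ k) x) ` ?K \<subseteq> Out \<inter> S" using cyclic_on_funpow_in[OF assms(1) x(2)] by auto
    show "Out \<inter> S \<subseteq> (\<lambda>k. (f ^^ k) x) ` ?K"
    proof
      fix y assume y: "y \<in> Out \<inter> S"
      then obtain k where "y = (f ^^ k) x" "k < ?m" using c(3) by blast
      then show "y \<in> (\<lambda>k. (f ^^ k) x) ` ?K" using y by blast
    qed
  qed
  have "inj_on (\<lambda>k. (f ^^ k) x) ?K" by (rule inj_on_subset[OF c(2)]) auto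
  then have "card ?K = 3" using card_image[of "\<lambda>k. (f ^^ k) x" ?K] img assms(2) by simp
  moreover have "0 \<in> ?K" using x c(4) by simp
  ultimately have "card (?K - {0}) = 2" by (simp add: card_Diff_singleton)
  then obtain a b where ab: "?K - {0} = {a, b}" "a \<noteq> b" by (meson card_2_iff)
  obtain p q where K0: "?K - {0} = {p, q}" "p < q"
  proof (cases "a < b")
    case True
    then show ?thesis using that ab by blast
  next
    case False
    then have "b < a" using ab(2) by simp
    then show ?thesis using that[of b a] ab(1) by (simp add: insert_commute)
  qed
  then have K: "?K = {0, p, q}" using \<open>0 \<in> ?K\<close> by blast
  have "p \<in> ?K - {0}" "q \<in> ?K" using K0 by blast+
  then have pq: "0 < p" "q < ?m" by simp_all
  have label: "L ((f ^^ k) x) = L x + of_bool (p \<le> k) + of_bool (q \<le> k)" if "k < ?m" for k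
    using that
  proof (induction k)
    case 0
    then show ?case using pq K0(2) by simp
  next
    case (Suc k)
    have "(f ^^ k) x \<in> S" using cyclic_on_funpow_in[OF assms(1) x(2)] .
    then have "L ((f ^^ Suc k) x) = L ((f ^^ k) x) + of_bool ((f ^^ Suc k) x \<in> Out)" using step by simp
    also have "(f ^^ Suc k) x \<in> Out \<longleftrightarrow> Suc k = p \<or> Suc k = q"
      using arg_cong[OF K, of "\<lambda>A. Suc k \<in> A"] Suc.prems by simp
    also have "L ((f ^^ k) x) = L x + of_bool (p \<le> k) + of_bool (q \<le> k)" using Suc by simp
    finally show ?case using K0(2) by (auto simp: le_Suc_eq)
  qed
  define i where "i = L x"
  define e where "e j = (if j = i then x else if j = i + 1 then (f ^^ p) x else (f ^^ q) x)" for j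
  have e: "e i = x" "e (i + 1) = (f ^^ p) x" "e (i + 2) = (f ^^ q) x" by (auto simp: e_def)
  have lab: "L ((f ^^ k) x) = (if k < p then i else if k < q then i + 1 else i + 2)" if "k < ?m" for k
    using label[OF that] K0(2) by (simp add: i_def)
  show ?thesis
  proof (rule that)
    show "cyclic_triple f S e"
      using cyclic_tripleI[of f S e i p q] assms(1) x pq K0(2) e by auto
    have "UNIV = {i, i + 1, i + 2}" using three_total[of _ i] by blast
    then have "range e = e ` {i, i + 1, i + 2}" by simp
    also have "\<dots> = (\<lambda>k. (f ^^ k) x) ` {0, p, q}" using e by simp
    also have "\<dots> = Out \<inter> S" using img unfolding K .
    finally show "Out \<inter> S = range e" ..
    have "L (e i) = i" "L (e (i + 1)) = i + 1" "L (e (i + 2)) = i + 2"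
      using lab[of 0] lab[of p] lab[of q] pq K0(2) c(4) unfolding e by auto
    then show "L (e j) = j" for j using three_total[of j i] by auto
    fix d assume "d \<in> S"
    then obtain k where k: "d = (f ^^ k) x" "k < ?m" using c(3) by auto
    note sec = sector_index[OF assms(1) x(2)]
    consider "k < p" | "p \<le> k" "k < q" | "q \<le> k" by linarith
    then show "d \<in> sector f (e (L d)) (e (L d + 1))"
    proof cases
      case 1
      then have "L d = i" using lab k by simp
      then show ?thesis using sec[of 0 p] pq K0(2) 1 k e by auto
    next
      case 2
      then have "L d = i + 1" using lab k by simp
      then show ?thesis using sec[of p q] pq K0(2) 2 k e by auto
    next
      case 3
      then have "L d = i + 2" using lab k K0(2) by simp
      then show ?thesis using sec[of q ?m] pq K0(2) 3 k e c(1) by auto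
    qed
  qed
qed

lemma card_orbit_partition:
  assumes "g permutes A" "finite A" "\<And>F. F \<in> orbit g ` A \<Longrightarrow> card F = k"
  shows "k * card (orbit g ` A) = card A"
proof -
  have perm: "permutation g" using assms by (auto simp: permutation_permutes)
  have "\<Union> (orbit g ` A) = A"
    using permutes_orbit_subset[OF assms(1)] permutation_self_in_orbit[OF perm] by blast
  moreover have "F \<inter> F' = {}" if "F \<in> orbit g ` A" "F' \<in> orbit g ` A" "F \<noteq> F'" for F F'
    using that by (auto dest: orbit_cyclic_eq3[OF cyclic_on_orbit'[OF perm]])
  ultimately show ?thesis
    using card_partition[of "orbit g ` A" k] assms(2,3) by auto
qed

lemma cyclic_on_insert:
  assumes "cyclic_on f S" "d \<in> S" "x \<notin> S" "\<And>s. s \<in> S \<Longrightarrow> s \<noteq> d \<Longrightarrow> g s = f s" "g d = x" "g x = f d"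
  shows "cyclic_on g (insert x S)"
proof -
  have S: "orbit f d = S" using assms(1,2) by (simp add: cyclic_on_alldef)
  have fS: "f s \<in> S" if "s \<in> S" for s using assms(1) that by (rule cyclic_on_inI)
  have sub: "y \<in> orbit g x" if "y \<in> orbit f d" for y
    using that
  proof induction
    case base
    then show ?case using assms(6) orbit.base[of g x] by simp
  next
    case (step y)
    then have "y \<in> S" using S by simp
    then show ?case
      using assms(4)[of y] orbit.step[OF step.IH] orbit.base[of g x] assms(6) by (cases "y = d") auto
  qed
  have "y \<in> insert x S" if "y \<in> orbit g x" for y
    using that
  proof induction
    case base
    then show ?case using assms(2,6) fS by simp
  next
    case (step y)
    then show ?case using assms(2,4,5,6) fS by (cases "y = d"; cases "y = x") auto
  qed
  moreover have "x \<in> orbit g x"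
    using sub[of d] assms(2,5) S orbit.step[of d g x] by simp
  ultimately have "insert x S = orbit g x" using sub S by auto
  then show ?thesis by (auto simp: cyclic_on_def)
qed

locale triangulation =
  fixes M :: "'v plane_map" and a :: "3 \<Rightarrow> 'v"
  assumes tri: "plane_triangulation M" and labeling: "outer_labeling M a"
begin

abbreviation "V \<equiv> vertices M"
abbreviation "A \<equiv> edge_arcs M"
abbreviation "star v \<equiv> {d \<in> A. fst d = v}"

lemma planar: "planar_map M" using tri by (simp add: plane_triangulation_def)

sublocale pair_graph "graph M" using planar by (simp add: planar_map_def)

lemma finite_V: "finite V" and finite_A: "finite A"
  by (rule pair_finite_verts, rule pair_finite_arcs)

lemma arc_sym: "(u, v) \<in> A \<longleftrightarrow> (v, u) \<in> A" using arcs_symmetric by blast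

lemma swap_arc: "prod.swap d \<in> A \<longleftrightarrow> d \<in> A" by (cases d) (simp add: arc_sym)

lemma rot_permutes: "rot M permutes A" using planar by (simp add: planar_map_def)

lemma rot_arc: "rot M d \<in> A \<longleftrightarrow> d \<in> A" by (rule permutes_in_image[OF rot_permutes])

lemma rot_cyclic: "star v \<noteq> {} \<Longrightarrow> v \<in> V \<Longrightarrow> cyclic_on (rot M) (star v)"
  using planar by (simp add: planar_map_def)

lemma fst_rot: "d \<in> A \<Longrightarrow> fst (rot M d) = fst d"
  
proof -
  assume d: "d \<in> A"
  then have "star (fst d) \<noteq> {}" "fst d \<in> V" using arc_fst_in_verts by blast+
  then have "cyclic_on (rot M) (star (fst d))" by (rule rot_cyclic)
  from cyclic_on_inI[OF this, of d] show ?thesis using d by simp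
qed

definition face_perm where "face_perm = perm_restrict (face_succ M) A"

lemma face_perm_permutes: "face_perm permutes A"
proof (rule bij_imp_permutes)
  have "inj_on (face_succ M) A"
  proof (rule inj_onI)
    fix d e assume "face_succ M d = face_succ M e"
    then have "prod.swap d = prod.swap e"
      unfolding face_succ_def by (rule injD[OF permutes_inj[OF rot_permutes]])
    then show "d = e" by (metis swap_swap)
  qed
  moreover have "face_succ M ` A \<subseteq> A" 
  proof (rule image_subsetI)
    fix d assume "d \<in> A"
    then have "prod.swap d \<in> A" by (simp only: swap_arc)
    then show "face_succ M d \<in> A" by (simp only: face_succ_def rot_arc)
  qed
  ultimately have "bij_betw (face_succ M) A A"
    using endo_inj_surj[OF finite_A] unfolding bij_betw_def by blast
  then show "bij_betw face_perm A A"
    using bij_betw_cong[of A "face_succ M" face_perm A] by (simp add: face_perm_def perm_restrict_def)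
qed (simp add: face_perm_def perm_restrict_def)

lemma orbit_face_perm:
  assumes "d \<in> A"
  shows "orbit face_perm d = orbit (face_succ M) d"
proof (rule orbit_cong0[OF assms])
  show "face_perm \<in> A \<rightarrow> A" using permutes_in_image[OF face_perm_permutes] by blast
qed (simp add: face_perm_def perm_restrict_def)

lemma faces_eq: "faces M = orbit face_perm ` A"
  unfolding faces_def by (rule image_cong) (simp_all add: orbit_face_perm)

lemma face_perm_cyclic: "F \<in> faces M \<Longrightarrow> cyclic_on face_perm F"
  using cyclic_on_orbit[OF face_perm_permutes finite_A] by (auto simp: faces_eq)

lemma face_subset: "F \<in> faces M \<Longrightarrow> F \<subseteq> A"
  using permutes_orbit_subset[OF face_perm_permutes] by (auto simp: faces_eq)

lemma card_face: "F \<in> faces M \<Longrightarrow> card F = 3"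
  using tri by (simp add: plane_triangulation_def)

lemma face_perm_arc: "d \<in> A \<Longrightarrow> face_perm d = rot M (prod.swap d)"
  by (simp add: face_perm_def perm_restrict_def face_succ_def)

lemma face_perm_cube:
  assumes "d \<in> A"
  shows "face_perm (face_perm (face_perm d)) = d"
proof -
  let ?F = "orbit face_perm d"
  have "?F \<in> faces M" using assms by (auto simp: faces_eq)
  moreover have "d \<in> ?F"
    using permutation_self_in_orbit face_perm_permutes finite_A permutation_permutes by metis
  ultimately have "(face_perm ^^ 3) d = d"
    using cyclic_on_index(1)[OF face_perm_cyclic] card_face by metis
  then show ?thesis by (simp add: numeral_3_eq_3)
qed

lemma card_arcs: "card A + 12 = 6 * card V"
proof -
  have "3 * card (faces M) = card A"
    using card_orbit_partition[OF face_perm_permutes finite_A] card_face by (simp add: faces_eq)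
  moreover have "int (card V) - int (card A div 2) + int (card (faces M)) = 2"
    using planar by (simp add: planar_map_def)
  moreover obtain k where "card A = 2 * k"
  proof -
    let ?E = "(\<lambda>d. {d, prod.swap d}) ` A"
    have "2 * card ?E = card (\<Union> ?E)"
    proof (rule card_partition)
      show "finite (\<Union> ?E)" "finite ?E" using finite_A by simp_all
      fix c assume "c \<in> ?E"
      then obtain u v where c: "c = {(u, v), (v, u)}" "(u, v) \<in> A" by auto
      then have "u \<noteq> v" using pair_no_loops by fastforce
      then show "card c = 2" using c(1) by simp
    qed auto
    moreover have "\<Union> ?E = A"
    proof
      show "\<Union> ?E \<subseteq> A" by (auto dest: arcs_symmetric)
    qed blast
    ultimately have "card A = 2 * card ?E" by simp
    then show ?thesis by (rule that)
  qed
  ultimately show ?thesis by simp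
qed

lemma outer_arc: "(a i, a (i + 1)) \<in> outer M"
  using labeling by (simp add: outer_labeling_def)

lemma outer_face: "outer M \<in> faces M" using planar by (simp add: planar_map_def)

lemma arc_next: "(a i, a (i + 1)) \<in> A" using outer_arc face_subset[OF outer_face] by blast

lemma arc_prev: "(a i, a (i + 2)) \<in> A" using arc_next[of "i + 2"] arc_sym by simp

lemma a_ne: "a i \<noteq> a (i + 1)" using pair_no_loops[OF arc_next[of i]] by simp

lemma inj_a: "inj a"
proof (rule injI)
  fix i j assume "a i = a j"
  then show "i = j" using three_total[of j i] a_ne[of i] a_ne[of "i + 2"] by (elim disjE) simp_all
qed

lemma a_eq [simp]: "a i = a j \<longleftrightarrow> i = j" using inj_a by (simp add: inj_eq)

lemma a_in_V: "a i \<in> V" using arc_next[of i] by (rule in_arcsD1)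

lemma card_UNIV_three: "card (UNIV :: 3 set) = 3" by simp

lemma outer_eq: "outer M = range (\<lambda>i. (a i, a (i + 1)))"
proof (rule sym, rule card_subset_eq)
  show "finite (outer M)" using finite_subset[OF face_subset[OF outer_face] finite_A] .
  have "card (range (\<lambda>i. (a i, a (i + 1)))) = card (UNIV :: 3 set)" by (rule card_image) (simp add: inj_on_def)
  then show "card (range (\<lambda>i. (a i, a (i + 1)))) = card (outer M)"
    using card_face[OF outer_face] card_UNIV_three by simp
qed (use outer_arc in auto)

lemma rot_prev: "rot M (a i, a (i + 2)) = (a i, a (i + 1))"
proof -
  have *: "(a (i + 2), a i) \<in> outer M" using outer_arc[of "i + 2"] by simp
  then have "face_perm (a (i + 2), a i) \<in> outer M"
    using cyclic_on_inI[OF face_perm_cyclic[OF outer_face]] by blast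
  moreover have "face_perm (a (i + 2), a i) = rot M (a i, a (i + 2))"
    using face_perm_arc[of "(a (i + 2), a i)"] * face_subset[OF outer_face] by auto
  ultimately obtain j where "rot M (a i, a (i + 2)) = (a j, a (j + 1))" by (auto simp: outer_eq)
  moreover have "fst (rot M (a i, a (i + 2))) = a i" using fst_rot[OF arc_prev] by simp
  ultimately show ?thesis by simp
qed

lemma susp_rot_Edge:
  assumes "d \<in> A" "\<And>i. d \<noteq> (a i, a (i + 2))"
  shows "susp_rot M a (Edge d) = Edge (rot M d)"
proof -
  have "rot M d \<notin> outer M"
  proof
    assume "rot M d \<in> outer M"
    then obtain i where "rot M d = (a i, a (i + 1))" by (auto simp: outer_eq)
    then have "d = (a i, a (i + 2))"
      using rot_prev[of i] permutes_inj[OF rot_permutes] by (metis injD)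
    then show False using assms(2) by blast
  qed
  then show ?thesis by simp
qed

lemma susp_rot_prev: "susp_rot M a (Edge (a i, a (i + 2))) = Half (a i)"
  using rot_prev[of i] outer_arc[of i] by simp

lemma susp_rot_Half: "susp_rot M a (Half (a i)) = Edge (a i, a (i + 1))"
proof -
  have "(THE d. d \<in> outer M \<and> fst d = a i) = (a i, a (i + 1))"
    by (rule the_equality) (auto simp: outer_eq)
  then show ?thesis by simp
qed

lemma darts_inner: "v \<notin> range a \<Longrightarrow> darts_at M a v = Edge ` star v"
  by (simp add: darts_at_def)

lemma darts_outer: "darts_at M a (a i) = insert (Half (a i)) (Edge ` star (a i))"
  by (simp add: darts_at_def)

lemma susp_cyclic:
  assumes "v \<in> V" "darts_at M a v \<noteq> {}"
  shows "cyclic_on (susp_rot M a) (darts_at M a v)"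
proof (cases "v \<in> range a")
  case False
  then have "star v \<noteq> {}" using assms(2) by (auto simp: darts_at_def)
  then have "cyclic_on (rot M) (star v)" using assms(1) rot_cyclic by blast
  then have "cyclic_on (susp_rot M a) (Edge ` star v)"
    by (rule cyclic_on_image) (use False in \<open>auto intro!: susp_rot_Edge simp del: susp_rot.simps\<close>)
  then show ?thesis using False by (simp add: darts_inner)
next
  case True
  then obtain i where v: "v = a i" by blast
  define g where "g d = (case d of Edge e \<Rightarrow> Edge (rot M e) | Half w \<Rightarrow> Half w)" for d :: "'v dart"
  have "star v \<noteq> {}" using arc_next[of i] v by auto
  then have "cyclic_on (rot M) (star v)" using assms(1) rot_cyclic by blast
  then have g: "cyclic_on g (Edge ` star v)" by (rule cyclic_on_image) (simp add: g_def)
  have "cyclic_on (susp_rot M a) (insert (Half v) (Edge ` star v))"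
  proof (rule cyclic_on_insert[OF g])
    show "Edge (a i, a (i + 2)) \<in> Edge ` star v" using arc_prev[of i] v by auto
    show "Half v \<notin> Edge ` star v" by auto
    show "susp_rot M a (Edge (a i, a (i + 2))) = Half v" using susp_rot_prev v by simp
    show "susp_rot M a (Half v) = g (Edge (a i, a (i + 2)))"
      using v by (simp add: susp_rot_Half g_def rot_prev del: susp_rot.simps)
    fix s assume "s \<in> Edge ` star v" "s \<noteq> Edge (a i, a (i + 2))"
    then show "susp_rot M a s = g s"
      using v by (auto simp: g_def simp del: susp_rot.simps intro!: susp_rot_Edge)
  qed
  then show ?thesis using v by (simp add: darts_outer)
qed

lemma connected_induct:
  assumes "u \<in> V" "v \<in> V" "P u" "\<And>x y. (x, y) \<in> A \<Longrightarrow> P x \<Longrightarrow> P y"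
  shows "P v"
proof -
  have "connected (with_proj (graph M))" using planar by (simp add: planar_map_def)
  then have "(u, v) \<in> rtrancl_on V (A\<^sup>s)" using assms(1,2) by (simp add: connected_conv)
  then have "(u, v) \<in> (A\<^sup>s)\<^sup>*" by (rule rtrancl_on_rtranclI)
  then show ?thesis
  proof induction
    case (step y z)
    then have "(y, z) \<in> A" using arc_sym by (auto simp: symcl_def)
    then show ?case using assms(4) step by blast
  qed (use assms in auto)
qed

end

definition nbrs :: "'v set \<Rightarrow> ('v \<times> 'v) set \<Rightarrow> 'v \<Rightarrow> 'v set" where
  "nbrs V E v = {w \<in> V. (v, w) \<in> E}"

definition orientations ::
  "'v set \<Rightarrow> ('v \<times> 'v) set \<Rightarrow> ('v \<Rightarrow> nat) \<Rightarrow> ('v \<times> 'v) set set" where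
  "orientations V E \<alpha> = {D. D \<subseteq> E \<inter> V \<times> V \<and>
     (\<forall>u \<in> V. \<forall>v \<in> V. (u, v) \<in> E \<longrightarrow> (u, v) \<in> D \<longleftrightarrow> (v, u) \<notin> D) \<and>
     (\<forall>v \<in> V. card {w. (v, w) \<in> D} = \<alpha> v)}"

definition average :: "(nat \<Rightarrow> real) \<Rightarrow> nat \<Rightarrow> real" where
  "average h d = (\<Sum>r\<le>d. h r) / (real d + 1)"

lemma average_balance:
  "h d - average h d + real d * (average h (d - 1) - average h d) = 0"
proof (cases d)
  case 0
  then show ?thesis by (simp add: average_def)
next
  case (Suc k)
  define s where "s = (\<Sum>r\<le>k. h r)"
  have "average h k = s / (real k + 1)" "average h d = (s + h d) / (real k + 2)"
    by (simp_all add: average_def Suc s_def add.commute)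
  then show ?thesis
    using Suc by (simp add: divide_simps) (simp add: algebra_simps)
qed

lemma exists_cheap_vertex:
  fixes h :: "'v \<Rightarrow> nat \<Rightarrow> real"
  assumes "finite V" "V \<noteq> {}" "sym E"
  defines "d v \<equiv> card (nbrs V E v)"
  shows "\<exists>u \<in> V. h u (d u) + (\<Sum>w \<in> nbrs V E u. average (h w) (d w - 1) - average (h w) (d w))
            \<le> average (h u) (d u)"
proof (rule ccontr)
  define \<delta> where "\<delta> w = average (h w) (d w - 1) - average (h w) (d w)" for w
  assume "\<not> ?thesis"
  then have *: "h u (d u) - average (h u) (d u) + (\<Sum>w \<in> nbrs V E u. \<delta> w) > 0" if "u \<in> V" for u
    using that unfolding \<delta>_def by force
  have "(\<Sum>u \<in> V. \<Sum>w \<in> nbrs V E u. \<delta> w) = (\<Sum>w \<in> V. \<Sum>u \<in> nbrs V E w. \<delta> w)"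
    unfolding nbrs_def using assms(1,3)
    by (subst sum.swap_restrict) (auto intro!: sum.cong simp: sym_def)
  then have "(\<Sum>u \<in> V. h u (d u) - average (h u) (d u) + (\<Sum>w \<in> nbrs V E u. \<delta> w))
      = (\<Sum>u \<in> V. h u (d u) - average (h u) (d u) + real (d u) * \<delta> u)"
    by (simp add: sum.distrib d_def)
  also have "\<dots> = 0" unfolding \<delta>_def by (simp only: average_balance sum.neutral_const)
  finally show False
    using sum_pos[OF assms(1,2), of "\<lambda>u. h u (d u) - average (h u) (d u) + (\<Sum>w \<in> nbrs V E u. \<delta> w)"] * by simp
qed

lemma finite_orientations: "finite V \<Longrightarrow> finite (orientations V E \<alpha>)"
  by (rule finite_subset[of _ "Pow (V \<times> V)"]) (auto simp: orientations_def)

theorem card_orientations_le: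
  fixes h :: "'v \<Rightarrow> nat \<Rightarrow> real"
  assumes "finite V" "sym E" "irrefl E"
    and "\<And>v r j. v \<in> V \<Longrightarrow> j \<le> \<alpha> v \<Longrightarrow> j \<le> r \<Longrightarrow> r + \<alpha> v \<le> j + card (nbrs V E v) \<Longrightarrow>
           real (r choose j) \<le> exp (h v r)"
  shows "real (card (orientations V E \<alpha>)) \<le> exp (\<Sum>v \<in> V. average (h v) (card (nbrs V E v)))"
  using assms(1,4)
proof (induction "card V" arbitrary: V \<alpha>)
  case 0
  then have "orientations V E \<alpha> \<subseteq> {{}}" by (auto simp: orientations_def)
  then have "card (orientations V E \<alpha>) \<le> 1" 
    using card_mono[of "{{}}" "orientations V E \<alpha>"] by simp
  then show ?case using 0 by simp
next
  case (Suc n)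
  define d where "d v = card (nbrs V E v)" for v
  have "V \<noteq> {}" using Suc.hyps(2) by auto
  then obtain u where u: "u \<in> V" and
    cheap: "h u (d u) + (\<Sum>w \<in> nbrs V E u. average (h w) (d w - 1) - average (h w) (d w))
            \<le> average (h u) (d u)"
    using exists_cheap_vertex[OF Suc.prems(1) _ assms(2)] unfolding d_def by blast
  define N where "N = nbrs V E u"
  define W where "W = V - {u}"
  define \<beta> where "\<beta> S w = \<alpha> w - (if w \<in> N \<and> w \<notin> S then 1 else 0)" for S w
  define Sel where "Sel = {S. S \<subseteq> N \<and> card S = \<alpha> u}"
  have N: "N \<subseteq> W" "finite N" "finite W"
    using assms(3) Suc.prems(1) by (auto simp: N_def W_def nbrs_def irrefl_def)
  have W: "V = insert u W" "u \<notin> W" using u by (auto simp: W_def)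
  have dW: "card (nbrs W E w) = (if w \<in> N then d w - 1 else d w)"
       "w \<in> N \<Longrightarrow> d w \<ge> 1" if "w \<in> W" for w
  proof -
    have "w \<in> N \<longleftrightarrow> u \<in> nbrs V E w" using assms(2) that u by (auto simp: N_def W_def nbrs_def sym_def)
    moreover have "nbrs W E w = nbrs V E w - {u}" by (auto simp: W_def nbrs_def)
    moreover have "finite (nbrs V E w)" using Suc.prems(1) by (simp add: nbrs_def)
    ultimately show "card (nbrs W E w) = (if w \<in> N then d w - 1 else d w)" "w \<in> N \<Longrightarrow> d w \<ge> 1"
      by (auto simp: d_def card_gt_0_iff Suc_le_eq)
  qed
  define B where "B = (\<Sum>w \<in> W. average (h w) (card (nbrs W E w)))"
  have IH: "real (card (orientations W E (\<beta> S))) \<le> exp B" for S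
    unfolding B_def
  proof (rule Suc.hyps(1))
    show "n = card W" using Suc.hyps(2) W \<open>finite W\<close> by simp
    fix w r j
    assume w: "w \<in> W" and j: "j \<le> \<beta> S w" "j \<le> r" "r + \<beta> S w \<le> j + card (nbrs W E w)"
    show "real (r choose j) \<le> exp (h w r)"
    proof (rule Suc.prems(2))
      show "w \<in> V" using w W by simp
      show "j \<le> \<alpha> w" using j(1) by (simp add: \<beta>_def)
      show "r + \<alpha> w \<le> j + card (nbrs V E w)"
        using j(3) dW[OF w] by (auto simp: \<beta>_def d_def split: if_splits)
    qed fact
  qed (use N in auto)
  let ?split = "\<lambda>D. ({w. (u, w) \<in> D}, D \<inter> W \<times> W)"
  have "inj_on ?split (orientations V E \<alpha>)"
  proof (rule inj_onI)
    fix D D' assume D: "D \<in> orientations V E \<alpha>" "D' \<in> orientations V E \<alpha>" "?split D = ?split D'"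
    have out: "(u, w) \<in> D \<longleftrightarrow> (u, w) \<in> D'" for w using D(3) by auto
    have inn: "(w, u) \<in> D \<longleftrightarrow> (w, u) \<in> D'" for w
    proof (cases "(w, u) \<in> E \<and> w \<in> V")
      case True
      then have "(w, u) \<in> D \<longleftrightarrow> (u, w) \<notin> D" "(w, u) \<in> D' \<longleftrightarrow> (u, w) \<notin> D'"
        using D(1,2) u by (simp_all add: orientations_def)
      then show ?thesis using out by simp
    next
      case False
      then show ?thesis using D(1,2) by (auto simp: orientations_def)
    qed
    have "D \<subseteq> V \<times> V" "D' \<subseteq> V \<times> V" using D(1,2) by (auto simp: orientations_def)
    moreover have "D \<inter> W \<times> W = D' \<inter> W \<times> W" using D(3) by simp
    ultimately show "D = D'" using out inn W by blast
  qed
  moreover have "?split ` orientations V E \<alpha> \<subseteq> (SIGMA S:Sel. orientations W E (\<beta> S))"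
  proof
    fix x assume "x \<in> ?split ` orientations V E \<alpha>"
    then obtain D where D: "D \<in> orientations V E \<alpha>" "x = ?split D" by blast
    define S where "S = {w. (u, w) \<in> D}"
    have DE: "D \<subseteq> E \<inter> V \<times> V" using D by (simp add: orientations_def)
    have "S \<subseteq> N" using DE by (auto simp: S_def N_def nbrs_def)
    moreover have "card S = \<alpha> u" using D(1) u by (simp add: orientations_def S_def)
    moreover have "D \<inter> W \<times> W \<in> orientations W E (\<beta> S)"
      unfolding orientations_def
    proof (intro CollectI conjI ballI impI)
      show "D \<inter> W \<times> W \<subseteq> E \<inter> W \<times> W" using DE by blast
      fix v w assume "v \<in> W" "w \<in> W" "(v, w) \<in> E"
      then show "((v, w) \<in> D \<inter> W \<times> W) = ((w, v) \<notin> D \<inter> W \<times> W)"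
        using D(1) W by (auto simp: orientations_def)
    next
      fix v assume v: "v \<in> W"
      have fin: "finite {w. (v, w) \<in> D}"
        by (rule finite_subset[of _ V]) (use DE Suc.prems(1) in auto)
      have "(v, u) \<in> D \<longleftrightarrow> v \<in> N \<and> v \<notin> S"
      proof (cases "(v, u) \<in> E")
        case True
        then have "v \<in> N" using assms(2) v W by (auto simp: N_def nbrs_def sym_def)
        then show ?thesis using D(1) True v u W by (auto simp: orientations_def S_def)
      next
        case False
        then show ?thesis using DE assms(2) by (auto simp: N_def nbrs_def sym_def)
      qed
      moreover have "{w. (v, w) \<in> D \<inter> W \<times> W} = {w. (v, w) \<in> D} - {u}"
        using v DE W by auto
      moreover have "card {w. (v, w) \<in> D} = \<alpha> v"
        using D(1) v W by (simp add: orientations_def)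
      ultimately show "card {w. (v, w) \<in> D \<inter> W \<times> W} = \<beta> S v"
        using fin by (auto simp: \<beta>_def card_Diff_singleton_if)
    qed
    ultimately show "x \<in> (SIGMA S:Sel. orientations W E (\<beta> S))"
      using D(2) by (simp add: Sel_def S_def)
  qed
  moreover have "finite Sel" using N by (simp add: Sel_def)
  moreover have "finite (orientations W E (\<beta> S))" for S
    using N by (simp add: finite_orientations)
  ultimately have "card (orientations V E \<alpha>) \<le> card (SIGMA S:Sel. orientations W E (\<beta> S))"
    by (meson card_inj_on_le finite_SigmaI)
  also have "\<dots> = (\<Sum>S \<in> Sel. card (orientations W E (\<beta> S)))"
    using \<open>finite Sel\<close> N by (simp add: card_SigmaI finite_orientations)
  finally have "real (card (orientations V E \<alpha>)) \<le> (\<Sum>S \<in> Sel. real (card (orientations W E (\<beta> S))))"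
    by (metis of_nat_mono of_nat_sum)
  also have "\<dots> \<le> (\<Sum>S \<in> Sel. exp B)" by (intro sum_mono IH)
  also have "\<dots> = real (d u choose \<alpha> u) * exp B"
    using n_subsets[OF \<open>finite N\<close>, of "\<alpha> u"] by (simp add: Sel_def N_def d_def)
  also have "\<dots> \<le> exp (h u (d u)) * exp B"
  proof (cases "\<alpha> u \<le> d u")
    case True
    then have "real (d u choose \<alpha> u) \<le> exp (h u (d u))"
      using u by (intro Suc.prems(2)) (auto simp: d_def)
    then show ?thesis by simp
  qed (simp add: binomial_eq_0)
  also have "\<dots> = exp (h u (d u) + B)" by (simp add: exp_add)
  also have "\<dots> \<le> exp (\<Sum>v \<in> V. average (h v) (d v))"
  proof -
    have "B = (\<Sum>w \<in> W. average (h w) (d w) +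
        (if w \<in> N then average (h w) (d w - 1) - average (h w) (d w) else 0))"
      unfolding B_def using dW by (intro sum.cong) auto
    also have "\<dots> = (\<Sum>w \<in> W. average (h w) (d w)) +
        (\<Sum>w \<in> N. average (h w) (d w - 1) - average (h w) (d w))"
    proof -
      have "W \<inter> N = N" using N by auto
      then show ?thesis using N by (simp add: sum.distrib sum.inter_restrict[symmetric])
    qed
    finally have "h u (d u) + B \<le> average (h u) (d u) + (\<Sum>w \<in> W. average (h w) (d w))"
      using cheap by (simp add: N_def)
    then show ?thesis using W N by simp
  qed
  finally show ?case by (simp add: d_def)
qed

definition max_choices :: "nat \<Rightarrow> nat \<Rightarrow> nat" where
  "max_choices d r =
     (if d = 3 then 1
      else if d = 4 \<and> r = 4 then 4
      else if r \<le> 1 then 1 else if r \<le> 3 then r else if r = 4 then 6 else r choose 3)"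

lemma choose_le_max_choices:
  assumes "3 \<le> d" "j \<le> 3" "j \<le> r" "r + 3 \<le> j + d"
  shows "r choose j \<le> max_choices d r"
proof (cases "d = 3 \<or> r \<le> 5")
  case True
  then have "j = r \<or> r \<in> {0, 1, 2, 3, 4, 5} \<and> d \<noteq> 3" "j \<in> {0, 1, 2, 3}" using assms by auto
  then show ?thesis using assms
    by (auto simp: max_choices_def numeral_eq_Suc split: if_splits)
next
  case False
  then have "r choose j \<le> r choose 3" using assms by (intro binomial_mono) auto
  then show ?thesis using False by (simp add: max_choices_def)
qed

lemma choose_three_Suc: "(Suc r choose 3) * (r - 2) = (r choose 3) * (r + 1)"
proof (cases "r \<ge> 2")
  case True
  then show ?thesis
    using binomial_absorb_comp[of "Suc r" 3] by (simp add: algebra_simps)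
qed (auto simp: binomial_eq_0 not_le less_2_cases_iff numeral_eq_Suc)

lemma choose_three_le:
  assumes "7 \<le> r"
  shows "real (r choose 3) \<le> 3.56 * (4 / 3) ^ (2 * r - 6)"
  using assms
proof (induction r rule: dec_induct)
  case base
  have "(7 :: nat) choose 3 = 35" by (simp add: numeral_eq_Suc)
  then show ?case by (simp add: power_divide)
next
  case (step r)
  have "real (Suc r choose 3) * (real r - 2) = real (r choose 3) * (real r + 1)"
    using arg_cong[OF choose_three_Suc[of r], of real] step(1) by (simp add: of_nat_diff algebra_simps)
  moreover have "9 * (real r + 1) \<le> 16 * (real r - 2)" using step(1) by simp
  then have "9 * (real (r choose 3) * (real r + 1)) \<le> real (r choose 3) * (16 * (real r - 2))"
    using mult_left_mono[of "9 * (real r + 1)" "16 * (real r - 2)" "real (r choose 3)"] by simp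
  ultimately have "9 * real (Suc r choose 3) * (real r - 2) \<le> 16 * real (r choose 3) * (real r - 2)"
    by (simp add: algebra_simps)
  then have "real (Suc r choose 3) \<le> (4 / 3) ^ 2 * real (r choose 3)"
    using step(1) by (simp add: power2_eq_square)
  also have "\<dots> \<le> (4 / 3) ^ 2 * (3.56 * (4 / 3) ^ (2 * r - 6))"
    using step.IH by (intro mult_left_mono) auto
  also have "\<dots> = 3.56 * (4 / 3) ^ (2 + (2 * r - 6))" by (simp only: power_add mult.left_commute)
  also have "2 + (2 * r - 6) = 2 * Suc r - 6" using step(1) by simp
  finally show ?case .
qed

lemma sum_ln_max_choices_le:
  assumes "real (\<Prod>r\<le>d. max_choices d r) \<le> (3.56 * (4 / 3) powr (real d - 6)) ^ (d + 1)"
    and "\<And>r. r \<le> d \<Longrightarrow> 0 < max_choices d r"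
  shows "(\<Sum>r\<le>d. ln (real (max_choices d r))) \<le> (real d + 1) * (ln 3.56 + (real d - 6) * ln (4 / 3))"
proof -
  have "(\<Sum>r\<le>d. ln (real (max_choices d r))) = ln (real (\<Prod>r\<le>d. max_choices d r))"
    using assms(2) by (subst of_nat_prod, subst ln_prod) auto
  also have "\<dots> \<le> ln ((3.56 * (4 / 3) powr (real d - 6)) ^ (d + 1))"
    using assms by (subst ln_le_cancel_iff) (auto intro!: prod_pos)
  also have "\<dots> = (real d + 1) * (ln 3.56 + (real d - 6) * ln (4 / 3))"
  proof -
    have "ln (3.56 * (4 / 3) powr (real d - 6)) = ln 3.56 + (real d - 6) * ln (4 / 3 :: real)"
      by (subst ln_mult) (simp_all add: ln_powr)
    then show ?thesis by (simp only: ln_realpow[of _ "d + 1"]) (simp add: add.commute)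
  qed
  finally show ?thesis .
qed

lemma max_choices_stable: "7 \<le> d \<Longrightarrow> max_choices d = max_choices 6"
  by (rule ext) (simp add: max_choices_def)

lemma average_max_choices_le:
  assumes "3 \<le> d"
  shows "average (\<lambda>r. ln (real (max_choices d r))) d \<le> ln 3.56 + (real d - 6) * ln (4 / 3)"
proof -
  let ?L = "ln 3.56 :: real" and ?\<mu> = "ln (4 / 3) :: real"
  have choose: "(6 :: nat) choose 3 = 20" "(5 :: nat) choose 3 = 10" by (simp_all add: numeral_eq_Suc)
  have powr: "(4 / 3 :: real) powr (-3) = 27 / 64" "(4 / 3 :: real) powr (-2) = 9 / 16"
    using powr_realpow[of "4 / 3 :: real" 3] powr_realpow[of "4 / 3 :: real" 2]
    by (simp_all only: powr_minus_divide) (simp_all add: power_divide)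
  have powr1: "(4 / 3 :: real) powr (-1) = 3 / 4"
    by (simp only: powr_minus_divide) simp
  have base: "(\<Sum>r\<le>6. ln (real (max_choices 6 r))) \<le> (real 6 + 1) * (?L + (real 6 - 6) * ?\<mu>)"
  proof (rule sum_ln_max_choices_le)
    have "{..6 :: nat} = {0, 1, 2, 3, 4, 5, 6}" by auto
    then have "(\<Prod>r\<le>6. max_choices 6 r) = 7200" by (simp add: max_choices_def choose)
    then show "real (\<Prod>r\<le>6. max_choices 6 r) \<le> (3.56 * (4 / 3) powr (real 6 - 6)) ^ (6 + 1)"
      by (simp add: power_divide)
  qed (simp add: max_choices_def zero_less_binomial)
  have "(\<Sum>r\<le>d. ln (real (max_choices d r))) \<le> (real d + 1) * (?L + (real d - 6) * ?\<mu>)"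
  proof (cases "d \<le> 6")
    case True
    then consider "d = 3" | "d = 4" | "d = 5" | "d = 6" using assms by linarith
    then show ?thesis
    proof cases
      case 1
      have "{..3 :: nat} = {0, 1, 2, 3}" by auto
      then show ?thesis unfolding 1
        by (intro sum_ln_max_choices_le) (auto simp: max_choices_def powr power_divide)
    next
      case 2
      have "{..4 :: nat} = {0, 1, 2, 3, 4}" by auto
      then show ?thesis unfolding 2
        by (intro sum_ln_max_choices_le) (auto simp: max_choices_def powr power_divide)
    next
      case 3
      have "{..5 :: nat} = {0, 1, 2, 3, 4, 5}" by auto
      then show ?thesis unfolding 3
        by (intro sum_ln_max_choices_le)
          (auto simp: max_choices_def powr1 power_divide choose intro!: zero_less_binomial)
    next
      case 4
      then show ?thesis using base by simp
    qed
  next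
    case False
    then have "6 \<le> d" by simp
    then have "(\<Sum>r\<le>d. ln (real (max_choices 6 r))) \<le> (real d + 1) * (?L + (real d - 6) * ?\<mu>)"
    proof (induction d rule: dec_induct)
      case base
      show ?case using \<open>(\<Sum>r\<le>6. ln (real (max_choices 6 r))) \<le> _\<close> by simp
    next
      case (step d)
      have "max_choices 6 (Suc d) = Suc d choose 3" using step(1) by (simp add: max_choices_def)
      then have "ln (real (max_choices 6 (Suc d))) \<le> ln (3.56 * (4 / 3) ^ (2 * Suc d - 6))"
        using step(1) choose_three_le[of "Suc d"]
        by (subst ln_le_cancel_iff) (auto intro!: zero_less_binomial)
      also have "\<dots> = ?L + real (2 * Suc d - 6) * ?\<mu>"
        by (subst ln_mult) (auto simp: ln_realpow)
      also have "real (2 * Suc d - 6) = 2 * real d - 4" using step(1) by (simp add: of_nat_diff)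
      finally have "ln (real (max_choices 6 (Suc d))) \<le> ?L + (2 * real d - 4) * ?\<mu>" .
      then show ?case using step.IH by (simp add: algebra_simps)
    qed
    moreover have "max_choices d = max_choices 6" using False by (intro max_choices_stable) simp
    ultimately show ?thesis by simp
  qed
  then show ?thesis by (simp add: average_def divide_simps mult.commute)
qed

locale schnyder_wood = triangulation +
  fixes c :: "'a dart \<Rightarrow> 3 option"
  assumes wood: "c \<in> schnyder_woods M a"
begin

abbreviation "next_dart \<equiv> susp_rot M a"
abbreviation "darts \<equiv> darts_at M a"
abbreviation "out \<equiv> out_dart M a c"

definition "directed = {d. c d \<noteq> None}"
definition "directed_arcs = {d \<in> A. c (Edge d) \<noteq> None}"

lemma W1: "(u, v) \<in> A \<Longrightarrow> c (Edge (u, v)) \<noteq> None \<or> c (Edge (v, u)) \<noteq> None"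
  using wood by (auto simp: schnyder_woods_def W1_def)

lemma W2: "c (Half (a i)) = Some i"
  using wood by (simp add: schnyder_woods_def W2_def)

lemma out_props:
  assumes "v \<in> V"
  shows "out v i \<in> darts v" "c (out v i) = Some i"
    and "d \<in> darts v \<Longrightarrow> c d = Some i \<Longrightarrow> d = out v i"
proof -
  have "\<exists>!d. d \<in> darts v \<and> c d = Some i"
    using wood assms by (simp add: schnyder_woods_def W3_def)
  note ex1 = this
  show "out v i \<in> darts v" "c (out v i) = Some i"
    using theI'[OF ex1] unfolding out_dart_def by blast+
  show "d \<in> darts v \<Longrightarrow> c d = Some i \<Longrightarrow> d = out v i"
    using the1_equality[OF ex1] unfolding out_dart_def by blast
qed

lemma inj_out: "v \<in> V \<Longrightarrow> inj (out v)"
  by (rule injI) (metis out_props(2) option.inject)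

lemma triple:
  assumes "v \<in> V"
  shows "cyclic_triple next_dart (darts v) (out v)"
proof (rule cyclic_triple_if_sector[where i = 1])
  show "cyclic_on next_dart (darts v)" using susp_cyclic[OF assms] out_props(1)[OF assms] by blast
  have "out v 2 \<in> sector next_dart (out v 1) (out v 3)"
    using wood assms by (simp add: schnyder_woods_def W3_def)
  then show "out v (1 + 1) \<in> sector next_dart (out v 1) (out v (1 + 2))" by simp
qed (use assms out_props inj_out in auto)

lemma entering:
  assumes "(u, v) \<in> A" "c (Edge (u, v)) = Some i"
  shows "Edge (v, u) \<in> sector next_dart (out v (i + 1)) (out v (i + 2))"
proof -
  have "v \<in> V" using assms(1) by (rule in_arcsD2)
  then have "Edge (v, u) \<in> sector next_dart (out v (i + 1)) (out v (i - 1))"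
    using wood assms by (simp add: schnyder_woods_def W3_def)
  then show ?thesis by simp
qed

lemma directed_darts: "v \<in> V \<Longrightarrow> directed \<inter> darts v = range (out v)"
  using out_props[of v] unfolding directed_def by fastforce

lemma directed_subset: "directed \<subseteq> (\<Union>v \<in> V. darts v)"
  using wood by (auto simp: schnyder_woods_def directed_def)

lemma out_half: "out (a i) i = Half (a i)"
  using out_props(3)[OF a_in_V, of "Half (a i)" i i] W2 by (simp add: darts_outer)

lemma arc_dart: "(u, v) \<in> A \<Longrightarrow> Edge (u, v) \<in> darts u"
  by (auto simp: darts_at_def)

lemma arc_back: "(a (i + 1), a i) \<in> A" using arc_next[of i] arc_sym by blast

lemma next_back: "next_dart (Edge (a (i + 1), a i)) = Half (a (i + 1))"
  using susp_rot_prev[of "i + 1"] by simp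

lemma outer_directed:
  "c (Edge (a i, a (i + 1))) \<noteq> None" (is ?fwd) "c (Edge (a (i + 1), a i)) \<noteq> None" (is ?bwd)
proof -
  let ?u = "a i" and ?v = "a (i + 1)"
  note adjacent_u = cyclic_triple_adjacent[OF triple[OF a_in_V[of i]]]
  note adjacent_v = cyclic_triple_adjacent[OF triple[OF a_in_V[of "i + 1"]]]
  have next_u: "next_dart (out ?u i) = Edge (?u, ?v)" by (simp only: out_half susp_rot_Half)
  show ?fwd
  proof
    assume none: "c (Edge (?u, ?v)) = None"
    then obtain j where j: "c (Edge (?v, ?u)) = Some j" using W1[OF arc_next[of i]] by auto
    then have "out ?v j = Edge (?v, ?u)"
      using out_props(3)[OF a_in_V arc_dart[OF arc_back] j] by simp
    then have "next_dart (out ?v j) = out ?v (i + 1)"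
      by (simp only: next_back out_half)
    then have "j = i" using adjacent_v(3)[of j "i + 1"] by simp
    then have "next_dart (out ?u i) = out ?u (i + 1)"
      using adjacent_u(1)[of i] entering[OF arc_back j] next_u by simp
    then have "Edge (?u, ?v) = out ?u (i + 1)" using next_u by simp
    then show False using none out_props(2)[OF a_in_V[of i], of "i + 1"] by simp
  qed
  show ?bwd
  proof
    assume none: "c (Edge (?v, ?u)) = None"
    then obtain j where j: "c (Edge (?u, ?v)) = Some j" using W1[OF arc_next[of i]] by auto
    then have "out ?u j = Edge (?u, ?v)"
      using out_props(3)[OF a_in_V arc_dart[OF arc_next] j] by simp
    then have "i = j + 2" using adjacent_u(3)[of i j] next_u by simp
    then have "j = i + 1" by simp
    then have "Edge (?v, ?u) = out ?v (i + 1 + 2)"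
      using adjacent_v(2)[of "Edge (?v, ?u)" "i + 1"] entering[OF arc_next j]
      by (simp add: next_back out_half del: susp_rot.simps)
    then show False using none out_props(2)[OF a_in_V[of "i + 1"], of i] by simp
  qed
qed

definition "outer_pairs = range (\<lambda>i. (a i, a (i + 1))) \<union> range (\<lambda>i. (a (i + 1), a i))"

lemma directed_eq: "directed = Edge ` directed_arcs \<union> Half ` range a"
proof
  show "directed \<subseteq> Edge ` directed_arcs \<union> Half ` range a"
  proof
    fix d assume d: "d \<in> directed"
    then obtain v where "d \<in> darts v" using directed_subset by blast
    then show "d \<in> Edge ` directed_arcs \<union> Half ` range a"
      using d by (auto simp: darts_at_def directed_arcs_def directed_def split: if_splits)
  qed
qed (auto simp: directed_arcs_def directed_def W2)

lemma card_directed_arcs: "card directed_arcs + 3 = 3 * card V"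
proof -
  have disj: "darts u \<inter> darts v = {}" if "u \<noteq> v" for u v
    using that by (auto simp: darts_at_def)
  have "directed = (\<Union>v \<in> V. directed \<inter> darts v)" using directed_subset by blast
  also have "card \<dots> = (\<Sum>v \<in> V. card (directed \<inter> darts v))"
  proof (rule card_UN_disjoint[OF finite_V])
    show "\<forall>v \<in> V. finite (directed \<inter> darts v)" using directed_darts by simp
    show "\<forall>u \<in> V. \<forall>v \<in> V. u \<noteq> v \<longrightarrow> directed \<inter> darts u \<inter> (directed \<inter> darts v) = {}"
      using disj by blast
  qed
  also have "\<dots> = (\<Sum>v \<in> V. 3)"
  proof (rule sum.cong)
    fix v assume "v \<in> V"
    then show "card (directed \<inter> darts v) = 3"
      using card_image[OF inj_out] card_UNIV_three by (simp add: directed_darts)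
  qed simp
  finally have "card directed = 3 * card V" by simp
  moreover have "finite directed_arcs" using finite_A by (simp add: directed_arcs_def)
  then have "card directed = card (Edge ` directed_arcs) + card (Half ` range a)"
    unfolding directed_eq by (intro card_Un_disjoint) auto
  moreover have "card (Edge ` directed_arcs) = card directed_arcs" by (rule card_image) (simp add: inj_on_def)
  moreover have "card (Half ` range a) = card (UNIV :: 3 set)"
    unfolding image_image by (rule card_image) (simp add: inj_on_def)
  ultimately show ?thesis using card_UNIV_three by simp
qed

lemma bidirected_eq: "directed_arcs \<inter> prod.swap ` directed_arcs = outer_pairs"
proof (rule sym, rule card_subset_eq)
  have fin: "finite directed_arcs" using finite_A by (simp add: directed_arcs_def)
  then show "finite (directed_arcs \<inter> prod.swap ` directed_arcs)" by simp
  show "outer_pairs \<subseteq> directed_arcs \<inter> prod.swap ` directed_arcs"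
    using outer_directed arc_next arc_back
    by (auto simp: outer_pairs_def directed_arcs_def image_iff)
  have "card outer_pairs = card (range (\<lambda>i. (a i, a (i + 1)))) + card (range (\<lambda>i. (a (i + 1), a i)))"
    unfolding outer_pairs_def by (rule card_Un_disjoint) auto
  also have "card (range (\<lambda>i. (a i, a (i + 1)))) = card (UNIV :: 3 set)"
    by (rule card_image) (simp add: inj_on_def)
  also have "card (range (\<lambda>i. (a (i + 1), a i))) = card (UNIV :: 3 set)"
    by (rule card_image) (simp add: inj_on_def)
  finally have six: "card outer_pairs = 6" using card_UNIV_three by simp
  have "directed_arcs \<union> prod.swap ` directed_arcs = A"
  proof
    show "A \<subseteq> directed_arcs \<union> prod.swap ` directed_arcs"
    proof
      fix d assume d: "d \<in> A"
      obtain u v where uv: "d = (u, v)" by fastforce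
      then show "d \<in> directed_arcs \<union> prod.swap ` directed_arcs"
        using d W1[of u v] arc_sym[of u v] by (force simp: directed_arcs_def image_iff)
    qed
  qed (auto simp: directed_arcs_def dest: arcs_symmetric)
  then have "card directed_arcs + card (prod.swap ` directed_arcs) = card A + card (directed_arcs \<inter> prod.swap ` directed_arcs)"
    using card_Un_Int[OF fin finite_imageI[OF fin, of prod.swap]] by simp
  moreover have "card (prod.swap ` directed_arcs) = card directed_arcs"
    by (intro card_image inj_onI) (metis swap_swap)
  ultimately show "card outer_pairs = card (directed_arcs \<inter> prod.swap ` directed_arcs)"
    using six card_directed_arcs card_arcs by simp
qed

definition "interior_arcs = A - outer_pairs"
definition "interior_out v = (if v \<in> range a then 0 else 3 :: nat)"

lemma outer_out_range: "range (out (a i)) = {Half (a i), Edge (a i, a (i + 1)), Edge (a i, a (i + 2))}"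
proof (rule sym, rule card_subset_eq)
  show "{Half (a i), Edge (a i, a (i + 1)), Edge (a i, a (i + 2))} \<subseteq> range (out (a i))"
    using outer_directed(1)[of i] outer_directed(2)[of "i + 2"] W2[of i] arc_next arc_prev
    unfolding directed_darts[OF a_in_V, symmetric] by (auto simp: directed_def darts_outer)
  have "card (range (out (a i))) = card (UNIV :: 3 set)"
    by (rule card_image) (rule inj_out[OF a_in_V])
  then show "card {Half (a i), Edge (a i, a (i + 1)), Edge (a i, a (i + 2))} = card (range (out (a i)))"
    using card_UNIV_three by simp
qed simp

lemma orientation: "directed_arcs - outer_pairs \<in> orientations V interior_arcs interior_out"
  unfolding orientations_def
proof (intro CollectI conjI ballI impI)
  show "directed_arcs - outer_pairs \<subseteq> interior_arcs \<inter> V \<times> V"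
    by (auto simp: directed_arcs_def interior_arcs_def dest: in_arcsD1 in_arcsD2)
next
  fix u v assume uv: "u \<in> V" "v \<in> V" "(u, v) \<in> interior_arcs"
  then have "(u, v) \<in> A" "(v, u) \<in> A" "(u, v) \<notin> outer_pairs" "(v, u) \<notin> outer_pairs"
    using arc_sym[of u v] by (auto simp: interior_arcs_def outer_pairs_def)
  moreover have "(u, v) \<in> directed_arcs \<and> (v, u) \<in> directed_arcs \<longrightarrow> (u, v) \<in> outer_pairs"
    unfolding bidirected_eq[symmetric] by (auto intro: rev_image_eqI[of "(v, u)"])
  ultimately show "((u, v) \<in> directed_arcs - outer_pairs) = ((v, u) \<notin> directed_arcs - outer_pairs)"
    using W1[of u v] by (auto simp: directed_arcs_def)
next
  fix v assume v: "v \<in> V"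
  let ?N = "{w. (v, w) \<in> directed_arcs - outer_pairs}"
  show "card ?N = interior_out v"
  proof (cases "v \<in> range a")
    case True
    then obtain i where i: "v = a i" by blast
    have "?N = {}"
    proof (intro equals0I)
      fix w assume "w \<in> ?N"
      then have w: "Edge (v, w) \<in> directed \<inter> darts v" "(v, w) \<notin> outer_pairs"
        using arc_dart by (auto simp: directed_arcs_def directed_def)
      then have "Edge (v, w) \<in> range (out v)" using directed_darts[OF v] by simp
      then have "w = a (i + 1) \<or> w = a (i + 2)" unfolding i outer_out_range by auto
      moreover have "(a i, a (i + 2)) \<in> outer_pairs"
        unfolding outer_pairs_def by (rule UnI2, rule range_eqI[of _ _ "i + 2"]) simp
      ultimately show False using w(2) i by (auto simp: outer_pairs_def)
    qed
    then have "card ?N = 0" by (simp only: card.empty)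
    then show ?thesis using True by (simp add: interior_out_def)
  next
    case False
    have "(\<lambda>w. Edge (v, w)) ` ?N = range (out v)"
    proof -
      have "(v, w) \<notin> outer_pairs" for w using False by (auto simp: outer_pairs_def)
      then show ?thesis
        unfolding directed_darts[OF v, symmetric] using False
        by (auto simp: directed_arcs_def directed_def darts_inner)
    qed
    moreover have "card ((\<lambda>w. Edge (v, w)) ` ?N) = card ?N"
      by (rule card_image) (simp add: inj_on_def)
    moreover have "card (range (out v)) = 3"
      using card_image[OF inj_out[OF v]] card_UNIV_three by simp
    ultimately show ?thesis using False by (simp add: interior_out_def)
  qed
qed

lemma degree_ge_three:
  assumes "v \<in> V" "v \<notin> range a"
  shows "3 \<le> card (star v)"
proof -
  have "range (out v) \<subseteq> Edge ` star v"
    using out_props(1)[OF assms(1)] darts_inner[OF assms(2)] by auto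
  then have "card (range (out v)) \<le> card (Edge ` star v)"
    using finite_A by (intro card_mono) auto
  also have "\<dots> \<le> card (star v)" using finite_A by (intro card_image_le) auto
  finally show ?thesis using card_image[OF inj_out[OF assms(1)]] card_UNIV_three by simp
qed

end


context triangulation
begin

definition "interior_map c = schnyder_wood.directed_arcs M c - schnyder_wood.outer_pairs a"

lemma wood_determined:
  assumes "c \<in> schnyder_woods M a" "c' \<in> schnyder_woods M a"
    and same: "schnyder_wood.directed_arcs M c = schnyder_wood.directed_arcs M c'"
  shows "c = c'"
proof -
  interpret w: schnyder_wood M a c by unfold_locales fact
  interpret w': schnyder_wood M a c' by unfold_locales fact
  have dir: "w'.directed = w.directed" using same by (simp add: w.directed_eq w'.directed_eq)
  have defined: "c d \<noteq> None \<longleftrightarrow> c' d \<noteq> None" for d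
    using dir unfolding w.directed_def w'.directed_def by (metis (mono_tags) mem_Collect_eq)
  have spread: "w.out v = w'.out v" if v: "v \<in> V" and eq: "w.out v i = w'.out v i" for v i
  proof -
    have step: "w.out v (j + 1) = w'.out v (j + 1)" if j: "w.out v j = w'.out v j" for j
      using cyclic_triple_next_in(1)[OF w.triple[OF v] w.directed_darts[OF v], of j]
        cyclic_triple_next_in(1)[OF w'.triple[OF v] w'.directed_darts[OF v], of j]
      unfolding dir j by (rule next_in_unique)
    have "w.out v (i + 1) = w'.out v (i + 1)" using eq by (rule step)
    moreover from this have "w.out v (i + 1 + 1) = w'.out v (i + 1 + 1)" by (rule step)
    ultimately have "w.out v k = w'.out v k" for k
      using eq three_total[of k i] by (elim disjE) simp_all
    then show ?thesis ..
  qed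
  have agree: "w.out v = w'.out v" if "v \<in> V" for v
  proof (rule connected_induct[OF a_in_V that, where P = "\<lambda>v. w.out v = w'.out v"])
    show corner: "w.out (a i) = w'.out (a i)" for i
      using spread[OF a_in_V, of i i] by (simp add: w.out_half w'.out_half)
    fix x y assume xy: "(x, y) \<in> A" and x: "w.out x = w'.out x"
    have V: "x \<in> V" "y \<in> V" using xy by (auto dest: in_arcsD1 in_arcsD2)
    have yx: "(y, x) \<in> A" using xy arc_sym by blast
    note enter = cyclic_triple_next_in(2)[OF w.triple w.directed_darts]
    note enter' = cyclic_triple_next_in(2)[OF w'.triple w'.directed_darts, unfolded dir]
    show "w.out y = w'.out y"
    proof (cases "Edge (x, y) \<in> w.directed \<and> Edge (y, x) \<in> w.directed")
      case True
      then have "(x, y) \<in> w.directed_arcs \<inter> prod.swap ` w.directed_arcs"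
        using xy yx by (auto simp: w.directed_arcs_def w.directed_def intro: rev_image_eqI[of "(y, x)"])
      then obtain i where "y = a i" unfolding w.bidirected_eq w.outer_pairs_def by auto
      then show ?thesis using corner by simp
    next
      case False
      show ?thesis
      proof (cases "Edge (x, y) \<in> w.directed")
        case True
        then obtain i i' where i: "c (Edge (x, y)) = Some i" "c' (Edge (x, y)) = Some i'"
          using defined[of "Edge (x, y)"] by (auto simp: w.directed_def)
        have "w.out x i = w'.out x i'"
          using w.out_props(3)[OF V(1) w.arc_dart[OF xy] i(1)] w'.out_props(3)[OF V(1) w.arc_dart[OF xy] i(2)]
          by simp
        then have "i' = i" using x w.inj_out[OF V(1)] by (simp add: inj_eq)
        moreover have "Edge (y, x) \<notin> w.directed" using True False by simp
        ultimately have "w.out y (i + 2) = w'.out y (i + 2)"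
          using enter[OF V(2) V(2) w.entering[OF xy i(1)]] enter'[OF V(2) V(2) w'.entering[OF xy i(2)]]
          by (auto intro: next_in_unique)
        then show ?thesis by (rule spread[OF V(2)])
      next
        case nxy: False
        then have "Edge (y, x) \<in> w.directed" using w.W1[OF xy] by (simp add: w.directed_def)
        then obtain i i' where i: "c (Edge (y, x)) = Some i" "c' (Edge (y, x)) = Some i'"
          using defined[of "Edge (y, x)"] by (auto simp: w.directed_def)
        have "w.out x (i + 2) = w'.out x (i' + 2)"
          using enter[OF V(1) V(1) w.entering[OF yx i(1)] nxy] enter'[OF V(1) V(1) w'.entering[OF yx i(2)] nxy]
          by (rule next_in_unique)
        then have "i' = i" using x w.inj_out[OF V(1)] by (simp add: inj_eq)
        then have "w.out y i = w'.out y i"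
          using w.out_props(3)[OF V(2) w.arc_dart[OF yx] i(1)] w'.out_props(3)[OF V(2) w.arc_dart[OF yx] i(2)]
          by simp
        then show ?thesis by (rule spread[OF V(2)])
      qed
    qed
  qed
  show ?thesis
  proof
    fix d
    show "c d = c' d"
    proof (cases "d \<in> w.directed")
      case True
      then obtain v where v: "v \<in> V" "d \<in> w.darts v" using w.directed_subset by blast
      then obtain i where "d = w.out v i" using True w.directed_darts[OF v(1)] by blast
      then show ?thesis using w.out_props(2)[OF v(1)] w'.out_props(2)[OF v(1)] agree[OF v(1)] by simp
    next
      case False
      then show ?thesis using defined[of d] by (simp add: w.directed_def)
    qed
  qed
qed

lemma sum_degrees: "(\<Sum>v \<in> V. card (star v)) = card A"
proof -
  have "A = (\<Union>v \<in> V. star v)" using arc_fst_in_verts by blast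
  also have "card \<dots> = (\<Sum>v \<in> V. card (star v))"
    using finite_V finite_A by (intro card_UN_disjoint) auto
  finally show ?thesis ..
qed

lemma sum_interior_degrees: "(\<Sum>v \<in> V - range a. card (star v)) + 18 \<le> 6 * card V"
proof -
  have "2 \<le> card (star (a i))" for i
  proof -
    have "card {(a i, a (i + 1)), (a i, a (i + 2))} \<le> card (star (a i))"
      using arc_next[of i] arc_prev[of i] finite_A by (intro card_mono) auto
    then show ?thesis by simp
  qed
  then have "(\<Sum>v \<in> range a. 2) \<le> (\<Sum>v \<in> range a. card (star v))" by (intro sum_mono) auto
  moreover have "card (range a) = 3" using card_image[OF inj_a] card_UNIV_three by simp
  moreover have "(\<Sum>v \<in> V. card (star v)) = (\<Sum>v \<in> V - range a. card (star v)) + (\<Sum>v \<in> range a. card (star v))"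
    using finite_V a_in_V by (intro sum.subset_diff) auto
  ultimately show ?thesis using sum_degrees card_arcs by simp
qed

theorem card_schnyder_woods_le: "real (card (schnyder_woods M a)) \<le> 3.56 ^ card V"
  and finite_schnyder_woods: "finite (schnyder_woods M a)"
proof -
  define E where "E = A - (range (\<lambda>i. (a i, a (i + 1))) \<union> range (\<lambda>i. (a (i + 1), a i)))"
  define \<alpha> where "\<alpha> v = (if v \<in> range a then 0 else 3 :: nat)" for v
  let ?f = "\<lambda>c. {d \<in> A. c (Edge d) \<noteq> None} - (range (\<lambda>i. (a i, a (i + 1))) \<union> range (\<lambda>i. (a (i + 1), a i)))"
  have into: "?f ` schnyder_woods M a \<subseteq> orientations V E \<alpha>"
  proof (rule image_subsetI)
    fix c assume "c \<in> schnyder_woods M a"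
    then interpret w: schnyder_wood M a c by unfold_locales
    show "?f c \<in> orientations V E \<alpha>"
      using w.orientation unfolding w.directed_arcs_def w.outer_pairs_def w.interior_arcs_def w.interior_out_def
        E_def \<alpha>_def by simp
  qed
  have inj: "inj_on ?f (schnyder_woods M a)"
  proof (rule inj_onI)
    fix c c' assume c: "c \<in> schnyder_woods M a" "c' \<in> schnyder_woods M a" and eq: "?f c = ?f c'"
    interpret w: schnyder_wood M a c by unfold_locales fact
    interpret w': schnyder_wood M a c' by unfold_locales fact
    have "w.outer_pairs \<subseteq> w.directed_arcs" "w'.outer_pairs \<subseteq> w'.directed_arcs"
      using w.bidirected_eq w'.bidirected_eq by auto
    moreover have "w.directed_arcs - w.outer_pairs = w'.directed_arcs - w'.outer_pairs"
      using eq unfolding w.directed_arcs_def w.outer_pairs_def w'.directed_arcs_def w'.outer_pairs_def .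
    moreover have "w.outer_pairs = w'.outer_pairs" unfolding w.outer_pairs_def w'.outer_pairs_def ..
    ultimately have "w.directed_arcs = w'.directed_arcs" by blast
    then show "c = c'" by (rule wood_determined[OF c])
  qed
  have fin: "finite (orientations V E \<alpha>)" using finite_V by (rule finite_orientations)
  show "finite (schnyder_woods M a)" using inj_on_finite[OF inj into fin] .
  show "real (card (schnyder_woods M a)) \<le> 3.56 ^ card V"
  proof (cases "schnyder_woods M a = {}")
    case True
    then show ?thesis by simp
  next
    case False
    then obtain c where c: "c \<in> schnyder_woods M a" by blast
    interpret w: schnyder_wood M a c by unfold_locales fact
    have deg3: "3 \<le> card (star v)" if "v \<in> V - range a" for v
      using w.degree_ge_three that by blast
    have deg: "card (nbrs V E v) = card (star v)" if "v \<in> V - range a" for v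
    proof -
      have "Pair v ` nbrs V E v = star v"
        using that by (auto simp: nbrs_def E_def image_iff dest: in_arcsD2)
      moreover have "card (Pair v ` nbrs V E v) = card (nbrs V E v)"
        by (rule card_image) (simp add: inj_on_def)
      ultimately show ?thesis by simp
    qed
    define h where "h v r = (if v \<in> range a then 0 else ln (real (max_choices (card (star v)) r)))" for v r
    have "real (card (orientations V E \<alpha>)) \<le> exp (\<Sum>v \<in> V. average (h v) (card (nbrs V E v)))"
    proof (rule card_orientations_le[OF finite_V])
      show "sym E" by (rule symI) (auto simp: E_def arc_sym)
      show "irrefl E" using pair_no_loops unfolding irrefl_def E_def by fastforce
      fix v r j assume v: "v \<in> V" and j: "j \<le> \<alpha> v" "j \<le> r" "r + \<alpha> v \<le> j + card (nbrs V E v)"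
      show "real (r choose j) \<le> exp (h v r)"
      proof (cases "v \<in> range a")
        case True
        then show ?thesis using j(1) by (simp add: \<alpha>_def h_def)
      next
        case False
        then have le: "r choose j \<le> max_choices (card (star v)) r"
          using j v deg[of v] deg3[of v] by (intro choose_le_max_choices) (auto simp: \<alpha>_def)
        moreover have "0 < r choose j" using j(2) by (simp only: zero_less_binomial)
        ultimately have "0 < max_choices (card (star v)) r" by linarith
        then have "exp (h v r) = real (max_choices (card (star v)) r)"
          using False by (simp add: h_def)
        then show ?thesis using le by simp
      qed
    qed
    moreover have "(\<Sum>v \<in> V. average (h v) (card (nbrs V E v))) \<le> real (card V) * ln 3.56"
    proof -
      have "(\<Sum>v \<in> V. average (h v) (card (nbrs V E v))) = (\<Sum>v \<in> V - range a. average (h v) (card (nbrs V E v)))"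
        using finite_V by (intro sum.mono_neutral_right) (auto simp: average_def h_def)
      also have "\<dots> \<le> (\<Sum>v \<in> V - range a. ln 3.56 + (real (card (star v)) - 6) * ln (4 / 3))"
      proof (rule sum_mono)
        fix v assume v: "v \<in> V - range a"
        then have "h v = (\<lambda>r. ln (real (max_choices (card (star v)) r)))" by (auto simp: h_def)
        then show "average (h v) (card (nbrs V E v)) \<le> ln 3.56 + (real (card (star v)) - 6) * ln (4 / 3)"
          using average_max_choices_le[OF deg3[OF v]] deg[OF v] by simp
      qed
      also have "\<dots> = real (card (V - range a)) * ln 3.56 +
          (real (\<Sum>v \<in> V - range a. card (star v)) - 6 * real (card (V - range a))) * ln (4 / 3)"
        by (simp add: sum.distrib sum_subtractf sum_distrib_left[symmetric] algebra_simps)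
      also have "\<dots> \<le> real (card (V - range a)) * ln 3.56 + 0"
      proof -
        have three: "card (range a) = 3" using card_image[OF inj_a] card_UNIV_three by simp
        have sub: "range a \<subseteq> V" using a_in_V by blast
        have "card (V - range a) = card V - 3" using card_Diff_subset[OF _ sub] three by simp
        moreover have "3 \<le> card V" using card_mono[OF finite_V sub] three by simp
        ultimately have "card (V - range a) + 3 = card V" by simp
        then have "(\<Sum>v \<in> V - range a. card (star v)) \<le> 6 * card (V - range a)"
          using sum_interior_degrees by linarith
        then have "real (\<Sum>v \<in> V - range a. card (star v)) \<le> 6 * real (card (V - range a))"
          using of_nat_mono[of _ "6 * card (V - range a)", where ?'a = real] by fastforce
        then show ?thesis by (intro add_left_mono mult_nonpos_nonneg) simp_all
      qed
      also have "\<dots> \<le> real (card V) * ln 3.56"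
        using card_mono[OF finite_V, of "V - range a"] by (simp add: mult_right_mono)
      finally show ?thesis .
    qed
    ultimately have "real (card (orientations V E \<alpha>)) \<le> exp (real (card V) * ln 3.56)"
      by (meson exp_le_cancel_iff order_trans)
    moreover have "exp (real (card V) * ln 3.56) = (3.56 :: real) ^ card V"
      by (subst exp_of_nat_mult) simp
    moreover have "card (schnyder_woods M a) \<le> card (orientations V E \<alpha>)"
      using card_inj_on_le[OF inj into fin] .
    ultimately show ?thesis by linarith
  qed
qed

end

fun follow :: "'a \<Rightarrow> 'a list \<Rightarrow> 'a \<Rightarrow> 'a" where
  "follow z (x # y # ys) v = (if v = x then y else follow z (y # ys) v)"
| "follow z xs v = z"

definition cyclic_next :: "'a list \<Rightarrow> 'a \<Rightarrow> 'a" where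
  "cyclic_next xs = follow (hd xs) xs"

lemma follow_nth:
  "distinct xs \<Longrightarrow> i < length xs \<Longrightarrow> follow z xs (xs ! i) = (if Suc i < length xs then xs ! Suc i else z)"
proof (induction xs arbitrary: i)
  case (Cons x xs)
  show ?case
  proof (cases xs)
    case Nil
    then show ?thesis using Cons.prems by simp
  next
    case (Cons y ys)
    show ?thesis
    proof (cases i)
      case 0
      then show ?thesis using Cons by simp
    next
      case (Suc k)
      then have "k < length xs" "xs ! k \<noteq> x" using Cons.prems by (auto simp: nth_mem)
      then show ?thesis using Cons.IH[of k] Cons.prems(1) Suc Cons by simp
    qed
  qed
qed simp

lemma cyclic_next_cyclic_on:
  assumes "distinct xs" "xs \<noteq> []"
  shows "cyclic_on (cyclic_next xs) (set xs)"
proof -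
  let ?f = "cyclic_next xs"
  have nth: "?f (xs ! i) = (if Suc i < length xs then xs ! Suc i else xs ! 0)" if "i < length xs" for i
    using follow_nth[OF assms(1) that] assms(2) by (simp add: cyclic_next_def hd_conv_nth)
  have pow: "(?f ^^ i) (xs ! 0) = xs ! i" if "i < length xs" for i
    using that by (induction i) (simp_all add: nth)
  have "(?f ^^ length xs) (xs ! 0) = ?f ((?f ^^ (length xs - 1)) (xs ! 0))"
    using assms(2) by (cases "length xs") simp_all
  also have "\<dots> = xs ! 0" using assms(2) by (simp add: pow nth)
  finally have "orbit ?f (xs ! 0) = {(?f ^^ m) (xs ! 0) | m. m < length xs}"
    using assms(2) by (intro orbit_altdef_bounded) auto
  also have "\<dots> = {xs ! m | m. m < length xs}" using pow by metis
  also have "\<dots> = set xs" by (auto simp: set_conv_nth)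
  finally show ?thesis
    using assms(2) unfolding cyclic_on_def by (intro bexI[of _ "xs ! 0"]) auto
qed

lemma cyclic_next_in: "distinct xs \<Longrightarrow> v \<in> set xs \<Longrightarrow> cyclic_next xs v \<in> set xs"
  by (rule cyclic_on_inI[OF cyclic_next_cyclic_on]) auto

definition list_arcs :: "nat \<Rightarrow> (nat \<Rightarrow> nat list) \<Rightarrow> (nat \<times> nat) set" where
  "list_arcs n nb = {(u, v). u < n \<and> v \<in> set (nb u)}"

definition list_map :: "nat \<Rightarrow> (nat \<Rightarrow> nat list) \<Rightarrow> nat \<times> nat \<Rightarrow> nat plane_map" where
  "list_map n nb d =
     (let r = \<lambda>(u, v). if (u, v) \<in> list_arcs n nb then (u, cyclic_next (nb u) v) else (u, v)
      in \<lparr>graph = \<lparr>pverts = {..<n}, parcs = list_arcs n nb\<rparr>, rot = r, outer = orbit (r \<circ> prod.swap) d\<rparr>)"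

locale neighbour_lists =
  fixes n :: nat and nb :: "nat \<Rightarrow> nat list" and d :: "nat \<times> nat"
  assumes distinct_nb: "u < n \<Longrightarrow> distinct (nb u)"
    and nb_less: "u < n \<Longrightarrow> v \<in> set (nb u) \<Longrightarrow> v < n \<and> v \<noteq> u"
    and triangle: "u < n \<Longrightarrow> v \<in> set (nb u) \<Longrightarrow>
      cyclic_next (nb u) v \<in> set (nb v) \<and> cyclic_next (nb v) (cyclic_next (nb u) v) = u"
    and count: "(\<Sum>u<n. length (nb u)) + 12 = 6 * n"
    and earlier: "0 < u \<Longrightarrow> u < n \<Longrightarrow> \<exists>v<u. v \<in> set (nb u)"
    and root: "d \<in> list_arcs n nb"
begin

abbreviation "M \<equiv> list_map n nb d"
abbreviation "arcset \<equiv> list_arcs n nb"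
abbreviation "next_at u \<equiv> cyclic_next (nb u)"

lemma M_simps [simp]:
  "vertices M = {..<n}" "edge_arcs M = arcset"
  "rot M (u, v) = (if (u, v) \<in> arcset then (u, next_at u v) else (u, v))"
  "outer M = orbit (face_succ M) d"
proof -
  show "outer M = orbit (face_succ M) d"
    by (simp add: list_map_def Let_def face_succ_def[abs_def] comp_def)
qed (simp_all add: list_map_def Let_def)

lemma arcs_iff: "(u, v) \<in> arcset \<longleftrightarrow> u < n \<and> v \<in> set (nb u)"
  by (simp add: list_arcs_def)

lemma finite_arcs: "finite arcset"
  by (rule finite_subset[of _ "{..<n} \<times> {..<n}"]) (use nb_less in \<open>auto simp: arcs_iff\<close>)

lemma arcs_ne: "(u, v) \<in> arcset \<Longrightarrow> u \<noteq> v" using nb_less by (auto simp: arcs_iff)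

lemma triangle_step:
  assumes "(u, v) \<in> arcset" "w = next_at u v"
  shows "(u, w) \<in> arcset" "(v, w) \<in> arcset" "(v, u) \<in> arcset" "next_at v w = u"
proof -
  have uv: "u < n" "v \<in> set (nb u)" "v < n" using assms(1) nb_less by (auto simp: arcs_iff)
  show "(u, w) \<in> arcset" using uv assms(2) cyclic_next_in[OF distinct_nb] by (simp add: arcs_iff)
  show vw: "(v, w) \<in> arcset" "next_at v w = u"
    using uv assms(2) triangle[of u v] by (auto simp: arcs_iff)
  then show "(v, u) \<in> arcset" using cyclic_next_in[OF distinct_nb[OF uv(3)], of w] by (auto simp: arcs_iff)
qed

lemma arcs_sym: "(u, v) \<in> arcset \<Longrightarrow> (v, u) \<in> arcset" using triangle_step(3) by blast

lemma triangle_full: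
  assumes "(u, v) \<in> arcset" "w = next_at u v"
  shows "(w, u) \<in> arcset" "(w, v) \<in> arcset" "next_at w u = v"
proof -
  note s = triangle_step[OF assms]
  note t = triangle_step[OF s(2), of u]
  show "(w, u) \<in> arcset" "(w, v) \<in> arcset" "next_at w u = v"
    using t s by auto
qed

lemma face_succ_arc:
  assumes "(u, v) \<in> arcset" "w = next_at u v"
  shows "face_succ M (v, u) = (u, w)" "face_succ M (u, w) = (w, v)" "face_succ M (w, v) = (v, u)"
  using assms triangle_step[OF assms] triangle_full[OF assms] by (simp_all add: face_succ_def)

lemma face_orbit:
  assumes "(u, v) \<in> arcset" "w = next_at u v"
  shows "orbit (face_succ M) (v, u) = {(v, u), (u, w), (w, v)}"
proof -
  note f = face_succ_arc[OF assms]
  have "(face_succ M ^^ 3) (v, u) = (v, u)" by (simp add: numeral_3_eq_3 f)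
  then have "orbit (face_succ M) (v, u) = {(face_succ M ^^ m) (v, u) | m. m < 3}"
    by (intro orbit_altdef_bounded) auto
  also have "\<dots> = (\<lambda>m. (face_succ M ^^ m) (v, u)) ` {..<3}" by blast
  also have "{..<3 :: nat} = {0, 1, 2}" by auto
  also have "(\<lambda>m. (face_succ M ^^ m) (v, u)) ` {0, 1, 2} = {(v, u), (u, w), (w, v)}"
    by (simp add: numeral_2_eq_2 f)
  finally show ?thesis .
qed

lemma card_face_orbit:
  assumes "(u, v) \<in> arcset"
  shows "card (orbit (face_succ M) (v, u)) = 3"
proof -
  define w where "w = next_at u v"
  have "u \<noteq> v" "u \<noteq> w" "v \<noteq> w"
    using arcs_ne assms triangle_step(1,2)[OF assms w_def] by auto
  then show ?thesis by (simp add: face_orbit[OF assms w_def])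
qed

lemma face_succ_bij: "bij_betw (face_succ M) arcset arcset"
proof -
  have cube: "face_succ M x \<in> arcset \<and> face_succ M (face_succ M (face_succ M x)) = x" if x: "x \<in> arcset" for x
  proof -
    obtain v u where vu: "x = (v, u)" by fastforce
    then have uv: "(u, v) \<in> arcset" using x arcs_sym by simp
    show ?thesis
      using face_succ_arc[OF uv refl] triangle_step(1)[OF uv refl] unfolding vu by simp
  qed
  then have "inj_on (face_succ M) arcset" by (metis inj_onI)
  moreover have "face_succ M ` arcset \<subseteq> arcset" using cube by blast
  ultimately show ?thesis using endo_inj_surj[OF finite_arcs] unfolding bij_betw_def by blast
qed

lemma rot_permutes_arcs: "rot M permutes arcset"
proof (rule bij_imp_permutes)
  have "bij_betw prod.swap arcset arcset"
    by (rule bij_betw_byWitness[where f' = prod.swap]) (use arcs_sym in auto)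
  from bij_betw_trans[OF this face_succ_bij]
  have "bij_betw (face_succ M \<circ> prod.swap) arcset arcset" .
  moreover have "face_succ M \<circ> prod.swap = rot M" by (auto simp: face_succ_def)
  ultimately show "bij_betw (rot M) arcset arcset" by simp
next
  fix x assume "x \<notin> arcset"
  then show "rot M x = x" by (cases x) simp
qed

lemma card_faces: "3 * card (faces M) = card arcset"
proof -
  let ?g = "perm_restrict (face_succ M) arcset"
  have "bij_betw ?g arcset arcset"
    using bij_betw_cong[of arcset "face_succ M" ?g arcset] face_succ_bij by (simp add: perm_restrict_def)
  then have g: "?g permutes arcset" by (rule bij_imp_permutes) (simp add: perm_restrict_def)
  have orb: "orbit ?g x = orbit (face_succ M) x" if "x \<in> arcset" for x
  proof (rule orbit_cong0[OF that])
    show "?g \<in> arcset \<rightarrow> arcset" using permutes_in_image[OF g] by blast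
  qed (simp add: perm_restrict_def)
  then have faces: "faces M = orbit ?g ` arcset"
    unfolding faces_def M_simps by (intro image_cong) simp_all
  have "card F = 3" if "F \<in> orbit ?g ` arcset" for F
  proof -
    from that obtain v u where "(v, u) \<in> arcset" "F = orbit ?g (v, u)" by auto
    then show ?thesis using orb card_face_orbit[OF arcs_sym] by simp
  qed
  then show ?thesis unfolding faces by (rule card_orbit_partition[OF g finite_arcs])
qed

lemma card_list_arcs: "card arcset + 12 = 6 * n"
proof -
  have "arcset = (SIGMA u:{..<n}. set (nb u))" by (auto simp: arcs_iff)
  then have "card arcset = (\<Sum>u<n. card (set (nb u)))" by (simp add: card_SigmaI)
  also have "\<dots> = (\<Sum>u<n. length (nb u))" by (intro sum.cong) (simp_all add: distinct_card distinct_nb)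
  finally show ?thesis using count by simp
qed

lemma connected_M: "connected (with_proj (graph M))"
proof -
  have sym: "arcset\<^sup>s = arcset" using arcs_sym by (auto simp: symcl_def)
  have "0 < n" using root by (auto simp: list_arcs_def)
  have zero: "(u, 0) \<in> arcset\<^sup>*" if "u < n" for u
    using that
  proof (induction u rule: less_induct)
    case (less u)
    show ?case
    proof (cases "u = 0")
      case False
      then obtain v where v: "v < u" "v \<in> set (nb u)" using earlier less.prems by blast
      then have "(v, 0) \<in> arcset\<^sup>*" using less by simp
      moreover have "(u, v) \<in> arcset" using v less.prems by (simp add: arcs_iff)
      ultimately show ?thesis by (meson converse_rtrancl_into_rtrancl)
    qed simp
  qed
  have "(u, v) \<in> rtrancl_on {..<n} (arcset\<^sup>s)" if "u < n" "v < n" for u v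
    unfolding sym
  proof (rule rtrancl_consistent_rtrancl_on)
    have "sym arcset" using arcs_sym by (auto simp: sym_def)
    then have "(0, v) \<in> arcset\<^sup>*" using zero[OF that(2)] by (metis sym_rtrancl symD)
    then show "(u, v) \<in> arcset\<^sup>*" using zero[OF that(1)] by (rule rtrancl_trans[rotated])
  qed (use that nb_less in \<open>auto simp: arcs_iff\<close>)
  then show ?thesis using \<open>0 < n\<close> by (auto simp: connected_conv)
qed

theorem triangulation_list_map: "plane_triangulation M"
proof -
  have "pair_graph (graph M)"
  proof unfold_locales
    show "symmetric (with_proj (graph M))" using arcs_sym by (auto simp: symmetric_def sym_def)
  qed (use finite_arcs nb_less arcs_ne in \<open>auto simp: arcs_iff\<close>)
  moreover have "cyclic_on (rot M) {x \<in> arcset. fst x = v}" if "v < n" "{x \<in> arcset. fst x = v} \<noteq> {}" for v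
  proof -
    have star: "{x \<in> arcset. fst x = v} = Pair v ` set (nb v)" using that(1) by (auto simp: arcs_iff)
    then have "nb v \<noteq> []" using that(2) by auto
    then have "cyclic_on (next_at v) (set (nb v))" using cyclic_next_cyclic_on distinct_nb that(1) by blast
    then show ?thesis
      unfolding star by (rule cyclic_on_image) (use that(1) in \<open>simp add: arcs_iff\<close>)
  qed
  moreover have "int n - int (card arcset div 2) + int (card (faces M)) = 2"
  proof -
    have "card arcset = 2 * (3 * n - 6)" "3 * card (faces M) = 3 * (2 * n - 4)" "2 \<le> n"
      using card_list_arcs card_faces by simp_all
    then show ?thesis by simp
  qed
  moreover have "outer M \<in> faces M" using root by (auto simp: faces_def)
  moreover have "card F = 3" if "F \<in> faces M" for F
  proof -
    from that obtain v u where "(v, u) \<in> arcset" "F = orbit (face_succ M) (v, u)" by (auto simp: faces_def)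
    then show ?thesis using card_face_orbit[OF arcs_sym] by simp
  qed
  ultimately show ?thesis
    using connected_M rot_permutes_arcs by (simp add: plane_triangulation_def planar_map_def)
qed

end

definition label_colouring ::
  "(3 \<Rightarrow> 'v) \<Rightarrow> ('v \<times> 'v) set \<Rightarrow> ('v \<times> 'v \<Rightarrow> 3) \<Rightarrow> 'v dart \<Rightarrow> 3 option" where
  "label_colouring a D L d = (case d of
     Edge e \<Rightarrow> if e \<in> D then Some (L e) else None
   | Half v \<Rightarrow> if v \<in> range a then Some (inv a v) else None)"

locale labelled_orientation = triangulation +
  fixes D :: "('a \<times> 'a) set" and L :: "'a \<times> 'a \<Rightarrow> 3"
  assumes D_arcs: "D \<subseteq> A"
    and D_cover: "(u, v) \<in> A \<Longrightarrow> (u, v) \<in> D \<or> (v, u) \<in> D"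
    and D_both: "(u, v) \<in> D \<Longrightarrow> (v, u) \<in> D \<Longrightarrow>
      \<exists>i. (u, v) = (a i, a (i + 1)) \<or> (u, v) = (a (i + 1), a i)"
    and inner_degree: "v \<in> V \<Longrightarrow> v \<notin> range a \<Longrightarrow> card {d \<in> D. fst d = v} = 3"
    and inner_label: "d \<in> A \<Longrightarrow> fst d \<notin> range a \<Longrightarrow> L (rot M d) = L d + of_bool (rot M d \<in> D)"
    and outer_D: "{d \<in> D. fst d = a i} = {(a i, a (i + 1)), (a i, a (i + 2))}"
    and outer_label: "L (a i, a (i + 2)) = i + 2"
      "d \<in> A \<Longrightarrow> fst d = a i \<Longrightarrow> d \<noteq> (a i, a (i + 2)) \<Longrightarrow> L d = i + 1"
    and edge_label: "(u, v) \<in> D \<Longrightarrow> (v, u) \<notin> D \<Longrightarrow> L (v, u) = L (u, v) + 1"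
begin

abbreviation "colour \<equiv> label_colouring a D L"

definition "dart_label d = (case d of Edge e \<Rightarrow> L e | Half v \<Rightarrow> inv a v)"

lemma inv_a [simp]: "inv a (a i) = i" by (rule inv_f_f[OF inj_a])

lemma colour_simps [simp]:
  "colour (Edge e) = (if e \<in> D then Some (L e) else None)"
  "colour (Half (a i)) = Some i"
  by (simp_all add: label_colouring_def)

lemma colour_label: "colour d = Some i \<Longrightarrow> dart_label d = i"
  by (auto simp: label_colouring_def dart_label_def split: dart.splits if_splits)

lemma vertex_triple:
  assumes "v \<in> V"
  obtains e where "cyclic_triple (susp_rot M a) (darts_at M a v) e"
    "{d. colour d \<noteq> None} \<inter> darts_at M a v = range e" "\<And>i. dart_label (e i) = i"
    "\<And>d. d \<in> darts_at M a v \<Longrightarrow> d \<in> sector (susp_rot M a) (e (dart_label d)) (e (dart_label d + 1))"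
proof -
  let ?S = "darts_at M a v" and ?O = "{d. colour d \<noteq> None}"
  have card: "card (?O \<inter> ?S) = 3 \<and> (\<forall>d \<in> ?S. dart_label (susp_rot M a d) = dart_label d + of_bool (susp_rot M a d \<in> ?O))"
  proof (cases "v \<in> range a")
    case False
    have "?O \<inter> ?S = Edge ` {d \<in> D. fst d = v}"
      using False D_arcs by (auto simp: darts_inner split: if_splits)
    moreover have "card (Edge ` {d \<in> D. fst d = v}) = card {d \<in> D. fst d = v}"
      by (rule card_image) (simp add: inj_on_def)
    ultimately have "card (?O \<inter> ?S) = 3" using inner_degree[OF assms False] by simp
    moreover have "dart_label (susp_rot M a d) = dart_label d + of_bool (susp_rot M a d \<in> ?O)"
      if d: "d \<in> ?S" for d
    proof -
      obtain x where x: "d = Edge x" "x \<in> A" "fst x = v" using d False by (auto simp: darts_inner)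
      then have "susp_rot M a d = Edge (rot M x)" using susp_rot_Edge[of x] False by auto
      then show ?thesis using inner_label[of x] x False by (simp add: dart_label_def)
    qed
    ultimately show ?thesis by blast
  next
    case True
    then obtain i where v: "v = a i" by blast
    have DO: "(a i, w) \<in> D \<longleftrightarrow> w = a (i + 1) \<or> w = a (i + 2)" for w
    proof -
      have "(a i, w) \<in> D \<longleftrightarrow> (a i, w) \<in> {d \<in> D. fst d = a i}" by simp
      then show ?thesis unfolding outer_D by simp
    qed
    have "?O \<inter> ?S = {Half (a i), Edge (a i, a (i + 1)), Edge (a i, a (i + 2))}"
    proof (intro set_eqI)
      fix d
      show "d \<in> ?O \<inter> ?S \<longleftrightarrow> d \<in> {Half (a i), Edge (a i, a (i + 1)), Edge (a i, a (i + 2))}"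
      proof (cases d)
        case (Edge x)
        obtain u w where "x = (u, w)" by fastforce
        moreover have "Edge (u, w) \<in> ?S \<longleftrightarrow> (u, w) \<in> A \<and> u = a i" unfolding v darts_outer by auto
        moreover have "(u, w) \<in> D \<and> u = a i \<longleftrightarrow> u = a i \<and> (w = a (i + 1) \<or> w = a (i + 2))"
          using DO[of w] by blast
        ultimately show ?thesis using Edge arc_next[of i] arc_prev[of i] by auto
      next
        case (Half w)
        then show ?thesis unfolding v darts_outer by auto
      qed
    qed
    then have "card (?O \<inter> ?S) = 3" by simp
    moreover have "dart_label (susp_rot M a d) = dart_label d + of_bool (susp_rot M a d \<in> ?O)"
      if d: "d \<in> ?S" for d
    proof -
      consider "d = Half (a i)" | "d = Edge (a i, a (i + 2))"
        | w where "d = Edge (a i, w)" "(a i, w) \<in> A" "w \<noteq> a (i + 2)"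
        using d unfolding v darts_outer by fastforce
      then show ?thesis
      proof cases
        case 1
        then have "susp_rot M a d = Edge (a i, a (i + 1))" by (simp only: susp_rot_Half)
        then show ?thesis using 1 DO outer_label(2)[OF arc_next, of i i] by (simp add: dart_label_def)
      next
        case 2
        then have "susp_rot M a d = Half (a i)" by (simp only: susp_rot_prev)
        then show ?thesis using 2 outer_label(1)[of i] by (simp add: dart_label_def)
      next
        case 3
        have rot: "susp_rot M a d = Edge (rot M (a i, w))" unfolding 3(1)
          using 3 by (intro susp_rot_Edge) auto
        obtain x where x: "rot M (a i, w) = (a i, x)" "(a i, x) \<in> A"
          using fst_rot[OF 3(2)] rot_arc[of "(a i, w)"] 3(2) by (cases "rot M (a i, w)") auto
        have "x \<noteq> a (i + 1)"
          using x(1) rot_prev[of i] 3(3) injD[OF permutes_inj[OF rot_permutes], of "(a i, w)" "(a i, a (i + 2))"]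
          by auto
        then show ?thesis
          using rot x 3 DO[of x] outer_label(1)[of i] outer_label(2)[OF 3(2), of i] outer_label(2)[OF x(2), of i]
          by (cases "x = a (i + 2)") (simp_all add: dart_label_def del: susp_rot.simps)
      qed
    qed
    ultimately show ?thesis by blast
  qed
  then have "?O \<inter> ?S \<noteq> {}" by auto
  then have "cyclic_on (susp_rot M a) ?S" using susp_cyclic[OF assms] by blast
  then show ?thesis
    using cyclic_triple_label[of "susp_rot M a" ?S ?O dart_label] card that by blast
qed

lemma W1: "W1 M colour"
  unfolding W1_def
proof (clarify, intro conjI impI)
  fix u v assume uv: "(u, v) \<in> A"
  show "colour (Edge (u, v)) \<noteq> None \<or> colour (Edge (v, u)) \<noteq> None" using D_cover[OF uv] by auto
  assume "colour (Edge (u, v)) \<noteq> None \<and> colour (Edge (v, u)) \<noteq> None"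
  then have D: "(u, v) \<in> D" "(v, u) \<in> D" by (simp_all split: if_splits)
  have "L (a i, a (i + 1)) = i + 1" "L (a (i + 1), a i) = i" for i
    using outer_label(2)[OF arc_next, of i i] outer_label(1)[of "i + 1"] by simp_all
  then show "colour (Edge (u, v)) \<noteq> colour (Edge (v, u))"
    using D_both[OF D] D by auto
qed

lemma W3: "W3 M a colour"
  unfolding W3_def
proof (intro ballI)
  fix v assume v: "v \<in> V"
  let ?f = "susp_rot M a" and ?S = "darts_at M a v"
  obtain e where e: "cyclic_triple ?f ?S e" "{d. colour d \<noteq> None} \<inter> ?S = range e" "\<And>i. dart_label (e i) = i"
    "\<And>d. d \<in> ?S \<Longrightarrow> d \<in> sector ?f (e (dart_label d)) (e (dart_label d + 1))"
    using vertex_triple[OF v] by blast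
  have out: "d \<in> ?S \<and> colour d = Some i \<longleftrightarrow> d = e i" for d i
  proof
    assume d: "d \<in> ?S \<and> colour d = Some i"
    then have "d \<in> range e" unfolding e(2)[symmetric] by simp
    then obtain j where j: "d = e j" by blast
    have "dart_label d = i" using d by (blast intro: colour_label)
    then show "d = e i" using e(3)[of j] j by simp
  next
    assume d: "d = e i"
    then have "d \<in> {d. colour d \<noteq> None} \<inter> ?S" using e(2) by simp
    then obtain j where j: "colour d = Some j" "d \<in> ?S" by blast
    have "j = i" using colour_label[OF j(1)] e(3)[of i] d by simp
    then show "d \<in> ?S \<and> colour d = Some i" using j by simp
  qed
  have out_dart: "out_dart M a colour v i = e i" for i
    unfolding out_dart_def out by simp
  show "(\<forall>i. \<exists>!d. d \<in> ?S \<and> colour d = Some i) \<and>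
    out_dart M a colour v 2 \<in> sector ?f (out_dart M a colour v 1) (out_dart M a colour v 3) \<and>
    (\<forall>u i. (u, v) \<in> A \<and> colour (Edge (u, v)) = Some i \<longrightarrow>
      Edge (v, u) \<in> sector ?f (out_dart M a colour v (i + 1)) (out_dart M a colour v (i - 1)))"
  proof (intro conjI allI impI)
    fix i show "\<exists>!d. d \<in> ?S \<and> colour d = Some i" unfolding out by simp
  next
    show "out_dart M a colour v 2 \<in> sector ?f (out_dart M a colour v 1) (out_dart M a colour v 3)"
      using cyclic_triple_sector(2)[OF e(1), of 1] by (simp add: out_dart)
  next
    fix u i assume "(u, v) \<in> A \<and> colour (Edge (u, v)) = Some i"
    then have u: "(v, u) \<in> A" "(u, v) \<in> D" "L (u, v) = i" using arc_sym by (auto split: if_splits)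
    then have dart: "Edge (v, u) \<in> ?S" by (auto simp: darts_at_def)
    have "Edge (v, u) \<in> sector ?f (e (i + 1)) (e (i + 2))"
    proof (cases "(v, u) \<in> D")
      case False
      then have "dart_label (Edge (v, u)) = i + 1" using edge_label u by (simp add: dart_label_def)
      then show ?thesis using e(4)[OF dart] by simp
    next
      case True
      then have e': "Edge (v, u) = e (L (v, u))" using out[of "Edge (v, u)" "L (v, u)"] dart by simp
      have lab: "L (a i, a (i + 1)) = i + 1" "L (a (i + 1), a i) = i" for i
        using outer_label(2)[OF arc_next, of i i] outer_label(1)[of "i + 1"] by simp_all
      from D_both[OF u(2) True] obtain j where "(u, v) = (a j, a (j + 1)) \<or> (u, v) = (a (j + 1), a j)" by blast
      then have "L (v, u) = i + 1 \<or> L (v, u) = i + 2"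
        using u(3) by (elim disjE) (simp_all add: lab del: three_arith(7) flip: u(3))
      then show ?thesis
        unfolding e' using cyclic_triple_sector(3,4)[OF e(1), of "i + 1"] by auto
    qed
    then show "Edge (v, u) \<in> sector ?f (out_dart M a colour v (i + 1)) (out_dart M a colour v (i - 1))"
      by (simp add: out_dart)
  qed
qed

lemma face_corner:
  assumes "F \<in> faces M" "(v, u) \<in> F"
  obtains w where "rot M (u, v) = (u, w)" "(u, w) \<in> F" "(v, u) \<in> A" "(u, v) \<in> A" "(u, w) \<in> A" "(w, u) \<in> A"
proof -
  have vu: "(v, u) \<in> A" "(u, v) \<in> A" using assms face_subset arc_sym by blast+
  obtain w where w: "rot M (u, v) = (u, w)" using fst_rot[OF vu(2)] by (cases "rot M (u, v)") simp
  have "face_perm (v, u) \<in> F" by (rule cyclic_on_inI[OF face_perm_cyclic[OF assms(1)] assms(2)])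
  then have "(u, w) \<in> F" using face_perm_arc[OF vu(1)] w by simp
  moreover from this have "(u, w) \<in> A" "(w, u) \<in> A" using face_subset[OF assms(1)] arc_sym by blast+
  ultimately show ?thesis using that w vu by blast
qed

lemma inner_corner_not_monochromatic:
  assumes "F \<in> faces M" "(v, u) \<in> F" "u \<notin> range a"
  shows "\<not> (\<forall>d \<in> F. colour (Edge d) = Some i)" "\<not> (\<forall>d \<in> F. colour (Edge (prod.swap d)) = Some i)"
proof -
  obtain w where w: "rot M (u, v) = (u, w)" "(u, w) \<in> F" "(u, v) \<in> A"
    using face_corner[OF assms(1,2)] by blast
  have one: "\<not> ((u, x) \<in> D \<and> (x, u) \<in> D)" for x using D_both[of u x] assms(3) by auto
  have step: "L (u, w) = L (u, v) + of_bool ((u, w) \<in> D)" using inner_label[OF w(3)] assms(3) w(1) by simp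
  show "\<not> (\<forall>d \<in> F. colour (Edge d) = Some i)"
  proof
    assume *: "\<forall>d \<in> F. colour (Edge d) = Some i"
    have "(v, u) \<in> D" "L (v, u) = i" "(u, w) \<in> D" "L (u, w) = i"
      using bspec[OF * assms(2)] bspec[OF * w(2)] by (simp_all split: if_splits)
    moreover from this have "(u, v) \<notin> D" using one[of v] by blast
    moreover from this have "L (u, v) = i + 1" using edge_label[OF \<open>(v, u) \<in> D\<close>] \<open>L (v, u) = i\<close> by simp
    ultimately show False using step by simp
  qed
  show "\<not> (\<forall>d \<in> F. colour (Edge (prod.swap d)) = Some i)"
  proof
    assume *: "\<forall>d \<in> F. colour (Edge (prod.swap d)) = Some i"
    have "(u, v) \<in> D" "L (u, v) = i" "(w, u) \<in> D" "L (w, u) = i"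
      using bspec[OF * assms(2)] bspec[OF * w(2)] by (simp_all split: if_splits)
    moreover from this have nD: "(u, w) \<notin> D" using one[of w] by blast
    moreover from this have "L (u, w) = i + 1" using edge_label[OF \<open>(w, u) \<in> D\<close>] \<open>L (w, u) = i\<close> by simp
    ultimately show False using step by simp
  qed
qed

lemma W4: "W4 M colour"
  unfolding W4_def
proof (rule notI, elim bexE exE)
  fix F i assume "F \<in> faces M - {outer M}"
    and mono: "(\<forall>d \<in> F. colour (Edge d) = Some i) \<or> (\<forall>d \<in> F. colour (Edge (prod.swap d)) = Some i)"
  then have F: "F \<in> faces M" "F \<noteq> outer M" by simp_all
  have heads: "u \<in> range a" if "(v, u) \<in> F" for u v
    using inner_corner_not_monochromatic[OF F(1) that] mono by blast
  have lab: "L (a i, a (i + 1)) = i + 1" "L (a (i + 1), a i) = i" for i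
    using outer_label(2)[OF arc_next, of i i] outer_label(1)[of "i + 1"] by simp_all
  have "\<not> F \<subseteq> outer M"
    using F card_face[OF F(1)] card_face[OF outer_face] finite_subset[OF face_subset[OF outer_face] finite_A]
    by (metis card_subset_eq)
  then obtain v u where vu: "(v, u) \<in> F" "(v, u) \<notin> outer M" by auto
  obtain w where w: "rot M (u, v) = (u, w)" "(u, w) \<in> F" "(v, u) \<in> A" "(u, w) \<in> A"
    using face_corner[OF F(1) vu(1)] by blast
  obtain x where x: "rot M (w, u) = (w, x)" "(w, x) \<in> F" "(u, w) \<in> A"
    using face_corner[OF F(1) w(2)] by blast
  obtain y where y: "rot M (x, w) = (x, y)" "(x, y) \<in> F"
    using face_corner[OF F(1) x(2)] by blast
  have "face_perm (face_perm (face_perm (v, u))) = (x, y)"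
    using w x y by (simp add: face_perm_arc face_subset[OF F(1), THEN subsetD])
  then have "x = v" "y = u" using face_perm_cube[OF w(3)] by simp_all
  obtain j where j: "u = a j" using heads vu by blast
  obtain k where k: "w = a k" using heads w by blast
  obtain l where l: "v = a l" using heads x \<open>x = v\<close> by blast
  have "j \<noteq> l" "j \<noteq> k" using w(3,4) pair_no_loops j k l by fastforce+
  moreover have "j \<noteq> l + 1" using vu(2) j l outer_arc by auto
  ultimately have l': "l = j + 1" using three_total[of l j] three_total[of j l] by auto
  have "k \<noteq> l"
  proof
    assume "k = l"
    then have "rot M (u, v) = rot M (a j, a (j + 2))" using w(1) rot_prev[of j] j k l' by simp
    then have "v = a (j + 2)" using injD[OF permutes_inj[OF rot_permutes]] by blast
    then show False using l l' by simp
  qed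
  then have k': "k = j + 2" using \<open>j \<noteq> k\<close> l' three_total[of k j] by auto
  have "L (v, u) \<noteq> L (u, w)" "L (u, v) \<noteq> L (w, u)"
    using lab[of j] lab[of "j + 2"] j k l l' k' by simp_all
  moreover from mono have "L (v, u) = L (u, w) \<or> L (u, v) = L (w, u)"
  proof
    assume *: "\<forall>d \<in> F. colour (Edge d) = Some i"
    show ?thesis using bspec[OF * vu(1)] bspec[OF * w(2)] by (simp split: if_splits)
  next
    assume *: "\<forall>d \<in> F. colour (Edge (prod.swap d)) = Some i"
    show ?thesis using bspec[OF * vu(1)] bspec[OF * w(2)] by (simp split: if_splits)
  qed
  ultimately show False by blast
qed

theorem colour_schnyder_wood: "colour \<in> schnyder_woods M a"
proof -
  have "colour d = None" if "d \<notin> (\<Union>v \<in> V. darts_at M a v)" for d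
  proof (cases d)
    case (Edge e)
    have "e \<notin> D"
    proof
      assume "e \<in> D"
      then have "e \<in> A" "fst e \<in> V" using D_arcs arc_fst_in_verts[of e] by blast+
      then have "Edge e \<in> darts_at M a (fst e)" by (simp add: darts_at_def)
      then show False using \<open>fst e \<in> V\<close> that Edge by blast
    qed
    then show ?thesis using Edge by simp
  next
    case (Half v)
    have "v \<notin> range a"
    proof
      assume v: "v \<in> range a"
      then have "Half v \<in> darts_at M a v" by (simp add: darts_at_def)
      moreover have "v \<in> V" using v a_in_V by blast
      ultimately show False using that Half by blast
    qed
    then show ?thesis using Half by (simp add: label_colouring_def)
  qed
  then show ?thesis using W1 W3 W4 by (simp add: schnyder_woods_def W2_def)
qed

end

definition later :: "nat \<Rightarrow> nat \<Rightarrow> nat list" where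
  "later m t = (if t + 9 \<le> m then [t + 8, t + 9, t + 1] else if t + 1 < m then [m, t + 1] else [m])"

definition prior :: "nat \<Rightarrow> nat list" where
  "prior t = (if 9 \<le> t then [t - 8, t - 9, t - 1] else if 2 \<le> t then [0, t - 1] else [0])"

definition spiral :: "nat \<Rightarrow> nat \<Rightarrow> nat list" where
  "spiral m t =
     (if t = 0 then [1, 2, 3, 4, 5, 6, 7, 8, 9]
      else if t = m then [m - 2, m - 3, m - 4, m - 5, m - 6, m - 7, m - 8, m - 9, m - 1]
      else later m t @ prior t)"

lemmas spiral_defs = spiral_def later_def prior_def

lemma spiral_lists:
  assumes "20 \<le> m"
  shows "spiral m 0 = [1, 2, 3, 4, 5, 6, 7, 8, 9]"
    and "spiral m 1 = [9, 10, 2, 0]"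
    and "2 \<le> t \<Longrightarrow> t \<le> 8 \<Longrightarrow> spiral m t = [t + 8, t + 9, t + 1, 0, t - 1]"
    and "s + 18 \<le> m \<Longrightarrow> spiral m (s + 9) = [s + 17, s + 18, s + 10, s + 1, s, s + 8]"
    and "s + 10 < m \<Longrightarrow> m < s + 18 \<Longrightarrow> spiral m (s + 9) = [m, s + 10, s + 1, s, s + 8]"
    and "m = s + 10 \<Longrightarrow> spiral m (s + 9) = [m, s + 1, s, s + 8]"
    and "m = s + 9 \<Longrightarrow> spiral m (s + 9) = [s + 7, s + 6, s + 5, s + 4, s + 3, s + 2, s + 1, s, s + 8]"
  using assms by (simp_all add: spiral_defs)

lemma vertex_kind:
  fixes t :: nat
  obtains "t = 0" | "t = 1" | "2 \<le> t" "t \<le> 8" | s where "t = s + 9"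
proof -
  have "t = 0 \<or> t = 1 \<or> 2 \<le> t \<and> t \<le> 8 \<or> t = (t - 9) + 9" by linarith
  then show ?thesis using that by blast
qed

lemma spiral_rhombus_left:
  assumes "20 \<le> m" "s + 9 \<le> m"
  shows "cyclic_next (spiral m s) (s + 8) = s + 9"
    and "cyclic_next (spiral m (s + 8)) (s + 9) = s"
    and "cyclic_next (spiral m (s + 9)) s = s + 8"
proof -
  note lists = spiral_lists[OF assms(1)]
  show "cyclic_next (spiral m s) (s + 8) = s + 9"
  proof (cases s rule: vertex_kind)
    case 1 then show ?thesis by (simp only: lists) (simp add: cyclic_next_def)
  next
    case 2 then show ?thesis by (simp only: lists) (simp add: cyclic_next_def)
  next
    case 3 then show ?thesis by (simp only: lists) (simp add: cyclic_next_def)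
  next
    case (4 r)
    then have "r + 18 \<le> m" using assms(2) by simp
    then show ?thesis using 4 by (simp only: lists) (simp add: cyclic_next_def)
  qed
  show "cyclic_next (spiral m (s + 8)) (s + 9) = s"
  proof (cases s)
    case 0
    then show ?thesis using lists(3)[of 8] by (simp add: cyclic_next_def)
  next
    case (Suc r)
    then have s: "s + 8 = r + 9" "s + 9 = r + 10" "s = r + 1" by simp_all
    consider "r + 18 \<le> m" | "m < r + 18" "r + 10 < m" | "m = r + 10" using assms(2) Suc by linarith
    then have "cyclic_next (spiral m (r + 9)) (r + 10) = r + 1"
    proof cases
      case 1 then show ?thesis by (simp only: lists) (simp add: cyclic_next_def)
    next
      case 2 then show ?thesis by (simp only: lists) (simp add: cyclic_next_def)
    next
      case 3 then show ?thesis unfolding lists(6)[OF 3] by (simp add: cyclic_next_def)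
    qed
    then show ?thesis unfolding s(1,2) unfolding s(3) .
  qed
  consider "s + 18 \<le> m" | "m < s + 18" "s + 10 < m" | "m = s + 10" | "m = s + 9" using assms(2) by linarith
  then show "cyclic_next (spiral m (s + 9)) s = s + 8"
  proof cases
    case 1 then show ?thesis by (simp only: lists) (simp add: cyclic_next_def)
  next
    case 2 then show ?thesis by (simp only: lists) (simp add: cyclic_next_def)
  next
    case 3 then show ?thesis unfolding lists(6)[OF 3] by (simp add: cyclic_next_def)
  next
    case 4 then show ?thesis unfolding lists(7)[OF 4] by (simp add: cyclic_next_def)
  qed
qed

lemma spiral_rhombus_right:
  assumes "20 \<le> m" "s + 9 \<le> m"
  shows "cyclic_next (spiral m s) (s + 9) = s + 1"
    and "cyclic_next (spiral m (s + 9)) (s + 1) = s"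
    and "cyclic_next (spiral m (s + 1)) s = s + 9"
proof -
  note lists = spiral_lists[OF assms(1)]
  show "cyclic_next (spiral m s) (s + 9) = s + 1"
  proof (cases s rule: vertex_kind)
    case 1 then show ?thesis by (simp only: lists) (simp add: cyclic_next_def)
  next
    case 2 then show ?thesis by (simp only: lists) (simp add: cyclic_next_def)
  next
    case 3 then show ?thesis by (simp only: lists) (simp add: cyclic_next_def)
  next
    case (4 r)
    then have "r + 18 \<le> m" using assms(2) by simp
    then show ?thesis using 4 by (simp only: lists) (simp add: cyclic_next_def)
  qed
  consider "s + 18 \<le> m" | "m < s + 18" "s + 10 < m" | "m = s + 10" | "m = s + 9" using assms(2) by linarith
  then show "cyclic_next (spiral m (s + 9)) (s + 1) = s"
  proof cases
    case 1 then show ?thesis by (simp only: lists) (simp add: cyclic_next_def)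
  next
    case 2 then show ?thesis by (simp only: lists) (simp add: cyclic_next_def)
  next
    case 3 then show ?thesis unfolding lists(6)[OF 3] by (simp add: cyclic_next_def)
  next
    case 4 then show ?thesis unfolding lists(7)[OF 4] by (simp add: cyclic_next_def)
  qed
  have "s = 0 \<or> 1 \<le> s \<and> s \<le> 7 \<or> s = (s - 8) + 8" by linarith
  then consider "s = 0" | "1 \<le> s" "s \<le> 7" | r where "s = r + 8" by blast
  then show "cyclic_next (spiral m (s + 1)) s = s + 9"
  proof cases
    case 1 then show ?thesis using lists(2) by (simp add: cyclic_next_def)
  next
    case 2
    then have "2 \<le> s + 1" "s + 1 \<le> 8" by simp_all
    then show ?thesis using 2 by (simp only: lists) (simp add: cyclic_next_def)
  next
    case (3 r)
    then have s: "s = r + 8" "s + 1 = r + 9" "s + 9 = r + 17" by simp_all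
    consider "r + 18 \<le> m" | "m < r + 18" "r + 10 < m" "m = r + 17" using assms(2) 3 by linarith
    then have "cyclic_next (spiral m (r + 9)) (r + 8) = r + 17"
    proof cases
      case 1 then show ?thesis by (simp only: lists) (simp add: cyclic_next_def)
    next
      case 2 then show ?thesis unfolding lists(5)[OF 2(2,1)] by (simp add: cyclic_next_def)
    qed
    then show ?thesis unfolding s(2,3) unfolding s(1) .
  qed
qed

lemma spiral_start:
  assumes "20 \<le> m" "1 \<le> t" "t \<le> 7"
  shows "cyclic_next (spiral m 0) t = t + 1"
    and "cyclic_next (spiral m t) (t + 1) = 0"
    and "cyclic_next (spiral m (t + 1)) 0 = t"
proof -
  note lists = spiral_lists[OF assms(1)]
  have t: "t = 1 \<or> t = 2 \<or> t = 3 \<or> t = 4 \<or> t = 5 \<or> t = 6 \<or> t = 7" using assms by linarith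
  then show "cyclic_next (spiral m 0) t = t + 1"
    by (elim disjE) (simp_all add: lists(1) cyclic_next_def)
  show "cyclic_next (spiral m t) (t + 1) = 0"
  proof (cases "t = 1")
    case True then show ?thesis by (simp only: lists) (simp add: cyclic_next_def)
  next
    case False
    then have "2 \<le> t" "t \<le> 8" using assms by simp_all
    then show ?thesis by (simp only: lists) (simp add: cyclic_next_def)
  qed
  have "2 \<le> t + 1" "t + 1 \<le> 8" using assms by simp_all
  then show "cyclic_next (spiral m (t + 1)) 0 = t" by (simp only: lists) (simp add: cyclic_next_def)
qed

lemma spiral_end:
  assumes "20 \<le> m" "m \<le> t + 8" "t + 2 \<le> m"
  shows "cyclic_next (spiral m m) (t + 1) = t"
    and "cyclic_next (spiral m t) m = t + 1"
    and "cyclic_next (spiral m (t + 1)) t = m"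
proof -
  note lists = spiral_lists[OF assms(1)]
  obtain s where s: "m = s + 9" using assms(1) by (intro that[of "m - 9"]) simp
  have "t = s + 1 \<or> t = s + 2 \<or> t = s + 3 \<or> t = s + 4 \<or> t = s + 5 \<or> t = s + 6 \<or> t = s + 7"
    using assms s by linarith
  then show "cyclic_next (spiral m m) (t + 1) = t"
    using lists(7)[OF s] unfolding s by (elim disjE) (simp_all add: cyclic_next_def)
  obtain r where r: "t = r + 9" using assms by (intro that[of "t - 9"]) simp
  have "r + 10 < m" "m < r + 18" using r assms by simp_all
  then show "cyclic_next (spiral m t) m = t + 1" unfolding r by (simp only: lists) (simp add: cyclic_next_def)
  have t1: "t + 1 = r + 1 + 9" using r by simp
  consider "r + 1 + 10 < m" "m < r + 1 + 18" | "m = r + 1 + 10" using r assms by linarith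
  then have "cyclic_next (spiral m (r + 1 + 9)) t = m"
  proof cases
    case 1 then show "cyclic_next (spiral m (r + 1 + 9)) t = m"
      unfolding lists(5)[OF 1] using r by (simp add: cyclic_next_def)
  next
    case 2 then show "cyclic_next (spiral m (r + 1 + 9)) t = m"
      unfolding lists(6)[OF 2] using r by (simp add: cyclic_next_def)
  qed
  then show "cyclic_next (spiral m (t + 1)) t = m" by (simp only: t1)
qed

lemma spiral_members:
  assumes "20 \<le> m"
  shows "s + 9 \<le> m \<Longrightarrow> s + 8 \<in> set (spiral m s)"
    and "s + 9 \<le> m \<Longrightarrow> s + 9 \<in> set (spiral m s)"
    and "s < m \<Longrightarrow> s + 1 \<in> set (spiral m s)"
    and "s < m \<Longrightarrow> s \<in> set (spiral m (s + 1))"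
    and "s + 9 \<le> m \<Longrightarrow> s \<in> set (spiral m (s + 9))"
    and "s + 9 \<le> m \<Longrightarrow> s + 1 \<in> set (spiral m (s + 9))"
    and "1 \<le> t \<Longrightarrow> t \<le> 8 \<Longrightarrow> t \<in> set (spiral m 0)"
    and "1 \<le> t \<Longrightarrow> t \<le> 8 \<Longrightarrow> 0 \<in> set (spiral m t)"
    and "m \<le> t + 8 \<Longrightarrow> t < m \<Longrightarrow> m \<in> set (spiral m t)"
    and "m \<le> t + 8 \<Longrightarrow> t < m \<Longrightarrow> t \<in> set (spiral m m)"
proof -
  have m: "m \<noteq> 0" using assms by simp
  show "s + 8 \<in> set (spiral m s)" "s + 9 \<in> set (spiral m s)" if "s + 9 \<le> m"
    using that by (cases "s = 0"; simp add: spiral_def later_def)+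
  show "s + 1 \<in> set (spiral m s)" if "s < m"
    using that m by (cases "s = 0"; cases "s + 9 \<le> m"; cases "s + 1 = m"; simp add: spiral_def later_def)
  have set_m: "set (spiral m m) = {m - 2, m - 3, m - 4, m - 5, m - 6, m - 7, m - 8, m - 9, m - 1}"
    using m by (simp add: spiral_def)
  show "s \<in> set (spiral m (s + 1))" if "s < m"
  proof (cases "s + 1 = m")
    case True
    then have "s = m - 1" by simp
    then show ?thesis unfolding True set_m by blast
  next
    case False
    then show ?thesis using that by (cases "s = 0"; simp add: spiral_def prior_def)
  qed
  show "s \<in> set (spiral m (s + 9))" "s + 1 \<in> set (spiral m (s + 9))" if "s + 9 \<le> m"
  proof -
    have "s \<in> set (spiral m (s + 9)) \<and> s + 1 \<in> set (spiral m (s + 9))"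
    proof (cases "s + 9 = m")
      case True
      then have "s = m - 9" "s + 1 = m - 8" by simp_all
      then show ?thesis unfolding True set_m by blast
    next
      case False
      then show ?thesis by (simp add: spiral_def prior_def)
    qed
    then show "s \<in> set (spiral m (s + 9))" "s + 1 \<in> set (spiral m (s + 9))" by blast+
  qed
  show "t \<in> set (spiral m 0)" if "1 \<le> t" "t \<le> 8"
  proof -
    have "t = 1 \<or> t = 2 \<or> t = 3 \<or> t = 4 \<or> t = 5 \<or> t = 6 \<or> t = 7 \<or> t = 8" using that by linarith
    then show ?thesis by (auto simp: spiral_def)
  qed
  show "0 \<in> set (spiral m t)" if "1 \<le> t" "t \<le> 8"
    using that assms by (cases "t = 1"; simp add: spiral_def prior_def)
  show "m \<in> set (spiral m t)" if "m \<le> t + 8" "t < m"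
  proof -
    have "t \<noteq> 0" "t \<noteq> m" "\<not> t + 9 \<le> m" using that assms by linarith+
    then show ?thesis unfolding spiral_def later_def by simp
  qed
  show "t \<in> set (spiral m m)" if "m \<le> t + 8" "t < m"
  proof -
    have "m = t + 1 \<or> m = t + 2 \<or> m = t + 3 \<or> m = t + 4 \<or> m = t + 5 \<or> m = t + 6 \<or> m = t + 7 \<or> m = t + 8"
      using that by linarith
    then show ?thesis unfolding set_m by (elim disjE) simp_all
  qed
qed

lemma spiral_arc_cases:
  assumes "20 \<le> m" "u \<le> m" "v \<in> set (spiral m u)"
  obtains (left) s where "s + 9 \<le> m" "(u, v) \<in> {(s, s + 8), (s + 8, s + 9), (s + 9, s)}"
    | (right) s where "s + 9 \<le> m" "(u, v) \<in> {(s, s + 9), (s + 9, s + 1), (s + 1, s)}"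
    | (start) t where "1 \<le> t" "t \<le> 7" "(u, v) \<in> {(0, t), (t, t + 1), (t + 1, 0)}"
    | ("end") t where "m \<le> t + 8" "t + 2 \<le> m" "(u, v) \<in> {(m, t + 1), (t, m), (t + 1, t)}"
proof -
  have "v \<in> set (later m u) \<or> v \<in> set (prior u)" if "u \<noteq> 0" "u \<noteq> m"
    using that assms(3) by (simp add: spiral_def)
  then consider "u = 0" | "u = m" | "u \<noteq> 0" "u \<noteq> m" "v \<in> set (later m u)"
    | "u \<noteq> 0" "u \<noteq> m" "v \<in> set (prior u)" by blast
  then show ?thesis
  proof cases
    case 1
    then have "v \<in> {1, 2, 3, 4, 5, 6, 7, 8, 9}" using assms by (simp add: spiral_def)
    then have "1 \<le> v \<and> v \<le> 7 \<or> v = 8 \<or> v = 9" by auto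
    then show ?thesis using 1 assms(1) start[of v] left[of 0] right[of 0] by auto
  next
    case 2
    obtain k where k: "m = k + 9" using assms(1) by (intro that[of "m - 9"]) simp
    then have "v \<in> {k + 7, k + 6, k + 5, k + 4, k + 3, k + 2, k + 1, k, k + 8}"
      using assms(3) spiral_lists(7)[OF assms(1) k] unfolding 2 k by simp
    then consider "v = k" | "v = k + 1" | "k + 2 \<le> v" "v \<le> k + 8" by auto
    then show ?thesis
    proof cases
      case 1
      then show ?thesis using 2 k left[of k] by simp
    next
      case v: 2
      then show ?thesis using 2 k right[of k] by simp
    next
      case 3
      then show ?thesis using 2 k "end"[of "v - 1"] by simp
    qed
  next
    case 3
    show ?thesis
    proof (cases "u + 9 \<le> m")
      case True
      then have "v = u + 8 \<or> v = u + 9 \<or> v = u + 1" using 3 by (auto simp: later_def)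
      moreover have ?thesis if "v = u + 1"
      proof (cases "u \<le> 7")
        case True
        then show ?thesis using that 3 start[of u] by auto
      next
        case False
        then show ?thesis using that 3 \<open>u + 9 \<le> m\<close> left[of "u - 8"] by auto
      qed
      ultimately show ?thesis using left[of u] right[of u] True by auto
    next
      case False
      then have "v = m \<or> v = u + 1" using 3 assms(2) by (auto simp: later_def split: if_splits)
      moreover have ?thesis if "v = u + 1" using that 3 assms(1,2) False left[of "u - 8"] by auto
      moreover have ?thesis if "v = m" "u + 1 \<noteq> m"
        using that 3 assms(1,2) False "end"[of u] by auto
      ultimately show ?thesis by blast
    qed
  next
    case 4
    show ?thesis
    proof (cases "9 \<le> u")
      case True
      then obtain s where s: "u = s + 9" by (metis add.commute le_Suc_ex)
      then have "v = s + 1 \<or> v = s \<or> v = s + 8" using 4 by (auto simp: prior_def)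
      moreover have ?thesis if "v = s + 8"
      proof (cases "s + 17 \<le> m")
        case True
        then show ?thesis using that s right[of "s + 8"] by simp
      next
        case False
        then show ?thesis using that s 4 assms(2) "end"[of "s + 8"] by simp
      qed
      moreover have ?thesis if "v = s" using that s assms(2) left[of s] by simp
      moreover have ?thesis if "v = s + 1" using that s assms(2) right[of s] by simp
      ultimately show ?thesis by blast
    next
      case False
      then have "v = 0 \<or> v = u - 1" using 4 by (auto simp: prior_def split: if_splits)
      then show ?thesis
        using 4 False assms(1) right[of "u - 1"] start[of "u - 1"] by (cases "u = 1") auto
    qed
  qed
qed


lemma spiral_triangle:
  assumes "20 \<le> m" "u \<le> m" "v \<in> set (spiral m u)"
  shows "cyclic_next (spiral m u) v \<in> set (spiral m v)"
    and "cyclic_next (spiral m v) (cyclic_next (spiral m u) v) = u"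
proof -
  note members = spiral_members[OF assms(1)]
  have "cyclic_next (spiral m u) v \<in> set (spiral m v) \<and>
      cyclic_next (spiral m v) (cyclic_next (spiral m u) v) = u"
    using assms
  proof (cases rule: spiral_arc_cases)
    case (left s)
    note nxt = spiral_rhombus_left[OF assms(1) left(1)]
    have "s + 9 \<in> set (spiral m (s + 8))" using members(3)[of "s + 8"] left(1) by (simp add: add.commute)
    then show ?thesis using left(2) nxt members(1,5)[OF left(1)] by auto
  next
    case (right s)
    note nxt = spiral_rhombus_right[OF assms(1) right(1)]
    have "s \<in> set (spiral m (s + 1))" using right(1) by (intro members(4)) simp
    then show ?thesis using right(2) nxt members(2,6)[OF right(1)] by auto
  next
    case (start t)
    note nxt = spiral_start[OF assms(1) start(1,2)]
    have "t \<in> set (spiral m 0)" "t + 1 \<in> set (spiral m t)" "0 \<in> set (spiral m (t + 1))"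
      using start(1,2) assms(1) members(7)[of t] members(3)[of t] members(8)[of "t + 1"] by simp_all
    then show ?thesis using start(3) nxt by auto
  next
    case ("end" t)
    note nxt = spiral_end[OF assms(1) "end"(1,2)]
    have "m \<in> set (spiral m t)" "t \<in> set (spiral m (t + 1))" "t + 1 \<in> set (spiral m m)"
      using "end"(1,2) members(9)[of t] members(4)[of t] members(10)[of "t + 1"] by simp_all
    then show ?thesis using "end"(3) nxt by auto
  qed
  then show "cyclic_next (spiral m u) v \<in> set (spiral m v)"
    "cyclic_next (spiral m v) (cyclic_next (spiral m u) v) = u" by blast+
qed

lemma sum_length_spiral:
  assumes "20 \<le> m"
  shows "(\<Sum>t<Suc m. length (spiral m t)) + 12 = 6 * Suc m"
proof -
  obtain k where m: "m = k + 18" using assms by (intro that[of "m - 18"]) simp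
  note lists = spiral_lists[OF assms, unfolded m]
  have "length (spiral m (t + 9)) = 6" if "t < k" for t
    using that lists(4)[of t] unfolding m by simp
  then have "(\<Sum>t\<in>{9..<k + 9}. length (spiral m t)) = 6 * k"
    using sum.shift_bounds_nat_ivl[of "\<lambda>t. length (spiral m t)" 0 9 k] by simp
  moreover have "(\<Sum>t<9. length (spiral m t)) = 9 + 4 + 7 * 5"
  proof -
    have "{..<9 :: nat} = {0, 1, 2, 3, 4, 5, 6, 7, 8}" by auto
    then show ?thesis using lists(1-3) unfolding m by simp
  qed
  moreover have "(\<Sum>t\<in>{k + 9..<k + 19}. length (spiral m t)) = 6 + 7 * 5 + 4 + 9"
  proof -
    define g where "g i = length (spiral m (k + i + 9))" for i
    have "{k + 9..<k + 19} = (\<lambda>i. k + i + 9) ` {0, 1, 2, 3, 4, 5, 6, 7, 8, 9}" by (auto simp: image_iff) presburger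
    then have sum: "(\<Sum>t\<in>{k + 9..<k + 19}. length (spiral m t)) = sum g {0, 1, 2, 3, 4, 5, 6, 7, 8, 9}"
      by (simp add: sum.reindex inj_on_def g_def)
    have five: "g i = 5" if "1 \<le> i" "i \<le> 7" for i
      using lists(5)[of "k + i"] that unfolding m g_def by simp
    have "g 0 = 6" using lists(4)[of k] unfolding m g_def by simp
    moreover have "g 8 = 4" using lists(6)[of "k + 8"] unfolding m g_def by simp
    moreover have "g 9 = 9" using lists(7)[of "k + 9"] unfolding m g_def by simp
    moreover have "g 1 = 5" "g 2 = 5" "g 3 = 5" "g 4 = 5" "g 5 = 5" "g 6 = 5" "g 7 = 5"
      by (simp_all add: five)
    ultimately show ?thesis unfolding sum by simp
  qed
  moreover have "(\<Sum>t<Suc m. f t) = (\<Sum>t<9. f t) + (\<Sum>t\<in>{9..<k + 9}. f t) + (\<Sum>t\<in>{k + 9..<k + 19}. f t)"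
    for f :: "nat \<Rightarrow> nat"
    using sum.atLeastLessThan_concat[of 0 9 "k + 9" f] sum.atLeastLessThan_concat[of 0 "k + 9" "k + 19" f] m
    by (simp add: lessThan_atLeast0 add.commute)
  ultimately show ?thesis unfolding m by simp
qed

lemma spiral_distinct_bounded:
  assumes "20 \<le> m" "u \<le> m"
  shows "distinct (spiral m u) \<and> (\<forall>v \<in> set (spiral m u). v \<le> m \<and> v \<noteq> u)"
proof -
  note lists = spiral_lists[OF assms(1)]
  show ?thesis
  proof (cases u rule: vertex_kind)
    case 1
    show ?thesis unfolding 1 lists(1) using assms(1) by simp
  next
    case 2
    show ?thesis unfolding 2 lists(2) using assms(1) by simp
  next
    case 3
    then obtain r where r: "u = r + 2" by (metis add.commute le_Suc_ex)
    show ?thesis unfolding lists(3)[OF 3] using assms(1) 3(2) unfolding r by simp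
  next
    case (4 s)
    consider "s + 18 \<le> m" | "s + 10 < m" "m < s + 18" | "m = s + 10" | "m = s + 9"
      using assms(2) 4 by linarith
    then show ?thesis
    proof cases
      case 1 then show ?thesis unfolding 4 lists(4)[OF 1] by simp
    next
      case 2 then show ?thesis unfolding 4 lists(5)[OF 2] by simp
    next
      case 3 then show ?thesis unfolding 4 lists(6)[OF 3] by simp
    next
      case c: 4 then show ?thesis unfolding 4 lists(7)[OF c] by simp
    qed
  qed
qed

lemma spiral_neighbours: "20 \<le> m \<Longrightarrow> neighbour_lists (Suc m) (spiral m) (2, Suc 0)"
proof
  assume m: "20 \<le> m"
  show "(\<Sum>t<Suc m. length (spiral m t)) + 12 = 6 * Suc m" using m by (rule sum_length_spiral)
  show "(2, Suc 0) \<in> list_arcs (Suc m) (spiral m)" using m by (simp add: list_arcs_def spiral_defs)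
  fix u assume u: "u < Suc m"
  show "distinct (spiral m u)" using spiral_distinct_bounded[OF m, of u] u by simp
  show "\<exists>v<u. v \<in> set (spiral m u)" if "0 < u"
    using spiral_members(4)[OF m, of "u - 1"] that u by (intro exI[of _ "u - 1"]) simp
  fix v assume v: "v \<in> set (spiral m u)"
  show "v < Suc m \<and> v \<noteq> u" using spiral_distinct_bounded[OF m, of u] u v by auto
  show "cyclic_next (spiral m u) v \<in> set (spiral m v) \<and> cyclic_next (spiral m v) (cyclic_next (spiral m u) v) = u"
    using spiral_triangle[OF m _ v] u by simp
qed

fun psum :: "('a \<Rightarrow> 'b::monoid_add) \<Rightarrow> 'a list \<Rightarrow> 'a \<Rightarrow> 'b" where
  "psum f [] u = 0"
| "psum f (v # vs) u = f v + (if u = v then 0 else psum f vs u)"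

lemma psum_nth:
  "distinct xs \<Longrightarrow> i < length xs \<Longrightarrow> psum f xs (xs ! i) = sum_list (map f (take (Suc i) xs))"
proof (induction xs arbitrary: i)
  case (Cons x xs)
  show ?case
  proof (cases i)
    case (Suc k)
    then have "xs ! k \<noteq> x" "k < length xs" using Cons.prems by (auto simp: nth_mem)
    then show ?thesis using Cons Suc by simp
  qed simp
qed simp

lemma psum_cyclic_next:
  assumes "distinct xs" "u \<in> set xs" "sum_list (map f xs) = 0"
  shows "psum f xs (cyclic_next xs u) = psum f xs u + f (cyclic_next xs u)"
proof -
  obtain i where i: "i < length xs" "u = xs ! i" using assms(2) by (auto simp: in_set_conv_nth)
  show ?thesis
  proof (cases "Suc i < length xs")
    case True
    then have "cyclic_next xs u = xs ! Suc i" using follow_nth[OF assms(1) i(1)] i by (simp add: cyclic_next_def)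
    then show ?thesis using psum_nth[OF assms(1) True, of f] psum_nth[OF assms(1) i(1), of f] i
      by (simp add: take_Suc_conv_app_nth[OF True])
  next
    case False
    then have "take (Suc i) xs = xs" "xs \<noteq> []" using i by auto
    then have "psum f xs u = 0" using psum_nth[OF assms(1) i(1), of f] i assms(3) by simp
    moreover have "cyclic_next xs u = xs ! 0"
      using follow_nth[OF assms(1) i(1)] i False \<open>xs \<noteq> []\<close> by (simp add: cyclic_next_def hd_conv_nth)
    moreover have "psum f xs (xs ! 0) = f (xs ! 0)"
      using \<open>xs \<noteq> []\<close> by (cases xs) simp_all
    ultimately show ?thesis by simp
  qed
qed

lemma psum_last: "distinct (xs @ v # ys) \<Longrightarrow> psum f (xs @ v # ys) v = sum_list (map f (xs @ [v]))"
  for f :: "'a \<Rightarrow> 'b::comm_monoid_add"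
  by (induction xs) (auto simp: add.assoc)

locale spiral_walk =
  fixes m :: nat and R :: "nat \<Rightarrow> nat \<Rightarrow> nat"
  assumes m: "20 \<le> m"
    and start: "i < 9 \<Longrightarrow> R 9 i = (if i < 6 then 1 else 0)"
    and shift: "9 \<le> t \<Longrightarrow> t < m \<Longrightarrow> 1 \<le> i \<Longrightarrow> i \<le> 6 \<Longrightarrow> R (t + 1) (i + 1) = R t i"
    and first: "9 \<le> t \<Longrightarrow> t < m \<Longrightarrow> R (t + 1) 1 \<le> R t 0 \<and> R t 0 \<le> R (t + 1) 1 + 1"
    and eighth: "9 \<le> t \<Longrightarrow> t < m \<Longrightarrow> R (t + 1) 8 \<le> R t 7 \<and> R t 7 \<le> R (t + 1) 8 + 1"
    and ninth: "9 \<le> t \<Longrightarrow> t < m \<Longrightarrow> R t 8 \<le> 1"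
    and fresh: "9 \<le> t \<Longrightarrow> t < m \<Longrightarrow>
      R (t + 1) 0 = R t 8 + (R t 0 - R (t + 1) 1) + (R t 7 - R (t + 1) 8)"
    and final: "i < 9 \<Longrightarrow> R m i \<le> 1" "(\<Sum>i<9. R m i) = 6"
begin

definition forward :: "nat \<Rightarrow> nat \<Rightarrow> bool" where
  "forward u v \<longleftrightarrow>
     (if v < 9 then False
      else if v = m then R m (m - 1 - u) = 1
      else if v = u + 1 then R v 0 \<noteq> R (v + 1) 1
      else if v = u + 8 then R v 7 \<noteq> R (v + 1) 8
      else R v 8 = 1)"

definition points :: "nat \<Rightarrow> nat \<Rightarrow> bool" where
  "points u v \<longleftrightarrow> (if u < v then forward u v \<or> v \<le> 2 else \<not> forward v u)"

abbreviation "pt u v \<equiv> (of_bool (points u v) :: nat)"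

lemma R_constant:
  assumes "9 \<le> u" "t + 2 \<le> u" "u \<le> v" "v \<le> t + 8" "v \<le> m"
  shows "R v (v - 1 - t) = R u (u - 1 - t)"
  using assms(3-5)
proof (induction v rule: dec_induct)
  case (step w)
  have "R (w + 1) (w - 1 - t + 1) = R w (w - 1 - t)"
    using step assms(1,2) by (intro shift) auto
  moreover have "w - 1 - t + 1 = Suc w - 1 - t" using step assms(2) by simp
  ultimately show ?case using step by simp
qed simp

lemma R_life:
  assumes "9 \<le> u" "u \<le> t + 8" "t + 2 \<le> u" "1 \<le> t" "t + 1 < m" "u \<le> m"
  shows "(if t + 9 \<le> m then of_bool (forward t (t + 8)) + of_bool (forward t (t + 9))
      else of_bool (forward t m)) = R u (u - 1 - t)"
proof (cases "t + 9 \<le> m")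
  case True
  have "R u (u - 1 - t) = R (t + 8) 7" using R_constant[of u t "t + 8"] assms True by simp
  moreover have "R (t + 9) 8 \<le> R (t + 8) 7 \<and> R (t + 8) 7 \<le> R (t + 9) 8 + 1"
    using eighth[of "t + 8"] assms True by (simp add: add.commute)
  moreover have "forward t (t + 8) \<longleftrightarrow> R (t + 8) 7 \<noteq> R (t + 9) 8"
    using assms True by (simp add: forward_def add.commute)
  moreover have "R (t + 9) 8 \<le> 1" using ninth[of "t + 9"] final(1)[of 8] True assms by (cases "t + 9 = m") auto
  moreover have "forward t (t + 9) \<longleftrightarrow> R (t + 9) 8 = 1"
    using assms True by (auto simp: forward_def)
  ultimately show ?thesis using True by auto
next
  case False
  have "R u (u - 1 - t) = R m (m - 1 - t)" using R_constant[of u t m] assms False by simp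
  moreover have "R m (m - 1 - t) \<le> 1" using False assms by (intro final(1)) simp
  moreover have "forward t m \<longleftrightarrow> R m (m - 1 - t) = 1" using m by (simp add: forward_def)
  ultimately show ?thesis using False by auto
qed

lemma forward_count:
  assumes "1 \<le> t" "t < m"
  shows "(\<Sum>v\<leftarrow>later m t. of_bool (forward t v)) = (if 9 \<le> t then R (t + 1) 0 else R 9 (8 - t))"
proof -
  consider "t \<le> 7" | "8 \<le> t" "t + 1 < m" | "t + 1 = m" using assms(2) by linarith
  then show ?thesis
  proof cases
    case 1
    then have "\<not> forward t (Suc t)" by (simp add: forward_def)
    then show ?thesis using 1 R_life[of 9 t] assms m by (simp add: later_def)
  next
    case 2
    have step: "R (t + 2) 1 \<le> R (t + 1) 0 \<and> R (t + 1) 0 \<le> R (t + 2) 1 + 1"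
      using first[of "t + 1"] 2 by (simp add: add.commute)
    have fwd: "forward t (t + 1) \<longleftrightarrow> R (t + 1) 0 \<noteq> R (t + 2) 1"
      using 2 by (simp add: forward_def add.commute)
    have "(\<Sum>v\<leftarrow>later m t. of_bool (forward t v)) = of_bool (forward t (t + 1)) +
        (if t + 9 \<le> m then of_bool (forward t (t + 8)) + of_bool (forward t (t + 9)) else of_bool (forward t m))"
      using 2 by (simp add: later_def)
    also have "\<dots> = of_bool (forward t (t + 1)) + R (t + 2) 1"
      using R_life[of "t + 2" t] 2 assms by simp
    also have "\<dots> = R (t + 1) 0" unfolding fwd using step by auto
    also have "\<dots> = (if 9 \<le> t then R (t + 1) 0 else R 9 (8 - t))"
      using 2 by (cases "t = 8") simp_all
    finally show ?thesis .
  next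
    case 3
    then have "forward t m \<longleftrightarrow> R m 0 = 1" using m by (auto simp: forward_def)
    moreover have "R m 0 \<le> 1" using final(1)[of 0] by simp
    ultimately show ?thesis using 3 m by (auto simp: later_def)
  qed
qed

lemma outdegree:
  assumes "3 \<le> t" "t \<le> m"
  shows "(\<Sum>v\<leftarrow>spiral m t. pt t v) = 3"
proof (cases "t = m")
  case True
  have last: "pt m (m - 1 - i) = 1 - R m i" if "i < 9" for i
    using final(1)[OF that] that m by (auto simp: points_def forward_def)
  have sum: "(\<Sum>i<9. pt m (m - 1 - i)) + (\<Sum>i<9. R m i) = (\<Sum>i<(9::nat). 1)"
    unfolding sum.distrib[symmetric] 
  proof (rule sum.cong)
    fix i assume "i \<in> {..<9 :: nat}"
    then show "pt m (m - 1 - i) + R m i = 1" using last[of i] final(1)[of i] by simp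
  qed simp
  then have "(\<Sum>i<9. pt m (m - 1 - i)) = 3" using final(2) by simp
  moreover have "(\<Sum>v\<leftarrow>spiral m m. pt m v) = (\<Sum>i<9. pt m (m - 1 - i))"
  proof -
    define g where "g = (\<lambda>i. pt m (m - 1 - i))"
    have "spiral m m = map (\<lambda>i. m - 1 - i) [1, 2, 3, 4, 5, 6, 7, 8, 0]" using m by (simp add: spiral_def)
    then have "(\<Sum>v\<leftarrow>spiral m m. pt m v) = sum_list (map g [1, 2, 3, 4, 5, 6, 7, 8, 0])"
      by (simp only: g_def map_map comp_def)
    also have "\<dots> = sum g {..<9}"
    proof -
      have "{..<9 :: nat} = {0, 1, 2, 3, 4, 5, 6, 7, 8}" by auto
      then show ?thesis by simp
    qed
    finally show ?thesis by (simp only: g_def)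
  qed
  ultimately show ?thesis using True by simp
next
  case False
  have later: "pt t v = of_bool (forward t v)" if "v \<in> set (later m t)" for v
  proof -
    have "t < v" using that assms False by (auto simp: later_def split: if_splits)
    then show ?thesis using assms by (simp add: points_def)
  qed
  have "(\<Sum>v\<leftarrow>later m t. pt t v) = (\<Sum>v\<leftarrow>later m t. of_bool (forward t v))"
    using later by (intro arg_cong[of _ _ sum_list] map_cong) auto
  also have "\<dots> = (if 9 \<le> t then R (t + 1) 0 else 1)"
  proof -
    have "8 - t < 6" using assms by simp
    then show ?thesis using forward_count[of t] start[of "8 - t"] assms False by simp
  qed
  finally have fwd: "(\<Sum>v\<leftarrow>later m t. pt t v) = (if 9 \<le> t then R (t + 1) 0 else 1)" .
  have "(\<Sum>v\<leftarrow>prior t. pt t v) + (if 9 \<le> t then R (t + 1) 0 else 1) = 3"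
  proof (cases "9 \<le> t")
    case True
    then have t: "t < m" using assms False by simp
    have "forward (t - 1) t \<longleftrightarrow> R t 0 \<noteq> R (t + 1) 1" "forward (t - 8) t \<longleftrightarrow> R t 7 \<noteq> R (t + 1) 8"
      "forward (t - 9) t \<longleftrightarrow> R t 8 = 1"
    proof -
      obtain s where s: "t = s + 9" using True by (metis add.commute le_Suc_ex)
      show "forward (t - 1) t \<longleftrightarrow> R t 0 \<noteq> R (t + 1) 1" "forward (t - 8) t \<longleftrightarrow> R t 7 \<noteq> R (t + 1) 8"
        "forward (t - 9) t \<longleftrightarrow> R t 8 = 1"
        using t unfolding s by (simp_all add: forward_def)
    qed
    moreover have "pt t (t - 1) = of_bool (\<not> forward (t - 1) t)" "pt t (t - 8) = of_bool (\<not> forward (t - 8) t)"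
      "pt t (t - 9) = of_bool (\<not> forward (t - 9) t)"
    proof -
      have "\<not> t < t - 1" "\<not> t < t - 8" "\<not> t < t - 9" by linarith+
      then show "pt t (t - 1) = of_bool (\<not> forward (t - 1) t)" "pt t (t - 8) = of_bool (\<not> forward (t - 8) t)"
        "pt t (t - 9) = of_bool (\<not> forward (t - 9) t)"
        by (simp_all add: points_def)
    qed
    ultimately show ?thesis
      using True first[OF True t] eighth[OF True t] ninth[OF True t] fresh[OF True t]
      by (auto simp: prior_def)
  next
    case nine: False
    then have "pt t 0 = 1" "pt t (t - 1) = 1" using assms by (simp_all add: points_def forward_def)
    then show ?thesis using nine assms by (simp add: prior_def)
  qed
  then show ?thesis using fwd assms False by (simp add: spiral_def)
qed

lemma outer_points:
  shows "v \<in> set (spiral m 0) \<Longrightarrow> points 0 v \<longleftrightarrow> v \<le> 2"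
    and "v \<in> set (spiral m 1) \<Longrightarrow> points 1 v \<longleftrightarrow> v \<le> 2"
    and "v \<in> set (spiral m 2) \<Longrightarrow> points 2 v \<longleftrightarrow> v \<le> 2"
proof -
  have nonforward: "\<not> forward t v" if "t = 1 \<or> t = 2" "v \<in> set (later m t)" for t v
  proof -
    have "(\<Sum>v\<leftarrow>later m t. of_bool (forward t v)) = (0 :: nat)"
      using forward_count[of t] start[of "8 - t"] that(1) m by auto
    then show ?thesis using that(2) by (fastforce simp: sum_list_eq_0_iff)
  qed
  show "points 0 v \<longleftrightarrow> v \<le> 2" if "v \<in> set (spiral m 0)"
  proof (cases "v = 9")
    case True
    then show ?thesis using start[of 8] m by (simp add: points_def forward_def)
  next
    case False
    then have "v < 9" "0 < v" using that m by (auto simp: spiral_def)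
    then show ?thesis by (simp add: points_def forward_def)
  qed
  show "points 1 v \<longleftrightarrow> v \<le> 2" if "v \<in> set (spiral m 1)"
  proof -
    have "v \<in> set (later m 1) \<or> v = 0" using that m by (auto simp: spiral_def prior_def)
    then show ?thesis using nonforward[of 1 v] m by (auto simp: points_def forward_def later_def)
  qed
  show "points 2 v \<longleftrightarrow> v \<le> 2" if "v \<in> set (spiral m 2)"
  proof -
    have "v \<in> set (later m 2) \<or> v = 0 \<or> v = 1" using that m by (auto simp: spiral_def prior_def)
    then show ?thesis using nonforward[of 2 v] m by (auto simp: points_def forward_def later_def)
  qed
qed

lemma points_opposite: "u \<noteq> v \<Longrightarrow> 3 \<le> u \<or> 3 \<le> v \<Longrightarrow> points v u \<longleftrightarrow> \<not> points u v"
  by (auto simp: points_def)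

end

definition corners :: "3 \<Rightarrow> nat" where
  "corners i = (if i = 0 then 0 else if i = 1 then 2 else 1)"

lemma corners_simps [simp]: "corners 0 = 0" "corners 1 = 2" "corners 2 = 1" "corners 4 = 2"
  by (simp_all add: corners_def)

lemma range_corners: "range corners = {0, 1, 2}"
proof
  show "{0, 1, 2} \<subseteq> range corners" 
    using rangeI[of corners 0] rangeI[of corners 1] rangeI[of corners 2] by simp
qed (auto simp: corners_def)

context spiral_walk
begin

abbreviation "pt3 u v \<equiv> (of_bool (points u v) :: 3)"

primrec base_label :: "nat \<Rightarrow> 3" where
  "base_label 0 = 0"
| "base_label (Suc t) = (if t < 2 then 2
     else base_label t + (\<Sum>v\<leftarrow>(if t = 2 then [] else later m t). pt3 t v) + 1 + pt3 (Suc t) t)"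

definition label :: "nat \<times> nat \<Rightarrow> 3" where
  "label = (\<lambda>(t, u).
     if t = 0 then (if u = 1 then 2 else 1)
     else if t = 1 then (if u = 2 then 1 else 0)
     else if t = 2 then (if u = 0 then 0 else 2)
     else base_label t + psum (pt3 t) (spiral m t) u)"

abbreviation "nx u \<equiv> cyclic_next (spiral m u)"

lemma arc: "u \<le> m \<Longrightarrow> v \<in> set (spiral m u) \<Longrightarrow>
    v \<le> m \<and> u \<noteq> v \<and> nx u v \<in> set (spiral m u) \<and> nx u v \<in> set (spiral m v) \<and> nx v (nx u v) = u \<and> u \<in> set (spiral m v)"
proof -
  assume u: "u \<le> m" "v \<in> set (spiral m u)"
  have v: "v \<le> m" "u \<noteq> v" using spiral_distinct_bounded[OF m u(1)] u(2) by auto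
  have w: "nx u v \<in> set (spiral m v)" "nx v (nx u v) = u" using spiral_triangle[OF m u] by auto
  have "nx v (nx u v) \<in> set (spiral m v)"
    using cyclic_next_in[OF _ w(1)] spiral_distinct_bounded[OF m v(1)] by blast
  moreover have "nx u v \<in> set (spiral m u)"
    using cyclic_next_in[OF _ u(2)] spiral_distinct_bounded[OF m u(1)] by blast
  ultimately show ?thesis using v w by simp
qed

lemma outdegree3:
  assumes "3 \<le> t" "t \<le> m"
  shows "(\<Sum>v\<leftarrow>spiral m t. pt3 t v) = 0"
proof -
  have "(\<Sum>v\<leftarrow>xs. pt3 t v) = of_nat (\<Sum>v\<leftarrow>xs. pt t v)" for xs by (induction xs) simp_all
  then show ?thesis using outdegree[OF assms] by simp
qed

lemma label_step_inner:
  assumes "3 \<le> t" "t \<le> m" "u \<in> set (spiral m t)"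
  shows "label (t, nx t u) = label (t, u) + pt3 t (nx t u)"
proof -
  have "distinct (spiral m t)" using spiral_distinct_bounded[OF m assms(2)] by blast
  from psum_cyclic_next[OF this assms(3) outdegree3[OF assms(1,2)]] show ?thesis
    using assms(1) by (simp add: label_def add.assoc)
qed

lemma label_step:
  assumes "t \<le> m" "u \<in> set (spiral m t)" "3 \<le> t \<or> 3 \<le> nx t u"
  shows "label (t, nx t u) = label (t, u) + pt3 t (nx t u)"
proof (cases "3 \<le> t")
  case True
  then show ?thesis using label_step_inner assms by simp
next
  case False
  then have w: "3 \<le> nx t u" "nx t u \<in> set (spiral m t)" using assms(3) arc[OF assms(1,2)] by simp_all
  have t: "t = 0 \<or> t = 1 \<or> t = 2" using False by auto
  then have no: "\<not> points t (nx t u)" 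
  proof (elim disjE)
    assume "t = 0" then show ?thesis using outer_points(1)[of "nx 0 u"] w by simp
  next
    assume "t = 1" then show ?thesis using outer_points(2)[of "nx 1 u"] w by simp
  next
    assume "t = 2" then show ?thesis using outer_points(3)[of "nx 2 u"] w by simp
  qed
  have "nx 0 1 = 2" "nx 1 2 = 0" "nx 2 0 = 1"
    using spiral_start[OF m, of 1] by (simp_all add: numeral_2_eq_2)
  then have "t = 0 \<longrightarrow> u \<noteq> 1" "t = 1 \<longrightarrow> u \<noteq> 2" "t = 2 \<longrightarrow> u \<noteq> 0" using w(1) by (intro impI notI; simp)+
  then show ?thesis using t no w(1) by (auto simp: label_def)
qed

definition consistent :: "nat \<Rightarrow> nat \<Rightarrow> bool" where
  "consistent u v \<longleftrightarrow> label (v, nx u v) = label (u, v) + 1"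

lemma consistent_face:
  assumes "u \<le> m" "v \<in> set (spiral m u)" "nx u v = w" "consistent u v" "consistent v w"
  shows "consistent w u"
proof -
  have vw: "v \<le> m" "w \<in> set (spiral m v)" "nx v w = u"
    using arc[OF assms(1,2)] assms(3) by simp_all
  moreover have "nx w u = v" using arc[OF vw(1,2)] vw(3) by simp
  ultimately show ?thesis using assms by (simp add: consistent_def)
qed

lemma consistent_flip:
  assumes "u \<le> m" "v \<in> set (spiral m u)" "3 \<le> u \<or> 3 \<le> v" "consistent u v"
  shows "consistent v u"
proof -
  note a = arc[OF assms(1,2)]
  then have b: "v \<le> m" "u \<in> set (spiral m v)" by simp_all
  note c = arc[OF b]
  have one: "label (v, u) = label (v, nx u v) + pt3 v u"
    using label_step[of v "nx u v"] a disj_commute[THEN iffD1, OF assms(3)] by simp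
  have two: "label (u, v) = label (u, nx v u) + pt3 u v"
    using label_step[of u "nx v u"] c assms(1,3) by simp
  have "points v u \<longleftrightarrow> \<not> points u v" using points_opposite[of u v] a assms(3) by simp
  then show ?thesis
    using one two assms(4) unfolding consistent_def by (cases "points u v") simp_all
qed

lemma base_label_last:
  assumes "3 \<le> t" "t \<le> m"
  shows "label (t, t - 1) = base_label t"
proof -
  define xs where "xs = (if t = m then [m - 2, m - 3, m - 4, m - 5, m - 6, m - 7, m - 8, m - 9]
    else later m t @ (if 9 \<le> t then [t - 8, t - 9] else [0]))"
  have xs: "spiral m t = xs @ [t - 1]"
    using assms m by (simp add: spiral_def prior_def xs_def)
  have "psum (pt3 t) (spiral m t) (t - 1) = (\<Sum>v\<leftarrow>spiral m t. pt3 t v)"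
    unfolding xs using spiral_distinct_bounded[OF m assms(2)] xs by (subst psum_last) auto
  then show ?thesis using assms outdegree3[OF assms] by (simp add: label_def)
qed

lemma label_later:
  assumes "3 \<le> t" "t < m"
  shows "label (t, t + 1) = base_label t + (\<Sum>v\<leftarrow>later m t. pt3 t v)"
proof -
  obtain xs where xs: "later m t = xs @ [t + 1]"
  proof (cases "t + 9 \<le> m")
    case True
    then show ?thesis using that[of "[t + 8, t + 9]"] by (simp add: later_def)
  next
    case False
    then show ?thesis using that[of "[m]"] that[of "[]"] assms by (cases "t + 1 < m") (simp_all add: later_def)
  qed
  then have sp: "spiral m t = xs @ (t + 1) # prior t" using assms by (simp add: spiral_def)
  have "psum (pt3 t) (spiral m t) (t + 1) = (\<Sum>v\<leftarrow>later m t. pt3 t v)"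
    unfolding sp xs using spiral_distinct_bounded[OF m, of t] assms sp by (subst psum_last) auto
  then show ?thesis using assms by (simp add: label_def)
qed

lemma consistent_spine:
  assumes "2 \<le> t" "t < m"
  shows "consistent t (t + 1)"
proof -
  have mem: "t + 1 \<in> set (spiral m t)" using spiral_members(3)[OF m] assms by simp
  have w: "nx t (t + 1) \<in> set (spiral m (t + 1))" "nx (t + 1) (nx t (t + 1)) = t" using arc[OF _ mem] assms by auto
  have "label (t, t + 1) = base_label t + (\<Sum>v\<leftarrow>(if t = 2 then [] else later m t). pt3 t v)"
  proof (cases "t = 2")
    case True
    then show ?thesis by (simp add: label_def numeral_2_eq_2)
  next
    case False
    then show ?thesis using label_later assms by simp
  qed
  moreover have "label (t + 1, t) = base_label (t + 1)" using base_label_last[of "t + 1"] assms by simp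
  moreover have "label (t + 1, t) = label (t + 1, nx t (t + 1)) + pt3 (t + 1) t"
    using label_step_inner[of "t + 1" "nx t (t + 1)"] assms w by simp
  ultimately show ?thesis using assms by (simp add: consistent_def)
qed

lemma consistent_outer: "consistent 0 2" "consistent 2 1" "consistent 1 0"
proof -
  have "nx 0 2 = 3" "nx 2 1 = 10" "nx 1 0 = 9"
    using spiral_start(1)[OF m, of 2] spiral_rhombus_right(3)[OF m, of 1] spiral_rhombus_right(3)[OF m, of 0] m
    by (simp_all add: numeral_eq_Suc)
  then show "consistent 0 2" "consistent 2 1" "consistent 1 0" by (simp_all add: consistent_def label_def)
qed

lemma consistent_down:
  assumes "1 \<le> t" "t < m"
  shows "consistent (t + 1) t"
proof (cases "t = 1")
  case True
  then show ?thesis using consistent_outer(2) by (simp add: numeral_2_eq_2)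
next
  case False
  then show ?thesis using consistent_flip[OF _ _ _ consistent_spine, of t] spiral_members(3)[OF m, of t] assms by simp
qed

lemma consistent_fan:
  assumes "2 \<le> t" "t \<le> 8"
  shows "consistent 0 t"
  using assms
proof (induction t rule: dec_induct)
  case base
  show ?case by (rule consistent_outer)
next
  case (step t)
  have "nx 0 t = t + 1" using spiral_start(1)[OF m, of t] step by simp
  moreover have "t \<in> set (spiral m 0)" using spiral_members(7)[OF m, of t] step by simp
  ultimately have "consistent (t + 1) 0"
    using consistent_face[of 0 t "t + 1"] step consistent_spine[of t] m by simp
  moreover have "0 \<in> set (spiral m (t + 1))" using spiral_members(8)[OF m, of "t + 1"] step by simp
  ultimately show ?case using consistent_flip[of "t + 1" 0] step m by simp
qed

lemma consistent_rhombus: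
  assumes "s + 9 \<le> m" "consistent s (s + 8)"
  shows "consistent (s + 9) s" "consistent s (s + 9)" "consistent (s + 9) (s + 1)"
proof -
  have spine: "consistent (s + 8) (s + 9)" using consistent_spine[of "s + 8"] assms(1) by (simp add: add.commute)
  show a: "consistent (s + 9) s"
    using consistent_face[OF _ _ spiral_rhombus_left(1)[OF m assms(1)] assms(2) spine]
      spiral_members(1)[OF m assms(1)] assms(1) by simp
  show b: "consistent s (s + 9)"
    using consistent_flip[OF _ spiral_members(5)[OF m assms(1)] _ a] assms(1) by simp
  have down: "consistent (s + 1) s" using consistent_down[of s] consistent_outer(3) assms(1) by (cases "s = 0") auto
  show "consistent (s + 9) (s + 1)"
    using consistent_face[OF _ _ spiral_rhombus_right(3)[OF m assms(1)] down b]
      spiral_members(4)[OF m, of s] assms(1) by simp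
qed

lemma consistent_left:
  assumes "s + 9 \<le> m"
  shows "consistent s (s + 8)"
  using assms
proof (induction s)
  case 0
  show ?case using consistent_fan[of 8] by simp
next
  case (Suc s)
  then have "consistent s (s + 8)" by simp
  then have "consistent (s + 9) (s + 1)" using consistent_rhombus(3) Suc.prems by simp
  moreover have "s + 1 \<in> set (spiral m (s + 9))" using spiral_members(6)[OF m, of s] Suc.prems by simp
  ultimately have "consistent (s + 1) (s + 9)" using consistent_flip[of "s + 9" "s + 1"] Suc.prems by simp
  then show ?case by (simp add: add.commute)
qed

lemma consistent_last:
  assumes "m \<le> t + 9" "t + 2 \<le> m"
  shows "consistent t m"
proof -
  have "m - 9 \<le> t" using assms by simp
  then show ?thesis using assms(2)
  proof (induction t rule: dec_induct)
    case base
    show ?case using consistent_rhombus(2)[OF _ consistent_left, of "m - 9"] m by simp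
  next
    case (step t)
    show ?case
    proof (cases "t = m - 9")
      case True
      then have "t + 9 = m" using m by simp
      then have "consistent m (t + 1)" using consistent_rhombus(3)[OF _ consistent_left, of t] by simp
      moreover have "t + 1 \<in> set (spiral m m)" using spiral_members(10)[OF m, of "t + 1"] \<open>t + 9 = m\<close> by simp
      ultimately show ?thesis using consistent_flip[of m "t + 1"] m by simp
    next
      case False
      then have t: "m \<le> t + 8" "t + 2 \<le> m" using step by simp_all
      have "consistent t m" using step t by simp
      moreover have "consistent (t + 1) t" using consistent_down[of t] t m by simp
      moreover have "t \<in> set (spiral m (t + 1))" using spiral_members(4)[OF m, of t] t by simp
      ultimately have "consistent m (t + 1)"
        using consistent_face[of "t + 1" t m] spiral_end(3)[OF m t] t by simp
      moreover have "t + 1 \<in> set (spiral m m)" using spiral_members(10)[OF m, of "t + 1"] t by simp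
      ultimately show ?thesis using consistent_flip[of m "t + 1"] m by simp
    qed
  qed
qed

lemma consistent_all:
  assumes "u \<le> m" "v \<in> set (spiral m u)" "3 \<le> u \<or> 3 \<le> v"
  shows "consistent u v"
  using m assms(1,2)
proof (cases rule: spiral_arc_cases)
  case (left s)
  then show ?thesis
    using consistent_left[of s] consistent_rhombus(1)[OF left(1)] consistent_spine[of "s + 8"]
    by (auto simp: add.commute)
next
  case (right s)
  have "consistent (s + 1) s" using consistent_down[of s] consistent_outer(3) right(1) by (cases "s = 0") auto
  then show ?thesis using right consistent_left[of s] consistent_rhombus(2,3)[OF right(1)] by auto
next
  case (start t)
  consider "(u, v) = (0, t)" | "(u, v) = (t, t + 1)" | "(u, v) = (t + 1, 0)" using start(3) by auto
  then show ?thesis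
  proof cases
    case 1
    then show ?thesis using consistent_fan[of t] start assms(3) by simp
  next
    case 2
    then have "2 \<le> t" using assms(3) by auto
    then show ?thesis using 2 consistent_spine[of t] start m by simp
  next
    case 3
    then have "t \<ge> 2" using assms(3) by simp
    then have "consistent 0 (t + 1)" using consistent_fan[of "t + 1"] start by simp
    moreover have "t + 1 \<in> set (spiral m 0)" using spiral_members(7)[OF m, of "t + 1"] start by simp
    ultimately show ?thesis using consistent_flip[of 0 "t + 1"] 3 \<open>t \<ge> 2\<close> by simp
  qed
next
  case ("end" t)
  have mem: "t + 1 \<in> set (spiral m m)" "m \<in> set (spiral m (t + 1))"
    using spiral_members(9,10)[OF m, of "t + 1"] "end" by simp_all
  have "consistent (t + 1) m"
  proof (cases "t + 2 = m")
    case True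
    then show ?thesis using consistent_spine[of "t + 1"] m by (simp add: numeral_2_eq_2)
  next
    case False
    then show ?thesis using consistent_last[of "t + 1"] "end" by simp
  qed
  then have "consistent m (t + 1)" using consistent_flip[OF _ mem(2)] "end" m by simp
  moreover have "consistent t m" using consistent_last "end" by simp
  moreover have "consistent (t + 1) t" using consistent_down[of t] "end" m by simp
  ultimately show ?thesis using "end"(3) by auto
qed

definition spiral_orientation :: "(nat \<times> nat) set" where
  "spiral_orientation = {(u, v) \<in> list_arcs (Suc m) (spiral m). points u v}"

sublocale neighbour_lists "Suc m" "spiral m" "(2, Suc 0)"
  by (rule spiral_neighbours[OF m])

lemma outer_spiral: "outer M = {(2, 1), (1, 0), (0, 2)}"
proof -
  have "(1, 2) \<in> list_arcs (Suc m) (spiral m)" using m by (simp add: list_arcs_def spiral_defs)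
  moreover have "nx 1 2 = 0" using spiral_start(2)[OF m, of 1] by (simp add: numeral_2_eq_2)
  ultimately show ?thesis using face_orbit[of 1 2 0] by simp
qed

sublocale triangulation M corners
proof
  show "plane_triangulation M" by (rule triangulation_list_map)
  show "outer_labeling M corners"
    unfolding outer_labeling_def outer_spiral
  proof
    fix i show "(corners i, corners (i + 1)) \<in> {(2, 1), (1, 0), (0, 2)}"
      by (rule three_cases[of i]) simp_all
  qed
qed

end

context spiral_walk
begin

lemma spiral_orientation_iff:
  "(u, v) \<in> spiral_orientation \<longleftrightarrow> u \<le> m \<and> v \<in> set (spiral m u) \<and> points u v"
  by (auto simp: spiral_orientation_def list_arcs_def)

lemma corner_out: "{e \<in> spiral_orientation. fst e = corners i} = {(corners i, corners (i + 1)), (corners i, corners (i + 2))}"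
proof -
  have "{e \<in> spiral_orientation. fst e = t} = Pair t ` {v \<in> set (spiral m t). v \<le> 2}" if "t = 0 \<or> t = 1 \<or> t = 2" for t
  proof -
    have "points t v \<longleftrightarrow> v \<le> 2" if v: "v \<in> set (spiral m t)" for v
      using \<open>t = 0 \<or> t = 1 \<or> t = 2\<close>
    proof (elim disjE)
      assume "t = 0" then show ?thesis using outer_points(1)[of v] v by simp
    next
      assume "t = 1" then show ?thesis using outer_points(2)[of v] v by simp
    next
      assume "t = 2" then show ?thesis using outer_points(3)[of v] v by simp
    qed
    moreover have "t \<le> m" using that m by auto
    ultimately show ?thesis by (auto simp: spiral_orientation_def list_arcs_def)
  qed
  note star = this
  have two: "spiral m 2 = [10, 11, 3, 0, 1]" using spiral_lists(3)[OF m, of 2] by simp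
  have "{v \<in> set (spiral m 0). v \<le> 2} = {2, 1}" unfolding spiral_lists(1)[OF m] by auto
  moreover have "{v \<in> set (spiral m 1). v \<le> 2} = {2, 0}" unfolding spiral_lists(2)[OF m] by auto
  moreover have "{v \<in> set (spiral m 2). v \<le> 2} = {1, 0}" unfolding two by auto
  ultimately have "{e \<in> spiral_orientation. fst e = 0} = {(0, 2), (0, 1)}"
    "{e \<in> spiral_orientation. fst e = 1} = {(1, 0), (1, 2)}"
    "{e \<in> spiral_orientation. fst e = 2} = {(2, 1), (2, 0)}"
    using star[of 0] star[of 1] star[of 2] by auto
  then show ?thesis by (rule_tac three_cases[of i]) simp_all
qed

lemma inner_vertex: "v \<notin> range corners \<longleftrightarrow> 3 \<le> v" for v
  by (auto simp: range_corners)

lemma orientation_locale: "labelled_orientation M corners spiral_orientation label"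
proof unfold_locales
  show "spiral_orientation \<subseteq> edge_arcs M" by (auto simp: spiral_orientation_def)
next
  fix u v assume "(u, v) \<in> edge_arcs M"
  then have uv: "u \<le> m" "v \<in> set (spiral m u)" by (simp_all add: list_arcs_def)
  have "v \<le> m" "u \<noteq> v" "u \<in> set (spiral m v)" using arc[OF uv] by simp_all
  moreover have "points u v \<or> points v u" using \<open>u \<noteq> v\<close> by (auto simp: points_def)
  ultimately show "(u, v) \<in> spiral_orientation \<or> (v, u) \<in> spiral_orientation"
    using uv by (simp add: spiral_orientation_iff)
next
  fix u v assume uv: "(u, v) \<in> spiral_orientation" "(v, u) \<in> spiral_orientation"
  then have "u \<noteq> v" using arc[of u v] by (simp add: spiral_orientation_iff)
  moreover have "points u v" "points v u" using uv by (simp_all add: spiral_orientation_iff)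
  ultimately have "\<not> (3 \<le> u \<or> 3 \<le> v)" using points_opposite[of u v] by blast
  then have "u \<le> 2" "v \<le> 2" by simp_all
  then have "(u, v) \<in> {(0, 1), (0, 2), (1, 2), (1, 0), (2, 0), (2, 1)}" using \<open>u \<noteq> v\<close> by auto
  moreover have "(corners 0, corners (0 + 1)) = (0, 2)" "(corners 1, corners (1 + 1)) = (2, 1)"
    "(corners 2, corners (2 + 1)) = (1, 0)" by simp_all
  ultimately show "\<exists>i. (u, v) = (corners i, corners (i + 1)) \<or> (u, v) = (corners (i + 1), corners i)"
    by (auto intro: exI[of _ 0] exI[of _ 1] exI[of _ 2])
next
  fix v assume "v \<in> vertices M" "v \<notin> range corners"
  then have v: "3 \<le> v" "v \<le> m" by (simp_all add: inner_vertex)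
  have d: "distinct (spiral m v)" using spiral_distinct_bounded[OF m v(2)] by blast
  have "{e \<in> spiral_orientation. fst e = v} = Pair v ` {w \<in> set (spiral m v). points v w}"
    using v by (auto simp: spiral_orientation_def list_arcs_def)
  then have "card {e \<in> spiral_orientation. fst e = v} = card {w \<in> set (spiral m v). points v w}"
    by (simp add: card_image inj_on_def)
  also have "\<dots> = (\<Sum>w \<in> set (spiral m v). pt v w)"
    by (simp add: Int_def)
  also have "\<dots> = 3" using outdegree[OF v] d by (simp add: sum_list_distinct_conv_sum_set)
  finally show "card {e \<in> spiral_orientation. fst e = v} = 3" .
next
  fix e assume "e \<in> edge_arcs M" "fst e \<notin> range corners"
  then obtain t u where e: "e = (t, u)" "3 \<le> t" "t \<le> m" "u \<in> set (spiral m t)"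
    by (cases e) (auto simp: list_arcs_def inner_vertex)
  then have "(t, u) \<in> arcset" by (simp add: list_arcs_def)
  then show "label (rot M e) = label e + of_bool (rot M e \<in> spiral_orientation)"
    using label_step_inner[OF e(2-4)] arc[OF e(3,4)] e(1,3) by (simp add: spiral_orientation_iff)
next
  fix i show "{e \<in> spiral_orientation. fst e = corners i} = {(corners i, corners (i + 1)), (corners i, corners (i + 2))}"
    by (rule corner_out)
next
  fix i show "label (corners i, corners (i + 2)) = i + 2"
    by (rule three_cases[of i]) (simp_all add: label_def)
next
  fix e i assume e: "e \<in> edge_arcs M" "fst e = corners i" "e \<noteq> (corners i, corners (i + 2))"
  then obtain u where "e = (corners i, u)" "u \<noteq> corners (i + 2)" by (cases e) auto
  then show "label e = i + 1"
    by (rule_tac three_cases[of i]) (simp_all add: label_def)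
next
  fix u v assume uv: "(u, v) \<in> spiral_orientation" "(v, u) \<notin> spiral_orientation"
  then have u: "u \<le> m" "v \<in> set (spiral m u)" "points u v" by (simp_all add: spiral_orientation_iff)
  note a = arc[OF u(1,2)]
  have npt: "\<not> points v u" using uv(2) a by (simp add: spiral_orientation_iff)
  moreover have "\<not> forward u v" "\<not> forward v u" if "u \<le> 2" "v \<le> 2" using that by (simp_all add: forward_def)
  ultimately have big: "3 \<le> u \<or> 3 \<le> v" using u(3) a by (fastforce simp: points_def split: if_splits)
  have "label (v, u) = label (v, nx u v) + pt3 v u"
    using label_step[of v "nx u v"] a disj_commute[THEN iffD1, OF big] by simp
  then show "label (v, u) = label (u, v) + 1"
    using consistent_all[OF u(1,2) big] npt by (simp add: consistent_def)
qed

definition wood :: "nat dart \<Rightarrow> 3 option" where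
  "wood = label_colouring corners spiral_orientation label"

lemma wood_schnyder: "wood \<in> schnyder_woods M corners"
  unfolding wood_def by (rule labelled_orientation.colour_schnyder_wood[OF orientation_locale])

lemma wood_forward:
  assumes "9 \<le> t" "t \<le> m" "s \<in> set (spiral m t)" "s < t"
  shows "wood (Edge (s, t)) \<noteq> None \<longleftrightarrow> forward s t"
proof -
  have "t \<in> set (spiral m s)" using arc[OF assms(2,3)] by simp
  then show ?thesis using assms by (simp add: wood_def label_colouring_def spiral_orientation_iff points_def)
qed

end

lemma walk_determined:
  assumes "spiral_walk m R" "spiral_walk m R'" "spiral_walk.wood m R = spiral_walk.wood m R'"
    and "9 \<le> t" "t \<le> m" "i < 9"
  shows "R t i = R' t i"
proof -
  interpret w: spiral_walk m R by fact
  interpret w': spiral_walk m R' by fact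
  show ?thesis
    using assms(4-6)
  proof (induction t arbitrary: i rule: dec_induct)
    case base
    then show ?case using w.start w'.start by simp
  next
    case (step t)
    then have t: "9 \<le> t" "t < m" by simp_all
    have same: "R t j = R' t j" if "j < 9" for j using step that by simp
    obtain s where s: "t = s + 9" using t(1) by (metis add.commute le_Suc_ex)
    have mem: "s + 1 \<in> set (spiral m t)" "s + 8 \<in> set (spiral m t)"
      using spiral_members(6)[OF w.m, of s] spiral_members(4)[OF w.m, of "s + 8"] t s by (simp_all add: add.commute)
    have "w.forward (s + 8) t \<longleftrightarrow> w'.forward (s + 8) t" "w.forward (s + 1) t \<longleftrightarrow> w'.forward (s + 1) t"
      using w.wood_forward[OF t(1) _ mem(2)] w'.wood_forward[OF t(1) _ mem(2)]
        w.wood_forward[OF t(1) _ mem(1)] w'.wood_forward[OF t(1) _ mem(1)] assms(3) t s by simp_all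
    moreover have "w.forward (s + 8) t \<longleftrightarrow> R t 0 \<noteq> R (t + 1) 1" "w'.forward (s + 8) t \<longleftrightarrow> R' t 0 \<noteq> R' (t + 1) 1"
      "w.forward (s + 1) t \<longleftrightarrow> R t 7 \<noteq> R (t + 1) 8" "w'.forward (s + 1) t \<longleftrightarrow> R' t 7 \<noteq> R' (t + 1) 8"
      using t unfolding s by (simp_all add: w.forward_def w'.forward_def)
    ultimately have iff: "R t 0 \<noteq> R (t + 1) 1 \<longleftrightarrow> R' t 0 \<noteq> R' (t + 1) 1"
      "R t 7 \<noteq> R (t + 1) 8 \<longleftrightarrow> R' t 7 \<noteq> R' (t + 1) 8" by simp_all
    have one: "R (t + 1) 1 = R' (t + 1) 1" using iff(1) same[of 0] w.first[OF t] w'.first[OF t] by auto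
    have eight: "R (t + 1) 8 = R' (t + 1) 8" using iff(2) same[of 7] w.eighth[OF t] w'.eighth[OF t] by auto
    have zero: "R (t + 1) 0 = R' (t + 1) 0"
      unfolding w.fresh[OF t] w'.fresh[OF t] using one eight same[of 0] same[of 7] same[of 8] by simp
    have mid: "R (t + 1) (j + 1) = R' (t + 1) (j + 1)" if "1 \<le> j" "j \<le> 6" for j
      using w.shift[OF t that] w'.shift[OF t that] same[of j] that by simp
    have "i = 0 \<or> i = 1 \<or> i = 8 \<or> i = (i - 1) + 1 \<and> 1 \<le> i - 1 \<and> i - 1 \<le> 6" using step.prems by linarith
    then show ?case
      using zero one eight mid[of "i - 1"] by auto
  qed
qed

definition bipyramid :: "nat \<Rightarrow> nat \<Rightarrow> nat list" where
  "bipyramid n u =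
     (if u = 0 then [1..<n]
      else if u = 1 then 0 # rev [2..<n]
      else 0 # (if u = 2 then [] else [u - 1]) @ 1 # (if u = n - 1 then [] else [u + 1]))"

lemma bipyramid_next:
  assumes "3 \<le> n"
  shows "v \<in> {1..<n} \<Longrightarrow> cyclic_next (bipyramid n 0) v = (if v = n - 1 then 1 else v + 1)"
    and "cyclic_next (bipyramid n 1) 0 = n - 1"
    and "v \<in> {2..<n} \<Longrightarrow> cyclic_next (bipyramid n 1) v = (if v = 2 then 0 else v - 1)"
    and "2 \<le> u \<Longrightarrow> u < n \<Longrightarrow> cyclic_next (bipyramid n u) 0 = u - 1"
    and "2 \<le> u \<Longrightarrow> u < n \<Longrightarrow> cyclic_next (bipyramid n u) 1 = (if u = n - 1 then 0 else u + 1)"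
    and "3 \<le> u \<Longrightarrow> u < n \<Longrightarrow> cyclic_next (bipyramid n u) (u - 1) = 1"
    and "2 \<le> u \<Longrightarrow> u + 1 < n \<Longrightarrow> cyclic_next (bipyramid n u) (u + 1) = 0"
proof -
  show "cyclic_next (bipyramid n 0) v = (if v = n - 1 then 1 else v + 1)" if "v \<in> {1..<n}"
  proof -
    have v: "v = [1..<n] ! (v - 1)" "v - 1 < length [1..<n]" using that by auto
    show ?thesis
      using follow_nth[OF distinct_upt v(2), of 1] that v assms
      by (auto simp: bipyramid_def cyclic_next_def hd_upt)
  qed
  have nth: "(0 # rev [2..<n]) ! i = (if i = 0 then 0 else n - i)" if "i < n - 1" for i
    using that by (auto simp: nth_Cons rev_nth split: nat.split)
  have next1: "cyclic_next (bipyramid n 1) (if i = 0 then 0 else n - i) =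
      (if Suc i < n - 1 then n - Suc i else 0)" if "i < n - 1" for i
  proof -
    have "cyclic_next (bipyramid n 1) = follow 0 (0 # rev [2..<n])"
      by (simp add: bipyramid_def cyclic_next_def)
    moreover have "distinct (0 # rev [2..<n])" "i < length (0 # rev [2..<n])" using that by auto
    ultimately show ?thesis
      using follow_nth[of "0 # rev [2..<n]" i 0] nth[OF that] nth[of "Suc i"] that by auto
  qed
  show "cyclic_next (bipyramid n 1) 0 = n - 1"
    using next1[of 0] assms by simp
  show "cyclic_next (bipyramid n 1) v = (if v = 2 then 0 else v - 1)" if "v \<in> {2..<n}"
    using next1[of "n - v"] that by auto
qed (auto simp: bipyramid_def cyclic_next_def)

lemma bipyramid_neighbours:
  assumes n: "3 \<le> n"
  shows "neighbour_lists n (bipyramid n) (1, 0)"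
proof
  have mem: "set (bipyramid n 0) = {1..<n}" "set (bipyramid n 1) = insert 0 {2..<n}"
    "2 \<le> u \<Longrightarrow> set (bipyramid n u) =
       {0, 1} \<union> (if u = 2 then {} else {u - 1}) \<union> (if u = n - 1 then {} else {u + 1})" for u
    by (auto simp: bipyramid_def)
  note mem = mem mem(2)[unfolded One_nat_def]
  have cases: "u = 0 \<or> u = 1 \<or> 2 \<le> u" for u :: nat by linarith
  show "distinct (bipyramid n u)" if "u < n" for u
    using that by (auto simp: bipyramid_def)
  show "v < n \<and> v \<noteq> u" if "u < n" "v \<in> set (bipyramid n u)" for u v
    using that n cases[of u] by (auto simp: mem split: if_splits)
  show "cyclic_next (bipyramid n u) v \<in> set (bipyramid n v) \<and>
      cyclic_next (bipyramid n v) (cyclic_next (bipyramid n u) v) = u"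
    if uv: "u < n" "v \<in> set (bipyramid n u)" for u v
  proof -
    note nxt = bipyramid_next[OF n]
    consider (top) "u = 0" "v \<in> {1..<n}" | (bottom) "u = 1" "v = 0" | (bottom_rim) "u = 1" "v \<in> {2..<n}"
      | (rim_top) "2 \<le> u" "v = 0" | (rim_bottom) "2 \<le> u" "v = 1"
      | (rim_prev) "3 \<le> u" "v = u - 1" | (rim_next) "2 \<le> u" "v = u + 1" "u + 1 < n"
      using cases[of u] uv
    proof (elim disjE)
      assume "2 \<le> u"
      then show ?thesis using uv rim_top rim_bottom rim_prev rim_next by (auto simp: mem split: if_splits)
    qed (use uv top bottom bottom_rim in \<open>auto simp: mem\<close>)
    then show ?thesis
    proof cases
      case top
      then consider "v = 1" | "2 \<le> v" "v < n - 1" | "2 \<le> v" "v = n - 1" by fastforce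
      then show ?thesis using top n nxt by cases (auto simp: mem)
    next
      case bottom
      then show ?thesis using n nxt by (auto simp: mem)
    next
      case bottom_rim
      then show ?thesis using n nxt(3,4,6)[of v] by (auto simp: mem)
    next
      case rim_top
      then obtain w where "u = Suc w" "1 \<le> w" by (cases u) auto
      then show ?thesis using rim_top n uv nxt(4)[of u] nxt(1)[of w] by (auto simp: mem)
    next
      case rim_bottom
      then show ?thesis using n uv nxt(5)[of u] nxt(2) nxt(3)[of "u + 1"] by (auto simp: mem)
    next
      case rim_prev
      then show ?thesis using n uv nxt(6)[of u] nxt(5)[of "u - 1"] by (auto simp: mem)
    next
      case rim_next
      then show ?thesis using n uv nxt(7)[of u] nxt(4)[of "u + 1"] by (auto simp: mem)
    qed
  qed
  show "(\<Sum>u<n. length (bipyramid n u)) + 12 = 6 * n"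
  proof -
    have "(\<Sum>u<n. length (bipyramid n u)) =
        length (bipyramid n 0) + length (bipyramid n 1) + (\<Sum>u\<in>{2..<n}. length (bipyramid n u))"
    proof -
      have "{..<n} = insert 0 (insert 1 {2..<n})" using n by auto
      then show ?thesis by simp
    qed
    moreover have "(\<Sum>u\<in>{2..<n}. length (bipyramid n u) + of_bool (u = 2) + of_bool (u = n - 1)) = (\<Sum>u\<in>{2..<n}. 4)"
      by (rule sum.cong) (auto simp: bipyramid_def)
    moreover have "(\<Sum>u\<in>{2..<n}. of_bool (u = 2)) = (1 :: nat)" "(\<Sum>u\<in>{2..<n}. of_bool (u = n - 1)) = (1 :: nat)"
      using n by (subst sum_of_bool_eq; simp add: Int_insert_right flip: Collect_conv_if)+
    ultimately show ?thesis using n unfolding sum.distrib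
      by (simp add: bipyramid_def)
  qed
  show "\<exists>v<u. v \<in> set (bipyramid n u)" if "0 < u" "u < n" for u
    using that by (intro exI[of _ 0]) (auto simp: bipyramid_def)
  show "(1, 0) \<in> list_arcs n (bipyramid n)" using n by (simp add: list_arcs_def bipyramid_def)
qed

lemma triangulations_nonempty:
  assumes n: "3 \<le> n"
  shows "triangulations n \<noteq> {}"
proof -
  interpret neighbour_lists n "bipyramid n" "(1, 0)" by (rule bipyramid_neighbours[OF n])
  define a :: "3 \<Rightarrow> nat" where "a i = (if i = 0 then 2 else if i = 1 then 1 else 0)" for i
  have a: "a 0 = 2" "a 1 = 1" "a 2 = 0" by (simp_all add: a_def)
  have "(0, 1) \<in> arcset" "2 = cyclic_next (bipyramid n 0) 1"
    using n bipyramid_next(1)[OF n, of 1] by (auto simp: list_arcs_def bipyramid_def)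
  then have outer: "outer M = {(1, 0), (0, 2), (2, 1)}"
    using face_orbit[of 0 1 2] unfolding M_simps(4) by auto
  have "outer_labeling M a"
    unfolding outer_labeling_def outer
  proof
    fix i show "(a i, a (i + 1)) \<in> {(1, 0), (0, 2), (2, 1)}"
      by (rule three_cases[of i]) (simp_all add: a_def)
  qed
  moreover have "card (vertices M) = n" unfolding M_simps(1) by simp
  ultimately show ?thesis using triangulation_list_map by (auto simp: triangulations_def)
qed

datatype trie = E | L int | B trie trie trie

fun look :: "trie \<Rightarrow> nat list \<Rightarrow> int" where
  "look (L w) [] = w"
| "look (B t0 t1 t2) (d # s) = look (if d = 0 then t0 else if d = 1 then t1 else if d = 2 then t2 else E) s"
| "look _ _ = 0"

fun entries :: "(nat list \<Rightarrow> int \<Rightarrow> bool) \<Rightarrow> nat list \<Rightarrow> trie \<Rightarrow> bool" where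
  "entries P p E \<longleftrightarrow> True"
| "entries P p (L w) \<longleftrightarrow> P (rev p) w"
| "entries P p (B t0 t1 t2) \<longleftrightarrow>
     entries P (0 # p) t0 \<and> entries P (1 # p) t1 \<and> entries P (2 # p) t2"

lemma entries_look: "entries P p t \<Longrightarrow> look t s \<noteq> 0 \<Longrightarrow> P (rev p @ s) (look t s)"
proof (induction t s arbitrary: p rule: look.induct)
  case (2 t0 t1 t2 d s)
  from 2(3) consider "d = 0" | "d = 1" | "d = 2" by (auto split: if_splits)
  then show ?case using 2(1)[of "d # p"] 2(2,3) by cases auto
qed auto

definition choices :: "nat \<Rightarrow> nat list" where
  "choices r = (if r = 0 then [0] else [0, 1])"

fun steps :: "nat list \<Rightarrow> nat list list" where
  "steps [a, b, c, d, e, f, g, h, i] =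
     (if i \<le> 1 then [[i + x + y, a - x, b, c, d, e, f, g, h - y]. x \<leftarrow> choices a, y \<leftarrow> choices h]
      else [])"
| "steps _ = []"

definition settled :: "nat list \<Rightarrow> bool" where
  "settled s \<longleftrightarrow> length s = 9 \<and> list_all (\<lambda>r. r \<le> 1) s \<and> sum_list s = 6"

fun settles :: "nat \<Rightarrow> nat list \<Rightarrow> bool" where
  "settles 0 s = settled s"
| "settles (Suc k) [a, b, c, d, e, f, g, h, i] =
     (settled [a, b, c, d, e, f, g, h, i] \<or>
      i \<le> 1 \<and> settles k [i + of_bool (2 \<le> a) + of_bool (2 \<le> h), a - of_bool (2 \<le> a), b, c, d, e, f, g,
        h - of_bool (2 \<le> h)])"
| "settles _ s = False"

definition weights :: trie where
  "weights =
   B (B (B (B E (B E (B E (B E (B E (B E (L 678) E) E) E) E) E) (B (B E (B E (B E (B E (L 302)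
   E) E) E) E) E E)) (B (B E (B (B E E (B E (B E (L 331) E) E)) (B (B E E (B E (L 416) E)) (B E
   (B E (L 1256) E) E) E) (B (B E (B E (L 346) E) E) E E)) (B (B E (B E (B E (L 513) E) E) E)
   (B (B E (B E (L 365) E) E) (B (B E (L 217) E) E E) E) E)) (B (B (B E E (B E (B E (L 353) E)
   E)) (B (B E E (B E (L 493) E)) (B E (B E (L 1658) E) (B (L 727) E E)) (B (B E (L 401) E) E
   E)) (B (B E (B E (L 571) E) E) (B (B E (L 380) E) (B (L 380) E E) E) E)) (B (B (B E E (B E
   (L 441) E)) (B E (B E (L 1733) E) (B (L 802) E E)) (B (B E (L 496) E) (B (L 496) E E) E)) (B
   (B E (B E (L 1518) E) (B (L 780) E E)) (B (B E (L 1115) E) (B (L 1401) E E) E) E) E) (B (B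
   (B E (B E (L 238) E) E) (B (B E (L 182) E) E E) E) E E)) (B (B (B E (B E (B E (L 349) E) E)
   E) (B (B E (B E (L 383) E) E) (B (B E (L 305) E) (B (L 305) E E) E) E) E) E E)) (B (B (B E
   (B E (B E (B E (L 471) E) E) E) (B (B E (B E (L 177) E) E) E E)) (B (B E (B E (B E (L 617)
   E) (B (L 296) E E)) (B (B E (L 191) E) E E)) (B (B E (B E (L 615) E) (B (L 321) E E)) (B (B
   E (L 478) E) (B (L 606) E E) E) E) E) E) (B (B (B E (B E (B E (L 361) E) E) E) (B (B E (B E
   (L 419) E) (B (L 225) E E)) (B (B E (L 351) E) (B (L 351) E E) E) E) E) (B (B (B E (B E (L
   247) E) E) (B (B E (L 229) E) (B (L 229) E E) E) E) E E) E) E)) (B (B (B E (B (B E E (B E (B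
   E (L 287) E) E)) (B (B E E (B E (L 379) E)) (B E (B E (L 1241) E) E) (B (B E (L 283) E) E
   E)) (B (B E (B E (L 397) E) E) E E)) (B (B E (B E (B E (L 573) E) E) E) (B (B E (B E (L 457)
   E) E) (B (B E (L 336) E) E E) E) E)) (B (B (B E E (B E (B E (L 362) E) E)) (B (B E E (B E (L
   528) E)) (B E (B E (L 1908) E) (B (L 869) E E)) (B (B E (L 506) E) (B (L 506) E E) E)) (B (B
   E (B E (L 723) E) E) (B (B E (L 519) E) (B (L 659) E E) E) E)) (B (B (B E E (B E (L 525) E))
   (B E (B E (L 2228) E) (B (L 1072) E E)) (B (B E (L 696) E) (B (L 872) E E) E)) (B (B E (B E
   (L 2147) E) (B (L 1152) E E)) (B (B E (L 1706) E) (B (L 2236) E E) E) E) (B (B (B E (L 258)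
   E) (B (L 258) E E) E) E E)) (B (B (B E (B E (L 447) E) E) (B (B E (L 407) E) (B (L 553) E E)
   E) E) (B (B (B E (L 153) E) E E) E E) E)) (B (B (B E (B E (B E (L 621) E) (B (L 315) E E))
   (B (B E (L 216) E) (B (L 216) E E) E)) (B (B E (B E (L 716) E) (B (L 400) E E)) (B (B E (L
   619) E) (B (L 836) E E) E) E) E) (B (B (B E (B E (L 409) E) (B (L 246) E E)) (B (B E (L 409)
   E) (B (L 563) E E) E) E) (B (B (B E (L 208) E) (B (L 300) E E) E) E E) E) E)) (B (B (B (B E
   E (B E (B E (L 264) E) E)) (B (B E E (B E (L 408) E)) (B E (B E (L 1586) E) (B (L 746) E E))
   (B (B E (L 454) E) (B (L 454) E E) E)) (B (B E (B E (L 659) E) E) (B (B E (L 500) E) (B (L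
   649) E E) E) E)) (B (B (B E E (B E (L 472) E)) (B E (B E (L 2175) E) (B (L 1082) E E)) (B (B
   E (L 732) E) (B (L 940) E E) E)) (B (B E (B E (L 2312) E) (B (L 1281) E E)) (B (B E (L 1984)
   E) (B (L 2683) E E) E) (B (B (L 306) E E) E E)) (B (B (B E (L 359) E) (B (L 529) E E) E) E
   E)) (B (B (B E (B E (L 585) E) (B (L 341) E E)) (B (B E (L 584) E) (B (L 825) E E) E) E) (B
   (B (B E (L 315) E) (B (L 475) E E) E) (B (B (L 160) E E) E E) E) E)) (B (B (B (B E E (B E (L
   313) E)) (B E (B E (L 1619) E) (B (L 836) E E)) (B (B E (L 594) E) (B (L 779) E E) E)) (B (B
   E (B E (L 2012) E) (B (L 1153) E E)) (B (B E (L 1873) E) (B (L 2603) E E) E) (B (B (L 338) E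
   E) E E)) (B (B (B E (L 413) E) (B (L 623) E E) E) (B (B (L 209) E E) E E) E)) (B (B (B E (B
   E (L 1365) E) (B (L 816) E E)) (B (B E (L 1448) E) (B (L 2088) E E) E) (B (B (L 329) E E) E
   E)) (B (B (B E (L 867) E) (B (L 1337) E E) E) (B (B (L 590) E E) E E) E) E) E) (B (B (B (B E
   (B E (L 182) E) E) (B (B E (L 215) E) (B (L 315) E E) E) E) (B (B (B E (L 122) E) (B (L 199)
   E E) E) E E) E) E E)) (B (B (B (B E (B E (B E (L 218) E) E) E) (B (B E (B E (L 369) E) (B (L
   225) E E)) (B (B E (L 371) E) (B (L 518) E E) E) E) E) (B (B (B E (B E (L 300) E) (B (L 189)
   E E)) (B (B E (L 345) E) (B (L 507) E E) E) E) (B (B (B E (L 226) E) (B (L 355) E E) E) (B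
   (B (L 128) E E) E E) E) E) E) (B (B (B E (B (B E (L 111) E) (B (L 111) E E) E) E) E E) E E)
   E)) (B (B (B (B E (B E (B E (B E (L 256) E) E) E) (B (B E (B E (L 115) E) E) E E)) (B (B E
   (B E (B E (L 459) E) (B (L 256) E E)) (B (B E (L 182) E) (B (L 182) E E) E)) (B (B E (B E (L
   569) E) (B (L 340) E E)) (B (B E (L 537) E) (B (L 736) E E) E) E) (B (B (B E (L 101) E) (B
   (L 101) E E) E) E E)) (B (B (B E (B E (L 168) E) (B (L 105) E E)) (B (B E (L 177) E) (B (L
   251) E E) E) E) (B (B E (B (L 71) E E) E) E E) E)) (B (B (B E (B E (B E (L 423) E) (B (L
   240) E E)) (B (B E (L 177) E) (B (L 177) E E) E)) (B (B E (B E (L 604) E) (B (L 370) E E))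
   (B (B E (L 622) E) (B (L 882) E E) E) (B (B (L 124) E E) E E)) (B (B (B E (L 151) E) (B (L
   232) E E) E) E E)) (B (B (B E (B E (L 467) E) (B (L 295) E E)) (B (B E (L 541) E) (B (L 801)
   E E) E) (B (B (L 135) E E) E E)) (B (B (B E (L 350) E) (B (L 552) E E) E) (B (B (L 255) E E)
   E E) E) E) E) E) (B (B (B (B E (B E (B E (L 209) E) E) (B (B E (L 90) E) E E)) (B (B E (B E
   (L 327) E) (B (L 200) E E)) (B (B E (L 351) E) (B (L 504) E E) E) E) (B (B (B E (L 95) E) (B
   (L 95) E E) E) E E)) (B (B (B E (B E (L 297) E) (B (L 189) E E)) (B (B E (L 357) E) (B (L
   534) E E) E) (B (B (L 94) E E) E E)) (B (B (B E (L 248) E) (B (L 396) E E) E) (B (B (L 148)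
   E E) E E) E) E) E) (B (B (B (B E (B E (L 143) E) E) (B (B E (L 190) E) (B (L 294) E E) E) E)
   (B (B (B E (L 150) E) (B (L 246) E E) E) (B (B (L 96) E E) E E) E) E) E E) E) E)) (B (B (B
   (B E (B E (B (B E E (B E (L 176) E)) (B E (B E (L 643) E) E) E) (B (B E (B E (L 196) E) E) E
   E)) (B (B E (B E (B E (L 310) E) E) E) (B (B E (B E (L 252) E) E) (B (B E (L 172) E) E E) E)
   E)) (B (B (B E E (B E (B E (L 197) E) E)) (B (B E E (B E (L 301) E)) (B E (B E (L 1214) E)
   (B (L 584) E E)) (B (B E (L 357) E) (B (L 357) E E) E)) (B (B E (B E (L 511) E) E) (B (B E
   (L 395) E) (B (L 516) E E) E) E)) (B (B (B E E (B E (L 326) E)) (B E (B E (L 1725) E) (B (L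
   952) E E)) (B (B E (L 668) E) (B (L 902) E E) E)) (B (B E (B E (L 1903) E) (B (L 1176) E E))
   (B (B E (L 1849) E) (B (L 2644) E E) E) E) (B (B (B E (L 313) E) (B (L 432) E E) E) E E)) (B
   (B (B E (B E (L 372) E) E) (B (B E (L 474) E) (B (L 724) E E) E) E) (B (B (B E (L 162) E) E
   E) E E) E)) (B (B (B E (B E (B E (L 488) E) (B (L 258) E E)) (B (B E (L 188) E) (B (L 188) E
   E) E)) (B (B E (B E (L 703) E) (B (L 454) E E)) (B (B E (L 762) E) (B (L 1135) E E) E) E) E)
   (B (B (B E (B E (L 440) E) (B (L 293) E E)) (B (B E (L 535) E) (B (L 834) E E) E) E) (B (B
   (B E (L 329) E) (B (L 544) E E) E) E E) E) E)) (B (B (B E (B (B E E (B E (L 267) E)) (B E (B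
   E (L 1269) E) (B (L 673) E E)) (B (B E (L 459) E) (B (L 459) E E) E)) (B (B E (B E (L 628)
   E) E) (B (B E (L 562) E) (B (L 798) E E) E) E)) (B (B (B E E (B E (L 342) E)) (B E (B E (L
   2062) E) (B (L 1201) E E)) (B (B E (L 881) E) (B (L 1231) E E) E)) (B (B E (B E (L 2544) E)
   (B (L 1652) E E)) (B (B E (L 2732) E) (B (L 4048) E E) E) (B (B (L 612) E E) E E)) (B (B (B
   E (L 602) E) (B (L 966) E E) E) (B (B (L 364) E E) E E) E)) (B (B (B E (B E (L 747) E) (B (L
   513) E E)) (B (B E (L 949) E) (B (L 1469) E E) E) E) (B (B (B E (L 585) E) (B (L 970) E E)
   E) (B (B (L 495) E E) E E) E) E)) (B (B (B (B E E (B E (L 257) E)) (B E (B E (L 1770) E) (B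
   (L 1078) E E)) (B (B E (L 827) E) (B (L 1186) E E) E)) (B (B E (B E (L 2566) E) (B (L 1738)
   E E)) (B (B E (L 3039) E) (B (L 4705) E E) E) (B (B (L 853) E E) E E)) (B (B (B E (L 810) E)
   (B (L 1386) E E) E) (B (B (L 748) E E) E E) E)) (B (B (B E (B E (L 1982) E) (B (L 1408) E
   E)) (B (B E (L 2735) E) (B (L 4443) E E) E) (B (B (L 981) E E) E E)) (B (B (B E (L 1935) E)
   (B (L 3434) E E) E) (B (B (L 2057) E E) E E) E) E) (B (B (B (B E (L 269) E) (B (L 510) E E)
   E) (B (B (L 291) E E) E E) E) E E)) (B (B (B (B E (B E (L 259) E) E) (B (B E (L 534) E) (B
   (L 880) E E) E) E) (B (B (B E (L 448) E) (B (L 820) E E) E) (B (B (L 538) E E) E E) E) E) (B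
   (B (B E (B (L 265) E E) E) E E) E E) E)) (B (B (B (B E (B E (B E (L 304) E) E) (B (B E (L
   137) E) E E)) (B (B E (B E (L 608) E) (B (L 432) E E)) (B (B E (L 807) E) (B (L 1275) E E)
   E) (B (B (L 241) E E) E E)) (B (B (B E (L 249) E) (B (L 420) E E) E) (B (B (L 170) E E) E E)
   E)) (B (B (B E (B E (L 570) E) (B (L 420) E E)) (B (B E (L 877) E) (B (L 1475) E E) E) (B (B
   (L 360) E E) E E)) (B (B (B E (L 701) E) (B (L 1284) E E) E) (B (B (L 831) E E) E E) E) E)
   E) (B (B (B (B E (B E (L 286) E) (B (L 214) E E)) (B (B E (L 476) E) (B (L 834) E E) E) (B
   (B (L 227) E E) E E)) (B (B (B E (L 450) E) (B (L 848) E E) E) (B (B (L 589) E E) E E) E) E)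
   (B (B (B (B E (L 224) E) (B (L 451) E E) E) (B (B (L 356) E E) E E) E) E E) E) E)) (B (B (B
   (B E (B E (B E (B E (L 675) E) (B (L 345) E E)) (B (B E (L 233) E) E E)) (B (B E (B E (L
   330) E) E) (B (B E (L 299) E) (B (L 410) E E) E) E)) (B (B (B E E (B E (L 198) E)) (B E (B E
   (L 1385) E) (B (L 847) E E)) (B (B E (L 652) E) (B (L 937) E E) E)) (B (B E (B E (L 1896) E)
   (B (L 1288) E E)) (B (B E (L 2217) E) (B (L 3420) E E) E) (B (B (L 598) E E) E E)) (B (B (B
   E (L 543) E) (B (L 929) E E) E) (B (B (L 385) E E) E E) E)) (B (B (B E (B E (L 613) E) (B (L
   446) E E)) (B (B E (L 858) E) (B (L 1401) E E) E) E) (B (B (B E (L 570) E) (B (L 1018) E E)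
   E) (B (B (L 610) E E) E E) E) E)) (B (B (B E (B E (B E (L 1411) E) (B (L 903) E E)) (B (B E
   (L 721) E) (B (L 1064) E E) E)) (B (B E (B E (L 2267) E) (B (L 1606) E E)) (B (B E (L 2930)
   E) (B (L 4716) E E) E) (B (B (L 962) E E) E E)) (B (B (B E (L 865) E) (B (L 1545) E E) E) (B
   (B (L 915) E E) E E) E)) (B (B (B E (B E (L 1955) E) (B (L 1449) E E)) (B (B E (L 2953) E)
   (B (L 5000) E E) E) (B (B (L 1236) E E) E E)) (B (B (B E (L 2294) E) (B (L 4282) E E) E) (B
   (B (L 2837) E E) E E) E) (B (B (B (L 387) E E) E E) E E)) (B (B (B (B E (L 405) E) (B (L
   810) E E) E) (B (B (L 630) E E) E E) E) (B (B (B (L 153) E E) E E) E E) E)) (B (B (B (B E (B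
   E (L 424) E) (B (L 326) E E)) (B (B E (L 724) E) (B (L 1286) E E) E) (B (B (L 360) E E) E
   E)) (B (B (B E (L 673) E) (B (L 1319) E E) E) (B (B (L 967) E E) E E) E) E) (B (B (B (B E (L
   332) E) (B (L 712) E E) E) (B (B (L 609) E E) E E) E) (B (B (B (L 276) E E) E E) E E) E) E))
   (B (B (B (B E (B E (B E (L 818) E) (B (L 553) E E)) (B (B E (L 470) E) (B (L 710) E E) E))
   (B (B E (B E (L 1522) E) (B (L 1131) E E)) (B (B E (L 2156) E) (B (L 3585) E E) E) (B (B (L
   807) E E) E E)) (B (B (B E (L 705) E) (B (L 1304) E E) E) (B (B (L 829) E E) E E) E)) (B (B
   (B E (B E (L 1549) E) (B (L 1192) E E)) (B (B E (L 2556) E) (B (L 4486) E E) E) (B (B (L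
   1219) E E) E E)) (B (B (B E (L 2192) E) (B (L 4262) E E) E) (B (B (L 3081) E E) E E) E) (B
   (B (B (L 502) E E) E E) E E)) (B (B (B (B E (L 476) E) (B (L 992) E E) E) (B (B (L 847) E E)
   E E) E) (B (B (B (L 403) E E) E E) E E) E)) (B (B (B (B E (B E (L 942) E) (B (L 744) E E))
   (B (B E (L 1712) E) (B (L 3123) E E) E) (B (B (L 937) E E) E E)) (B (B (B E (L 1707) E) (B
   (L 3470) E E) E) (B (B (L 2753) E E) E E) E) (B (B (B (L 552) E E) E E) E E)) (B (B (B (B E
   (L 1020) E) (B (L 2201) E E) E) (B (B (L 2011) E E) E E) E) (B (B (B (L 1116) E E) E E) E E)
   E) E) (B (B (B (B E (B (L 182) E E) E) (B (B (L 215) E E) E E) E) (B (B (B (L 122) E E) E E)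
   E E) E) E E)) (B (B (B (B E (B E (B (L 372) E E) E) E) (B (B (B E (L 234) E) (B (L 550) E E)
   E) (B (B (L 504) E E) E E) E) E) (B (B (B E (B (L 403) E E) E) (B (B (L 429) E E) E E) E) (B
   (B (B (L 226) E E) E E) E E) E) E) (B (B (B E (B (B (L 111) E E) E E) E) E E) E E) E)) (B (B
   (B (B E (B E (B (B E (L 285) E) (B (L 505) E E) E) E) (B (B E (B (L 115) E E) E) E E)) (B (B
   (B E (B E (L 172) E) (B (L 172) E E)) (B (B E (L 434) E) (B (L 847) E E) E) (B (B (L 277) E
   E) E E)) (B (B (B E (L 441) E) (B (L 938) E E) E) (B (B (L 756) E E) E E) E) (B (B (B (L
   101) E E) E E) E E)) (B (B (B E (B (L 168) E E) E) (B (B (L 177) E E) E E) E) (B (B (B (L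
   71) E E) E E) E E) E)) (B (B (B E (B (B E (L 353) E) (B (L 720) E E) E) (B (B (L 256) E E) E
   E)) (B (B (B E (L 415) E) (B (L 931) E E) E) (B (B (L 836) E E) E E) E) (B (B (B (L 151) E
   E) E E) E E)) (B (B (B (B E (L 267) E) (B (L 658) E E) E) (B (B (L 691) E E) E E) E) (B (B
   (B (L 404) E E) E E) E E) E) E) E) (B (B (B (B E (B E (B (L 209) E E) E) (B (B (L 90) E E) E
   E)) (B (B (B E (L 173) E) (B (L 421) E E) E) (B (B (L 398) E E) E E) E) (B (B (B (L 95) E E)
   E E) E E)) (B (B (B E (B (L 297) E E) E) (B (B (L 357) E E) E E) E) (B (B (B (L 248) E E) E
   E) E E) E) E) (B (B (B (B E (B (L 143) E E) E) (B (B (L 190) E E) E E) E) (B (B (B (L 150) E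
   E) E E) E E) E) E E) E) E)) (B (B (B (B E (B E (B (B E (B E (L 362) E) (B (L 296) E E)) (B
   (B E (L 572) E) (B (L 964) E E) E) (B (B (L 145) E E) E E)) (B (B E (B (L 196) E E) E) E E))
   (B (B E (B (B E (L 219) E) (B (L 407) E E) E) E) (B (B (B E (L 126) E) (B (L 252) E E) E) (B
   (B (L 172) E E) E E) E) E)) (B (B (B E (B E (B E (L 186) E) (B (L 186) E E)) (B (B E (L 186)
   E) (B (L 270) E E) E)) (B (B E (B E (L 582) E) (B (L 484) E E)) (B (B E (L 988) E) (B (L
   1765) E E) E) (B (B (L 465) E E) E E)) (B (B (B E (L 353) E) (B (L 705) E E) E) (B (B (L
   472) E E) E E) E)) (B (B (B E (B E (L 602) E) (B (L 513) E E)) (B (B E (L 1169) E) (B (L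
   2208) E E) E) (B (B (L 686) E E) E E)) (B (B (B E (L 1046) E) (B (L 2207) E E) E) (B (B (L
   1753) E E) E E) E) (B (B (B (L 252) E E) E E) E E)) (B (B (B E (B (L 457) E E) E) (B (B (L
   434) E E) E E) E) (B (B (B (L 162) E E) E E) E E) E)) (B (B (B E (B (B E (L 300) E) (B (L
   629) E E) E) (B (B (L 232) E E) E E)) (B (B (B E (L 323) E) (B (L 760) E E) E) (B (B (L 696)
   E E) E E) E) E) (B (B (B (B E (L 177) E) (B (L 417) E E) E) (B (B (L 459) E E) E E) E) (B (B
   (B (L 257) E E) E E) E E) E) E)) (B (B (B E (B (B E (B E (L 487) E) (B (L 415) E E)) (B (B E
   (L 899) E) (B (L 1673) E E) E) (B (B (L 482) E E) E E)) (B (B (B E (L 353) E) (B (L 732) E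
   E) E) (B (B (L 523) E E) E E) E)) (B (B (B E (B E (L 593) E) (B (L 517) E E)) (B (B E (L
   1253) E) (B (L 2463) E E) E) (B (B (L 833) E E) E E)) (B (B (B E (L 1245) E) (B (L 2742) E
   E) E) (B (B (L 2360) E E) E E) E) (B (B (B (L 458) E E) E E) E E)) (B (B (B (B E (L 297) E)
   (B (L 725) E E) E) (B (B (L 749) E E) E E) E) (B (B (B (L 386) E E) E E) E E) E)) (B (B (B
   (B E (B E (L 370) E) (B (L 370) E E)) (B (B E (L 969) E) (B (L 1991) E E) E) (B (B (L 735) E
   E) E E)) (B (B (B E (L 1120) E) (B (L 2593) E E) E) (B (B (L 2446) E E) E E) E) (B (B (B (L
   578) E E) E E) E E)) (B (B (B (B E (L 744) E) (B (L 1859) E E) E) (B (B (L 2038) E E) E E)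
   E) (B (B (B (L 1304) E E) E E) E E) E) (B (B (B (B (L 163) E E) E E) E E) E E)) (B (B (B (B
   E (B (L 259) E E) E) (B (B (L 341) E E) E E) E) (B (B (B (L 265) E E) E E) E E) E) E E)) (B
   (B (B (B E (B E (B (L 304) E E) E) (B (B (L 137) E E) E E)) (B (B (B E (L 176) E) (B (L 481)
   E E) E) (B (B (L 542) E E) E E) E) (B (B (B (L 151) E E) E E) E E)) (B (B (B E (B (L 434) E
   E) E) (B (B (L 556) E E) E E) E) (B (B (B (L 407) E E) E E) E E) E) E) (B (B (B (B E (B (L
   211) E E) E) (B (B (L 300) E E) E E) E) (B (B (B (L 256) E E) E E) E E) E) (B (B (B (B (L
   116) E E) E E) E E) E E) E) E)) (B (B (B (B E (B E (B (B E (L 418) E) (B (L 851) E E) E) (B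
   (B (L 233) E E) E E)) (B (B E (B (L 406) E E) E) (B (B (L 299) E E) E E) E)) (B (B (B E (B E
   (L 271) E) (B (L 271) E E)) (B (B E (L 715) E) (B (L 1495) E E) E) (B (B (L 561) E E) E E))
   (B (B (B E (L 775) E) (B (L 1833) E E) E) (B (B (L 1724) E E) E E) E) (B (B (B (L 340) E E)
   E E) E E)) (B (B (B E (B (L 544) E E) E) (B (B (L 590) E E) E E) E) (B (B (B (L 349) E E) E
   E) E E) E)) (B (B (B E (B (B E (L 633) E) (B (L 1412) E E) E) (B (B (L 582) E E) E E)) (B (B
   (B E (L 811) E) (B (L 2040) E E) E) (B (B (L 2117) E E) E E) E) (B (B (B (L 553) E E) E E) E
   E)) (B (B (B (B E (L 611) E) (B (L 1640) E E) E) (B (B (L 1964) E E) E E) E) (B (B (B (L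
   1361) E E) E E) E E) E) (B (B (B (B (L 211) E E) E E) E E) E E)) (B (B (B (B E (B (L 298) E
   E) E) (B (B (L 418) E E) E E) E) (B (B (B (L 357) E E) E E) E E) E) (B (B (B (B (L 170) E E)
   E E) E E) E E) E)) (B (B (B (B E (B E (B (L 783) E E) E) (B (B (L 313) E E) E E)) (B (B (B E
   (L 471) E) (B (L 1274) E E) E) (B (B (L 1441) E E) E E) E) (B (B (B (L 395) E E) E E) E E))
   (B (B (B E (B (L 1204) E E) E) (B (B (L 1567) E E) E E) E) (B (B (B (L 1202) E E) E E) E E)
   E) (B (B (B (B (L 232) E E) E E) E E) E E)) (B (B (B (B E (B (L 628) E E) E) (B (B (L 928) E
   E) E E) E) (B (B (B (L 848) E E) E E) E E) E) (B (B (B (B (L 470) E E) E E) E E) E E) E) E)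
   E) (B (B (B (B E (B E (B (B (L 156) E E) E E) E) E) (B (B E (B (B (L 232) E E) E E) E) (B (B
   (B (L 212) E E) E E) E E) E) E) (B (B (B E (B (B (L 170) E E) E E) E) (B (B (B (L 180) E E)
   E E) E E) E) E E) E) E E))"

definition good_weight :: "nat list \<Rightarrow> int \<Rightarrow> bool" where
  "good_weight s w \<longleftrightarrow> 0 \<le> w \<and> w \<le> 5000 \<and> settles 21 s \<and>
     11851 * w \<le> 5000 * sum_list (map (look weights) (steps s))"

lemma good_weights: "entries good_weight [] weights"
  by code_simp

fun walks :: "nat \<Rightarrow> nat list \<Rightarrow> nat list list set" where
  "walks 0 s = (if settled s then {[s]} else {})"
| "walks (Suc k) s = (\<Union>s'\<in>set (steps s). (#) s ` walks k s')"

lemma distinct_steps: "distinct (steps s)"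
  by (cases s rule: steps.cases) (auto simp: choices_def)

lemma steps_length: "s' \<in> set (steps s) \<Longrightarrow> length s = 9 \<and> length s' = 9"
  by (cases s rule: steps.cases) (auto simp: choices_def split: if_splits)

lemma finite_walks: "finite (walks k s)"
  by (induction k arbitrary: s) auto

lemma walks_hd: "ws \<in> walks k s \<Longrightarrow> \<exists>r. ws = s # r"
  by (cases k) (auto split: if_splits)

lemma card_walks_Suc: "card (walks (Suc k) s) = sum_list (map (\<lambda>s'. card (walks k s')) (steps s))"
proof -
  have "card (walks (Suc k) s) = (\<Sum>s'\<in>set (steps s). card ((#) s ` walks k s'))"
    unfolding walks.simps
  proof (rule card_UN_disjoint)
    show "\<forall>s'\<in>set (steps s). \<forall>s''\<in>set (steps s). s' \<noteq> s'' \<longrightarrow>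
        (#) s ` walks k s' \<inter> (#) s ` walks k s'' = {}"
      by (auto dest!: walks_hd)
  qed (simp_all add: finite_walks)
  also have "\<dots> = (\<Sum>s'\<in>set (steps s). card (walks k s'))"
    by (simp add: card_image)
  finally show ?thesis by (simp add: sum_list_distinct_conv_sum_set[OF distinct_steps])
qed

lemma walks_elim:
  "ws \<in> walks k s \<Longrightarrow> length ws = Suc k \<and> ws ! 0 = s \<and> settled (ws ! k) \<and>
     (\<forall>j<k. ws ! Suc j \<in> set (steps (ws ! j)))"
proof (induction k arbitrary: s ws)
  case (Suc k)
  then obtain s' us where us: "s' \<in> set (steps s)" "us \<in> walks k s'" "ws = s # us" by auto
  show ?case
    using Suc.IH[OF us(2)] us by (auto simp: nth_Cons split: nat.split)
qed (auto split: if_splits)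

lemma length_walk_entry:
  assumes "ws \<in> walks k s" "j \<le> k"
  shows "length (ws ! j) = 9"
  using walks_elim[OF assms(1)] assms(2) steps_length[of "ws ! Suc j" "ws ! j"]
  by (cases "j = k") (auto simp: settled_def)

lemma steps_nth:
  assumes "s' \<in> set (steps s)"
  shows "1 \<le> i \<Longrightarrow> i \<le> 6 \<Longrightarrow> s' ! (i + 1) = s ! i"
    and "s' ! 1 \<le> s ! 0 \<and> s ! 0 \<le> s' ! 1 + 1"
    and "s' ! 8 \<le> s ! 7 \<and> s ! 7 \<le> s' ! 8 + 1"
    and "s ! 8 \<le> 1"
    and "s' ! 0 = s ! 8 + (s ! 0 - s' ! 1) + (s ! 7 - s' ! 8)"
proof -
  obtain a b c d e f g h i' x y where s: "s = [a, b, c, d, e, f, g, h, i']" "i' \<le> 1"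
    "s' = [i' + x + y, a - x, b, c, d, e, f, g, h - y]" "x \<in> set (choices a)" "y \<in> set (choices h)"
    using assms by (cases s rule: steps.cases) (auto split: if_splits)
  have xy: "x \<le> 1 \<and> x \<le> a" "y \<le> 1 \<and> y \<le> h"
    using s(4,5) by (auto simp: choices_def split: if_splits)
  show "s' ! (i + 1) = s ! i" if "1 \<le> i" "i \<le> 6"
  proof -
    have "i = 1 \<or> i = 2 \<or> i = 3 \<or> i = 4 \<or> i = 5 \<or> i = 6" using that by linarith
    then show ?thesis using s(1,3) by (elim disjE) simp_all
  qed
  show "s' ! 1 \<le> s ! 0 \<and> s ! 0 \<le> s' ! 1 + 1" "s' ! 8 \<le> s ! 7 \<and> s ! 7 \<le> s' ! 8 + 1"
    "s ! 8 \<le> 1" "s' ! 0 = s ! 8 + (s ! 0 - s' ! 1) + (s ! 7 - s' ! 8)"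
    using s(1-3) xy by auto
qed

definition origin :: "nat list" where "origin = [1, 1, 1, 1, 1, 1, 0, 0, 0]"

lemma spiral_walk_of_walk:
  assumes ws: "ws \<in> walks k origin" and k: "11 \<le> k"
  shows "spiral_walk (k + 9) (\<lambda>t i. ws ! (t - 9) ! i)"
proof
  note w = walks_elim[OF ws]
  have step: "ws ! (t + 1 - 9) \<in> set (steps (ws ! (t - 9)))" if "9 \<le> t" "t < k + 9" for t
  proof -
    have "t + 1 - 9 = Suc (t - 9)" "t - 9 < k" using that by simp_all
    then show ?thesis using w by simp
  qed
  show "20 \<le> k + 9" using k by simp
  show "ws ! (9 - 9) ! i = (if i < 6 then 1 else 0)" if "i < 9" for i
  proof -
    have "i \<in> {0, 1, 2, 3, 4, 5, 6, 7, 8}" using that by auto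
    then show ?thesis using w by (auto simp: origin_def)
  qed
  show "ws ! (t + 1 - 9) ! (i + 1) = ws ! (t - 9) ! i" if "9 \<le> t" "t < k + 9" "1 \<le> i" "i \<le> 6" for t i
    using steps_nth(1)[OF step[OF that(1,2)] that(3,4)] .
  show "ws ! (t + 1 - 9) ! 1 \<le> ws ! (t - 9) ! 0 \<and> ws ! (t - 9) ! 0 \<le> ws ! (t + 1 - 9) ! 1 + 1"
    if "9 \<le> t" "t < k + 9" for t using steps_nth(2)[OF step[OF that]] .
  show "ws ! (t + 1 - 9) ! 8 \<le> ws ! (t - 9) ! 7 \<and> ws ! (t - 9) ! 7 \<le> ws ! (t + 1 - 9) ! 8 + 1"
    if "9 \<le> t" "t < k + 9" for t using steps_nth(3)[OF step[OF that]] .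
  show "ws ! (t - 9) ! 8 \<le> 1" if "9 \<le> t" "t < k + 9" for t using steps_nth(4)[OF step[OF that]] .
  show "ws ! (t + 1 - 9) ! 0 = ws ! (t - 9) ! 8 + (ws ! (t - 9) ! 0 - ws ! (t + 1 - 9) ! 1) +
      (ws ! (t - 9) ! 7 - ws ! (t + 1 - 9) ! 8)"
    if "9 \<le> t" "t < k + 9" for t using steps_nth(5)[OF step[OF that]] .
  have set: "length (ws ! k) = 9" "list_all (\<lambda>r. r \<le> 1) (ws ! k)" "sum_list (ws ! k) = 6"
    using w by (auto simp: settled_def)
  show "ws ! (k + 9 - 9) ! i \<le> 1" if "i < 9" for i
    using set that by (simp add: list_all_length)
  show "(\<Sum>i<9. ws ! (k + 9 - 9) ! i) = 6"
    using set by (simp add: sum_list_sum_nth atLeast0LessThan)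
qed

lemma card_walks_le_schnyder_woods:
  assumes k: "11 \<le> k" and ne: "walks k origin \<noteq> {}"
  shows "\<exists>(T, a) \<in> triangulations (k + 10). card (walks k origin) \<le> card (schnyder_woods T a)"
proof -
  let ?R = "\<lambda>ws t i. ws ! (t - 9) ! i"
  let ?T = "list_map (Suc (k + 9)) (spiral (k + 9)) (2, Suc 0)"
  obtain ws0 where "ws0 \<in> walks k origin" using ne by auto
  then interpret w0: spiral_walk "k + 9" "?R ws0" by (rule spiral_walk_of_walk[OF _ k])
  have "inj_on (\<lambda>ws. spiral_walk.wood (k + 9) (?R ws)) (walks k origin)"
  proof (rule inj_onI)
    fix ws ws' assume ws: "ws \<in> walks k origin" "ws' \<in> walks k origin"
      and eq: "spiral_walk.wood (k + 9) (?R ws) = spiral_walk.wood (k + 9) (?R ws')"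
    show "ws = ws'"
    proof (rule nth_equalityI)
      show "length ws = length ws'" using walks_elim ws by metis
      fix j assume "j < length ws"
      then have j: "j \<le> k" using walks_elim[OF ws(1)] by simp
      show "ws ! j = ws' ! j"
      proof (rule nth_equalityI)
        show "length (ws ! j) = length (ws' ! j)" using length_walk_entry ws j by simp
        fix i assume "i < length (ws ! j)"
        then have "i < 9" using length_walk_entry[OF ws(1) j] by simp
        then show "ws ! j ! i = ws' ! j ! i"
          using walk_determined[OF spiral_walk_of_walk[OF ws(1) k] spiral_walk_of_walk[OF ws(2) k] eq,
              of "j + 9" i] j by simp
      qed
    qed
  qed
  moreover have "(\<lambda>ws. spiral_walk.wood (k + 9) (?R ws)) ` walks k origin \<subseteq> schnyder_woods ?T corners"
    using spiral_walk.wood_schnyder[OF spiral_walk_of_walk[OF _ k]] by auto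
  ultimately have "card (walks k origin) \<le> card (schnyder_woods ?T corners)"
    by (rule card_inj_on_le[OF _ _ w0.finite_schnyder_woods])
  moreover have "(?T, corners) \<in> triangulations (k + 10)"
  proof -
    have "triangulation ?T corners" by (rule w0.triangulation_axioms)
    moreover have "card (vertices ?T) = k + 10" unfolding w0.M_simps(1) by simp
    ultimately show ?thesis by (simp add: triangulations_def triangulation_def)
  qed
  ultimately show ?thesis by blast
qed

lemma settled_step:
  assumes "settled s"
  shows "\<exists>s' \<in> set (steps s). settled s'"
proof -
  have "length s = 9" using assms by (simp add: settled_def)
  then obtain a b c d e f g h i where s: "s = [a, b, c, d, e, f, g, h, i]"
    by (auto simp: numeral_eq_Suc length_Suc_conv)
  have "[i, a, b, c, d, e, f, g, h] \<in> set (steps s)"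
    using assms unfolding s by (auto simp: settled_def choices_def)
  moreover have "settled [i, a, b, c, d, e, f, g, h]"
    using assms unfolding s by (auto simp: settled_def)
  ultimately show ?thesis by blast
qed

lemma settled_walks: "settled s \<Longrightarrow> walks k s \<noteq> {}"
proof (induction k arbitrary: s)
  case (Suc k)
  then show ?case using settled_step[OF Suc.prems] by fastforce
qed simp

lemma settles_walks: "settles k s \<Longrightarrow> walks k s \<noteq> {}"
proof (induction k s rule: settles.induct)
  case (2 k a b c d e f g h i)
  let ?s = "[a, b, c, d, e, f, g, h, i]"
  let ?s' = "[i + of_bool (2 \<le> a) + of_bool (2 \<le> h), a - of_bool (2 \<le> a), b, c, d, e, f, g,
    h - of_bool (2 \<le> h)]"
  show ?case
  proof (cases "settled ?s")
    case True
    then show ?thesis using settled_walks[of ?s "Suc k"] by blast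
  next
    case False
    then have "?s' \<in> set (steps ?s)" "settles k ?s'" using 2(2) by (auto simp: choices_def)
    moreover have "walks k ?s' \<noteq> {}" using 2 False by simp
    ultimately show ?thesis unfolding walks.simps by blast
  qed
qed auto

lemma weights_step: "11851 * look weights s \<le> 5000 * sum_list (map (look weights) (steps s))"
  and weights_settle: "look weights s \<noteq> 0 \<Longrightarrow> settles 21 s"
  and weights_bounds: "0 \<le> look weights s" "look weights s \<le> 5000"
proof -
  have good: "good_weight s (look weights s)" if "look weights s \<noteq> 0" for s
    using entries_look[OF good_weights that] by simp
  show nonneg: "0 \<le> look weights s" "look weights s \<le> 5000" for s
    using good[of s] by (cases "look weights s = 0"; simp add: good_weight_def)+
  show "settles 21 s" if "look weights s \<noteq> 0" using good[OF that] by (simp add: good_weight_def)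
  have "0 \<le> sum_list (map (look weights) (steps s))" by (rule sum_list_nonneg) (use nonneg in auto)
  then show "11851 * look weights s \<le> 5000 * sum_list (map (look weights) (steps s))"
    using good[of s] by (cases "look weights s = 0") (auto simp: good_weight_def)
qed

lemma weights_le_card_walks:
  "11851 ^ k * look weights s \<le> 5000 ^ (k + 1) * int (card (walks (k + 21) s))"
proof (induction k arbitrary: s)
  case 0
  show ?case
  proof (cases "look weights s = 0")
    case False
    then have "0 < card (walks 21 s)"
      using settles_walks[OF weights_settle] finite_walks by (simp add: card_gt_0_iff)
    then show ?thesis using weights_bounds(2)[of s] by simp
  qed simp
next
  case (Suc k)
  have "11851 ^ Suc k * look weights s = 11851 ^ k * (11851 * look weights s)" by simp
  also have "\<dots> \<le> 11851 ^ k * (5000 * sum_list (map (look weights) (steps s)))"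
    by (intro mult_left_mono weights_step) simp
  also have "\<dots> = 5000 * sum_list (map (\<lambda>s'. 11851 ^ k * look weights s') (steps s))"
    by (simp add: sum_list_const_mult)
  also have "\<dots> \<le> 5000 * sum_list (map (\<lambda>s'. 5000 ^ (k + 1) * int (card (walks (k + 21) s'))) (steps s))"
    by (intro mult_left_mono sum_list_mono Suc.IH) simp
  also have "\<dots> = 5000 ^ (Suc k + 1) * int (card (walks (Suc k + 21) s))"
    unfolding add_Suc card_walks_Suc
    by (simp add: sum_list_const_mult sum_list_of_nat[symmetric] comp_def)
  finally show ?case .
qed

lemma card_walks_growth: "2.3702 ^ k \<le> 5000 * real (card (walks (k + 21) origin))"
proof -
  have "(1 :: int) \<le> look weights origin" by code_simp
  then have "11851 ^ k * 1 \<le> 11851 ^ k * look weights origin" by (intro mult_left_mono) simp_all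
  also have "\<dots> \<le> 5000 ^ (k + 1) * int (card (walks (k + 21) origin))" by (rule weights_le_card_walks)
  finally have "real_of_int (11851 ^ k) \<le> real_of_int (5000 ^ (k + 1) * int (card (walks (k + 21) origin)))"
    by (simp only: of_int_le_iff)
  then have "11851 ^ k \<le> 5000 ^ k * (5000 * real (card (walks (k + 21) origin)))" by (simp add: mult_ac)
  then have "(11851 / 5000) ^ k \<le> 5000 * real (card (walks (k + 21) origin))"
    by (simp add: power_divide divide_le_eq mult_ac)
  then show ?thesis by simp
qed

lemma eventually_power_le:
  fixes a b C :: real
  assumes "1 \<le> a" "a < b"
  shows "\<exists>K. \<forall>k\<ge>K. C * a ^ k \<le> b ^ k"
proof -
  have "1 < b / a" using assms by simp
  then obtain K where K: "C < (b / a) ^ K" using real_arch_pow by blast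
  have "C * a ^ k \<le> b ^ k" if "K \<le> k" for k
  proof -
    have "(b / a) ^ K \<le> (b / a) ^ k" using that \<open>1 < b / a\<close> by (intro power_increasing) auto
    then have "C \<le> b ^ k / a ^ k" using K by (simp add: power_divide)
    then show ?thesis using assms by (simp add: le_divide_eq)
  qed
  then show ?thesis by blast
qed

lemma triangulation_of_triangulations:
  assumes "(T, a) \<in> triangulations n"
  shows "triangulation T a" "card (vertices T) = n"
  using assms by (auto simp: triangulations_def triangulation_def)

lemma finite_counts: "finite ((\<lambda>(T, a). card (schnyder_woods T a)) ` triangulations n)" (is "finite ?C")
proof -
  have "?C \<subseteq> {.. nat \<lfloor>(3.56 :: real) ^ n\<rfloor>}"
  proof clarsimp
    fix T a assume "(T, a) \<in> triangulations n"
    from triangulation.card_schnyder_woods_le[OF triangulation_of_triangulations(1)[OF this]]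
      triangulation_of_triangulations(2)[OF this]
    show "card (schnyder_woods T a) \<le> nat \<lfloor>(89 / 25 :: real) ^ n\<rfloor>" by (simp add: le_nat_floor)
  qed
  then show ?thesis by (rule finite_subset) simp
qed

theorem theorem6:
  shows "(\<exists>N. \<forall>n \<ge> N. (2.37::real) ^ n
             \<le> real (MAX (T, a) \<in> triangulations n. card (schnyder_woods T a))) \<and>
         (\<forall>n \<ge> 3. real (MAX (T, a) \<in> triangulations n. card (schnyder_woods T a))
             \<le> (3.56::real) ^ n)"
proof
  let ?C = "\<lambda>n. (\<lambda>(T, a). card (schnyder_woods T a)) ` triangulations n"
  obtain K where K: "\<And>k. K \<le> k \<Longrightarrow> (5000 * 2.37 ^ 31) * 2.37 ^ k \<le> (2.3702 :: real) ^ k"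
    using eventually_power_le[of "2.37" "2.3702" "5000 * 2.37 ^ 31"] by auto
  show "\<exists>N. \<forall>n\<ge>N. (2.37 :: real) ^ n \<le> real (Max (?C n))"
  proof (intro exI allI impI)
    fix n assume n: "K + 31 \<le> n"
    define k where "k = n - 31"
    have n_eq: "n = k + 31" and k: "K \<le> k" using n by (simp_all add: k_def)
    have "5000 * (2.37 :: real) ^ n = (5000 * 2.37 ^ 31) * 2.37 ^ k"
      unfolding n_eq power_add by (simp only: mult_ac)
    also have "\<dots> \<le> 2.3702 ^ k" by (rule K[OF k])
    also have "\<dots> \<le> 5000 * real (card (walks (k + 21) origin))" by (rule card_walks_growth)
    finally have le: "2.37 ^ n \<le> real (card (walks (k + 21) origin))" by simp
    moreover have "0 < (2.37 :: real) ^ n" by simp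
    ultimately have "walks (k + 21) origin \<noteq> {}" by (metis card.empty not_le of_nat_0)
    then obtain T a where "(T, a) \<in> triangulations n" "card (walks (k + 21) origin) \<le> card (schnyder_woods T a)"
      using card_walks_le_schnyder_woods[of "k + 21"] n_eq by (auto simp: add.assoc)
    moreover from this(1) have "card (schnyder_woods T a) \<le> Max (?C n)"
      by (intro Max_ge finite_counts) force
    ultimately have "card (walks (k + 21) origin) \<le> Max (?C n)" by linarith
    then show "2.37 ^ n \<le> real (Max (?C n))" using le by linarith
  qed
  show "\<forall>n\<ge>3. real (Max (?C n)) \<le> 3.56 ^ n"
  proof (intro allI impI)
    fix n :: nat assume "3 \<le> n"
    then have "Max (?C n) \<in> ?C n" by (intro Max_in finite_counts) (simp add: triangulations_nonempty)
    then obtain T a where "(T, a) \<in> triangulations n" "Max (?C n) = card (schnyder_woods T a)" by auto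
    then show "real (Max (?C n)) \<le> 3.56 ^ n"
      using triangulation.card_schnyder_woods_le[OF triangulation_of_triangulations(1)]
        triangulation_of_triangulations(2) by metis
  qed
qed

end
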